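(* Let $G$ be a fixed graph with $\mathsf{mtw}(G) = t$. Then, given an $m$-edge host graph $H$ as input, an arithmetic circuit computing the homomorphism polynomial $\mathsf{Hom}_G[H]$ can be constructed in $\widetilde{O}(m^{\lceil (t+1)/2 \rceil})$ time.
   Context: A tree decomposition of $G$ is a tree $T$ with bags $B(t)\subseteq V(G)$ such that every edge of $G$ lies in some bag and, for each vertex, the bags containing it form a nonempty connected subtree; its width is the maximum bag size minus one. A bag is matched if the subgraph of $G$ induced by the bag has a perfect matching, or has a matching leaving exactly one vertex $v$ of the bag unmatched with $v$ adjacent to some matched vertex. A matched tree decomposition is one all of whose bags are matched; the matched treewidth $\mathsf{mtw}(G)$ is the minimum width of a matched tree decomposition. The homomorphism polynomial is $\mathsf{Hom}_G[H]=\sum_{\phi}\prod_{u\in V(G)} y_{\phi(u)}\prod_{uv\in E(G)} x_{\{\phi(u),\phi(v)\}}$, where $\phi$ ranges over homomorphisms from $G$ to $H$ (maps $V(G)\to V(H)$ sending edges to edges), and the $y_w$ ($w\in V(H)$) and $x_e$ ($e\in E(H)$) are variables. An arithmetic circuit is a DAG with $+$ and $\times$ internal gates, leaves labelled by variables or constants, and a designated output gate. Model: unit-cost RAM; host given with $\widetilde{O}(1)$ adjacency queries and $\widetilde{O}(m)$ ordered edge iteration; $\widetilde{O}$ hides polylogarithmic factors in the input size. *)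

theory Defs
  imports
    Complex_Main
    "HOL-Library.FuncSet"
    "HOL-Library.Poly_Mapping"
    "HOL-Library.Product_Lexorder"
begin

section \<open>Graphs, trees and matched treewidth\<close>

record 'a ugraph =
  verts :: "'a set"
  edges :: "'a set set"

definition simple_graph :: "'a ugraph \<Rightarrow> bool" where
  "simple_graph G \<longleftrightarrow> finite (verts G) \<and> (\<forall>e\<in>edges G. e \<subseteq> verts G \<and> card e = 2)"

definition connected_in :: "'a ugraph \<Rightarrow> 'a set \<Rightarrow> bool" where
  "connected_in G S \<longleftrightarrow> S \<noteq> {} \<and>
     (\<forall>u\<in>S. \<forall>v\<in>S. (u, v) \<in> {(x, y). x \<in> S \<and> y \<in> S \<and> {x, y} \<in> edges G}\<^sup>*)"

definition is_cycle :: "'a ugraph \<Rightarrow> 'a list \<Rightarrow> bool" where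
  "is_cycle G c \<longleftrightarrow> length c \<ge> 3 \<and> distinct c \<and>
     (\<forall>i<length c. {c ! i, c ! (Suc i mod length c)} \<in> edges G)"

definition is_tree :: "'a ugraph \<Rightarrow> bool" where
  "is_tree T \<longleftrightarrow> simple_graph T \<and> connected_in T (verts T) \<and> (\<nexists>c. is_cycle T c)"

text \<open>Decomposition trees have natural numbers as nodes; every finite tree is isomorphic to one of
  these.  Nonemptiness of the subtree of each vertex is part of \<^const>\<open>connected_in\<close>.\<close>

definition tree_decomposition :: "'a ugraph \<Rightarrow> nat ugraph \<Rightarrow> (nat \<Rightarrow> 'a set) \<Rightarrow> bool" where
  "tree_decomposition G T B \<longleftrightarrow>
     is_tree T \<and>
     (\<forall>x\<in>verts T. B x \<subseteq> verts G) \<and>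
     (\<forall>e\<in>edges G. \<exists>x\<in>verts T. e \<subseteq> B x) \<and>
     (\<forall>v\<in>verts G. connected_in T {x \<in> verts T. v \<in> B x})"

text \<open>The width is an integer because the graph without vertices has a decomposition of width
  \<open>-1\<close>.\<close>

definition td_width :: "nat ugraph \<Rightarrow> (nat \<Rightarrow> 'a set) \<Rightarrow> int" where
  "td_width T B = int (Max ((\<lambda>x. card (B x)) ` verts T)) - 1"

definition is_matching :: "'a ugraph \<Rightarrow> 'a set \<Rightarrow> 'a set set \<Rightarrow> bool" where
  "is_matching G S M \<longleftrightarrow>
     M \<subseteq> {e \<in> edges G. e \<subseteq> S} \<and> (\<forall>e\<in>M. \<forall>f\<in>M. e \<noteq> f \<longrightarrow> e \<inter> f = {})"

definition matched_bag :: "'a ugraph \<Rightarrow> 'a set \<Rightarrow> bool" where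
  "matched_bag G S \<longleftrightarrow>
     (\<exists>M. is_matching G S M \<and> \<Union>M = S) \<or>
     (\<exists>M. \<exists>v\<in>S. is_matching G S M \<and> \<Union>M = S - {v} \<and> (\<exists>u\<in>\<Union>M. {u, v} \<in> edges G))"

definition matched_tree_decomposition :: "'a ugraph \<Rightarrow> nat ugraph \<Rightarrow> (nat \<Rightarrow> 'a set) \<Rightarrow> bool" where
  "matched_tree_decomposition G T B \<longleftrightarrow>
     tree_decomposition G T B \<and> (\<forall>x\<in>verts T. matched_bag G (B x))"

definition matched_widths :: "'a ugraph \<Rightarrow> int set" where
  "matched_widths G = {td_width T B | T B. matched_tree_decomposition G T B}"

text \<open>A graph with an isolated vertex has no matched tree decomposition; its matched treewidth is
  \<^const>\<open>None\<close>.\<close>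

definition mtw :: "'a ugraph \<Rightarrow> int option" where
  "mtw G = (if matched_widths G = {} then None else Some (LEAST w. w \<in> matched_widths G))"


section \<open>Homomorphism polynomials\<close>

datatype 'v hvar = Y 'v | X "'v set"

text \<open>Multivariate polynomials with coefficients in \<open>'k\<close>: finitely supported functions from
  monomials (exponent vectors) to coefficients.\<close>

type_synonym ('v, 'k) hpoly = "('v hvar \<Rightarrow>\<^sub>0 nat) \<Rightarrow>\<^sub>0 'k"

definition pvar :: "'v hvar \<Rightarrow> ('v, 'k::comm_ring_1) hpoly" where
  "pvar x = Poly_Mapping.single (Poly_Mapping.single x 1) 1"

definition pconst :: "'k \<Rightarrow> ('v, 'k::comm_ring_1) hpoly" where
  "pconst c = Poly_Mapping.single 0 c"

definition homs :: "'a ugraph \<Rightarrow> 'v ugraph \<Rightarrow> ('a \<Rightarrow> 'v) set" where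
  "homs G H = {\<phi> \<in> verts G \<rightarrow>\<^sub>E verts H. \<forall>e\<in>edges G. \<phi> ` e \<in> edges H}"

definition hom_poly :: "'a ugraph \<Rightarrow> 'v ugraph \<Rightarrow> ('v, 'k::comm_ring_1) hpoly" where
  "hom_poly G H =
     (\<Sum>\<phi>\<in>homs G H. (\<Prod>u\<in>verts G. pvar (Y (\<phi> u))) * (\<Prod>e\<in>edges G. pvar (X (\<phi> ` e))))"


section \<open>Arithmetic circuits\<close>

text \<open>The gates of a circuit are listed in a topological order of the DAG; the operands of a gate
  are the positions of earlier gates.\<close>

datatype ('v, 'k) gate =
    Var_Leaf "'v hvar"
  | Const_Leaf 'k
  | Add_Gate nat nat
  | Mul_Gate nat nat

record ('v, 'k) circuit =
  gates :: "('v, 'k) gate list"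
  output_gate :: nat

fun wf_gate :: "'v hvar set \<Rightarrow> nat \<Rightarrow> ('v, 'k) gate \<Rightarrow> bool" where
  "wf_gate Vars i (Var_Leaf x) \<longleftrightarrow> x \<in> Vars"
| "wf_gate Vars i (Const_Leaf c) \<longleftrightarrow> True"
| "wf_gate Vars i (Add_Gate a b) \<longleftrightarrow> a < i \<and> b < i"
| "wf_gate Vars i (Mul_Gate a b) \<longleftrightarrow> a < i \<and> b < i"

definition wf_circuit :: "'v hvar set \<Rightarrow> ('v, 'k) circuit \<Rightarrow> bool" where
  "wf_circuit Vars C \<longleftrightarrow>
     (\<forall>i<length (gates C). wf_gate Vars i (gates C ! i)) \<and> output_gate C < length (gates C)"

fun gate_value :: "('v, 'k::comm_ring_1) hpoly list \<Rightarrow> ('v, 'k) gate \<Rightarrow> ('v, 'k) hpoly" where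
  "gate_value vs (Var_Leaf x) = pvar x"
| "gate_value vs (Const_Leaf c) = pconst c"
| "gate_value vs (Add_Gate a b) = vs ! a + vs ! b"
| "gate_value vs (Mul_Gate a b) = vs ! a * vs ! b"

definition gate_values :: "('v, 'k::comm_ring_1) gate list \<Rightarrow> ('v, 'k) hpoly list" where
  "gate_values gs = foldl (\<lambda>vs g. vs @ [gate_value vs g]) [] gs"

definition circuit_computes ::
    "'v hvar set \<Rightarrow> ('v, 'k::comm_ring_1) circuit \<Rightarrow> ('v, 'k) hpoly \<Rightarrow> bool" where
  "circuit_computes Vars C p \<longleftrightarrow> wf_circuit Vars C \<and> gate_values (gates C) ! output_gate C = p"


section \<open>The machine model\<close>

definition hosts :: "nat ugraph set" where
  "hosts = {H. simple_graph H \<and> (\<exists>n. verts H = {..<n})}"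

definition num_edges :: "'a ugraph \<Rightarrow> nat" where
  "num_edges H = card (edges H)"

definition input_size :: "'a ugraph \<Rightarrow> nat" where
  "input_size H = card (verts H) + card (edges H)"

definition host_vars :: "'v ugraph \<Rightarrow> 'v hvar set" where
  "host_vars H = Y ` verts H \<union> X ` edges H"

definition edge_list :: "nat ugraph \<Rightarrow> (nat \<times> nat) list" where
  "edge_list H = sorted_list_of_set {(u, v). u < v \<and> {u, v} \<in> edges H}"

text \<open>A random access machine with registers, an indirectly addressed memory of natural numbers,
  addition and truncated subtraction.  The host is accessible only through \<open>Adjacent\<close>, \<open>Rewind\<close> and
  \<open>Next_Edge\<close>, the latter two operating an iterator over the lexicographically ordered edge list.
  The \<open>Emit\<close> instructions append one gate to the circuit under construction.  Instruction operands
  are register numbers, except for the literal in \<open>Set_Const\<close>.\<close>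

datatype instr =
    Set_Const nat nat
  | Add nat nat nat
  | Sub nat nat nat
  | Load nat nat
  | Store nat nat
  | Adjacent nat nat nat
  | Rewind
  | Next_Edge nat nat nat
  | Emit_Y nat
  | Emit_X nat nat
  | Emit_Const nat
  | Emit_Add nat nat
  | Emit_Mul nat nat
  | Set_Output nat

datatype prog =
    Instr instr
  | Seq prog prog
  | If_Nonzero nat prog prog
  | While_Nonzero nat prog

record 'k state =
  reg :: "nat \<Rightarrow> nat"
  mem :: "nat \<Rightarrow> nat"
  iter_pos :: nat
  circ :: "(nat, 'k) circuit"

definition emit :: "(nat, 'k) gate \<Rightarrow> 'k state \<Rightarrow> 'k state" where
  "emit g s = s\<lparr>circ := (circ s)\<lparr>gates := gates (circ s) @ [g]\<rparr>\<rparr>"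

fun step :: "nat ugraph \<Rightarrow> instr \<Rightarrow> 'k::comm_ring_1 state \<Rightarrow> 'k state" where
  "step H (Set_Const r c) s = s\<lparr>reg := (reg s)(r := c)\<rparr>"
| "step H (Add r a b) s = s\<lparr>reg := (reg s)(r := reg s a + reg s b)\<rparr>"
| "step H (Sub r a b) s = s\<lparr>reg := (reg s)(r := reg s a - reg s b)\<rparr>"
| "step H (Load r a) s = s\<lparr>reg := (reg s)(r := mem s (reg s a))\<rparr>"
| "step H (Store a r) s = s\<lparr>mem := (mem s)(reg s a := reg s r)\<rparr>"
| "step H (Adjacent r a b) s =
     s\<lparr>reg := (reg s)(r := (if {reg s a, reg s b} \<in> edges H then 1 else 0))\<rparr>"
| "step H Rewind s = s\<lparr>iter_pos := 0\<rparr>"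
| "step H (Next_Edge r a b) s =
     (if iter_pos s < length (edge_list H)
      then s\<lparr>reg := (reg s)(a := fst (edge_list H ! iter_pos s),
                             b := snd (edge_list H ! iter_pos s), r := 1),
             iter_pos := Suc (iter_pos s)\<rparr>
      else s\<lparr>reg := (reg s)(r := 0)\<rparr>)"
| "step H (Emit_Y a) s = emit (Var_Leaf (Y (reg s a))) s"
| "step H (Emit_X a b) s = emit (Var_Leaf (X {reg s a, reg s b})) s"
| "step H (Emit_Const a) s = emit (Const_Leaf (of_nat (reg s a))) s"
| "step H (Emit_Add a b) s = emit (Add_Gate (reg s a) (reg s b)) s"
| "step H (Emit_Mul a b) s = emit (Mul_Gate (reg s a) (reg s b)) s"
| "step H (Set_Output a) s = s\<lparr>circ := (circ s)\<lparr>output_gate := reg s a\<rparr>\<rparr>"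

text \<open>Every instruction and every test costs one unit, except that an access to the host costs
  \<open>q\<close> units.\<close>

fun instr_cost :: "nat \<Rightarrow> instr \<Rightarrow> nat" where
  "instr_cost q (Adjacent r a b) = q"
| "instr_cost q Rewind = q"
| "instr_cost q (Next_Edge r a b) = q"
| "instr_cost q _ = 1"

text \<open>\<open>exec H q P s c s'\<close>: on host \<open>H\<close>, program \<open>P\<close> started in \<open>s\<close> halts in \<open>s'\<close> after time \<open>c\<close>.\<close>

inductive exec ::
    "nat ugraph \<Rightarrow> nat \<Rightarrow> prog \<Rightarrow> 'k::comm_ring_1 state \<Rightarrow> nat \<Rightarrow> 'k state \<Rightarrow> bool"
  for H :: "nat ugraph" and q :: nat where
  Instr: "exec H q (Instr i) s (instr_cost q i) (step H i s)"
| Seq: "exec H q P s c s' \<Longrightarrow> exec H q Q s' d s'' \<Longrightarrow> exec H q (Seq P Q) s (c + d) s''"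
| If_True: "reg s r \<noteq> 0 \<Longrightarrow> exec H q P s c s' \<Longrightarrow> exec H q (If_Nonzero r P Q) s (1 + c) s'"
| If_False: "reg s r = 0 \<Longrightarrow> exec H q Q s c s' \<Longrightarrow> exec H q (If_Nonzero r P Q) s (1 + c) s'"
| While_False: "reg s r = 0 \<Longrightarrow> exec H q (While_Nonzero r P) s 1 s"
| While_True: "reg s r \<noteq> 0 \<Longrightarrow> exec H q P s c s' \<Longrightarrow> exec H q (While_Nonzero r P) s' d s'' \<Longrightarrow>
    exec H q (While_Nonzero r P) s (1 + c + d) s''"

definition init_state :: "nat ugraph \<Rightarrow> 'k state" where
  "init_state H =
     \<lparr>reg = (\<lambda>_. 0)(0 := card (verts H)), mem = (\<lambda>_. 0), iter_pos = 0,
      circ = \<lparr>gates = [], output_gate = 0\<rparr>\<rparr>"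

text \<open>\<open>soft_O I sz f T\<close>: on the instances in \<open>I\<close>, \<open>T\<close> is bounded by \<open>f\<close> up to a constant and a
  polylogarithmic factor in the input size.  The offset makes the logarithm at least \<open>1\<close>.\<close>

definition soft_O :: "'i set \<Rightarrow> ('i \<Rightarrow> nat) \<Rightarrow> ('i \<Rightarrow> real) \<Rightarrow> ('i \<Rightarrow> nat) \<Rightarrow> bool" where
  "soft_O I sz f T \<longleftrightarrow>
     (\<exists>(C::real) (d::nat). \<forall>x\<in>I. real (T x) \<le> C * f x * log 2 (real (sz x) + 2) ^ d)"

text \<open>One program must work for all hosts and all host access costs \<open>q\<close> that are polylogarithmic in
  the input size.  The bound \<open>f\<close> is a function of the host.\<close>

definition circuit_constructible ::
    "(nat ugraph \<Rightarrow> (nat, 'k::comm_ring_1) hpoly) \<Rightarrow> (nat ugraph \<Rightarrow> real) \<Rightarrow> bool" where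
  "circuit_constructible p f \<longleftrightarrow>
     (\<exists>P. \<forall>q. soft_O hosts input_size (\<lambda>_. 1) q \<longrightarrow>
        (\<exists>T. soft_O hosts input_size f T \<and>
          (\<forall>H\<in>hosts. \<exists>s. exec H (q H) P (init_state H) (T H) s \<and>
             circuit_computes (host_vars H) (circ s) (p H))))"

end

theory Submission
  imports Defs
begin

text \<open>
  Order the bags of a matched tree decomposition so that each bag meets the later ones inside a
  single later bag, its parent.  A matched bag of size \<open>s\<close> is covered by at most \<open>\<lceil>s / 2\<rceil>\<close> edges of
  \<open>G\<close>, so its homomorphisms to \<open>H\<close> are among the tuples of that many oriented edges of \<open>H\<close> and can
  be enumerated in time \<open>O(m ^ \<lceil>s / 2\<rceil>)\<close>.  For every bag the program fills a table, indexed by the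
  restriction of a homomorphism to the intersection with the parent bag, whose entries are gates
  for the partial sums of the sum-product over the bags below.  Memory is addressed directly by the
  base-\<open>2 ^ L\<close> expansion of the index, with \<open>L\<close> logarithmic in the number of host vertices; computing
  an address by repeated doubling costs \<open>O(L)\<close>, which is absorbed by the polylogarithmic factor.
\<close>

section \<open>Running intersection orders and edge covers of matched bags\<close>

text \<open>Naive enumeration of the maps of a bag with s vertices costs n^s, where n counts even
  the isolated vertices of the host. Running over host edges instead is possible because every bag
  vertex is an end point of a covering edge, and s \<le> t + 1 bounds the number of loops by the
  exponent K of the claim. The price is overlap: in a bag of odd size the edge to the unmatched
  vertex reuses a matched one, so a vertex may be recorded in several registers. Equality tests
  discard the inconsistent tuples; the others correspond one-to-one to the maps of the bag that
  preserve the covering edges, so nothing is counted twice.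

  Tables may have far more cells than the running time allows one to touch. They are never
  initialised: zeroed memory points to gate 0, the constant 0.

  Reading the edge list is paid for by m^K. This fails for K = 0, which happens only for a graph
  without vertices; that graph gets a program of its own. The maximum with 1 in the bound accounts
  for the work done on a host without edges.\<close>

lemma rtrancl_distinct_path:
  assumes "(a, b) \<in> R\<^sup>*"
  shows "\<exists>xs. xs \<noteq> [] \<and> hd xs = a \<and> last xs = b \<and> distinct xs \<and>
    (\<forall>i. Suc i < length xs \<longrightarrow> (xs ! i, xs ! Suc i) \<in> R)"
  using assms
proof (induction rule: rtrancl_induct)
  case base
  show ?case by (rule exI[of _ "[a]"]) simp
next
  case (step y z)
  then obtain xs where xs: "xs \<noteq> []" "hd xs = a" "last xs = y" "distinct xs"
    "\<And>i. Suc i < length xs \<Longrightarrow> (xs ! i, xs ! Suc i) \<in> R" by blast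
  show ?case
  proof (cases "z \<in> set xs")
    \<comment> \<open>Loop erasure: the walk returns to a vertex it has seen, so it is cut back to
      that visit.\<close>
    case True
    then obtain k where k: "k < length xs" "xs ! k = z" by (auto simp: in_set_conv_nth)
    let ?ys = "take (Suc k) xs"
    have "last ?ys = z" using k by (simp add: take_Suc_conv_app_nth)
    moreover have "hd ?ys = a" using xs by simp
    ultimately show ?thesis using xs k by (intro exI[of _ ?ys]) auto
  next
    case False
    have "((xs @ [z]) ! i, (xs @ [z]) ! Suc i) \<in> R" if "Suc i < length (xs @ [z])" for i
    proof (cases "Suc i < length xs")
      case True
      then show ?thesis using xs(5)[of i] by (simp add: nth_append)
    next
      case False
      then have "i = length xs - 1" "Suc i = length xs" using that by auto
      then show ?thesis using xs(1,3) step(2) by (simp add: nth_append last_conv_nth)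
    qed
    then show ?thesis using xs False by (intro exI[of _ "xs @ [z]"]) auto
  qed
qed

text \<open>A simple path from \<open>a\<close> to \<open>b\<close> that avoids the edge between
  them closes up with it to a cycle. It has at least three vertices: one is excluded by
  \<open>a \<noteq> b\<close>, and two would make its single step the forbidden edge.\<close>

lemma acyclic_edge_is_bridge:
  assumes "\<nexists>c. is_cycle T c" "{a, b} \<in> edges T" "a \<noteq> b"
  shows "(a, b) \<notin> {(x, y). {x, y} \<in> edges T \<and> {x, y} \<noteq> {a, b}}\<^sup>*"
proof
  assume "(a, b) \<in> {(x, y). {x, y} \<in> edges T \<and> {x, y} \<noteq> {a, b}}\<^sup>*"
  from rtrancl_distinct_path[OF this] obtain xs where xs: "xs \<noteq> []" "hd xs = a" "last xs = b"
    "distinct xs"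
    "\<And>i. Suc i < length xs \<Longrightarrow> {xs ! i, xs ! Suc i} \<in> edges T \<and> {xs ! i, xs ! Suc i} \<noteq> {a, b}"
    by auto
  have h: "xs ! 0 = a" "xs ! (length xs - 1) = b" using xs by (auto simp: hd_conv_nth last_conv_nth)
  have "length xs \<noteq> 1" using h assms(3) by auto
  moreover have "length xs \<noteq> 2" using h xs(5)[of 0] by auto
  moreover have "length xs \<noteq> 0" using xs by auto
  ultimately have len: "length xs \<ge> 3" by linarith
  have "{xs ! i, xs ! (Suc i mod length xs)} \<in> edges T" if "i < length xs" for i
  proof (cases "Suc i < length xs")
    case True
    then show ?thesis using xs(5) by simp
  next
    case False
    then have "i = length xs - 1" "Suc i = length xs" using that by auto
    then show ?thesis using h assms(2) by (simp add: insert_commute)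
  qed
  then have "is_cycle T xs" using len xs(4) unfolding is_cycle_def by blast
  with assms(1) show False by blast
qed

text \<open>Linear form of a tree decomposition, read from the leaves to the root: parents come
  later, and the last bag is the root, on which \<open>par\<close> is unconstrained. It turns the
  elimination of bags into induction on an index.\<close>

definition running_intersection :: "'a set list \<Rightarrow> (nat \<Rightarrow> nat) \<Rightarrow> bool" where
  "running_intersection bs par \<longleftrightarrow>
     (\<forall>i. Suc i < length bs \<longrightarrow> i < par i \<and> par i < length bs \<and>
        (\<forall>j. i < j \<and> j < length bs \<longrightarrow> bs ! i \<inter> bs ! j \<subseteq> bs ! par i))"

lemma connected_in_edge_leaving:
  assumes "connected_in T V" "S \<subset> V" "S \<noteq> {}"
  shows "\<exists>x p. x \<in> V - S \<and> p \<in> S \<and> {x, p} \<in> edges T"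
proof -
  obtain a b where ab: "a \<in> S" "b \<in> V - S" using assms by blast
  have "(a, b) \<in> {(x, y). x \<in> V \<and> y \<in> V \<and> {x, y} \<in> edges T}\<^sup>*"
    using assms(1) ab assms(2) unfolding connected_in_def by blast
  then have "b \<in> S \<or> (\<exists>x p. x \<in> V - S \<and> p \<in> S \<and> {x, p} \<in> edges T)"
  proof (induction rule: rtrancl_induct)
    case (step y z)
    then have "{z, y} \<in> edges T" "z \<in> V" by (auto simp: insert_commute)
    with step.IH show ?case by blast
  qed (use ab in simp)
  with ab show ?thesis by blast
qed

lemma connected_in_insert:
  assumes "connected_in T S" "p \<in> S" "{x, p} \<in> edges T"
  shows "connected_in T (insert x S)"
proof -
  let ?R = "{(u, v). u \<in> insert x S \<and> v \<in> insert x S \<and> {u, v} \<in> edges T}"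
  have S: "(u, v) \<in> ?R\<^sup>*" if "u \<in> S" "v \<in> S" for u v
  proof -
    have "(u, v) \<in> {(u, v). u \<in> S \<and> v \<in> S \<and> {u, v} \<in> edges T}\<^sup>*"
      using assms(1) that unfolding connected_in_def by blast
    then show ?thesis by (rule rtrancl_mono[THEN subsetD, rotated]) auto
  qed
  have xp: "(x, p) \<in> ?R" "(p, x) \<in> ?R" using assms by (auto simp: insert_commute)
  have "(u, v) \<in> ?R\<^sup>*" if "u \<in> insert x S" "v \<in> insert x S" for u v
  proof -
    have "(u, p) \<in> ?R\<^sup>*" using S[of u p] that assms(2) xp by auto
    moreover have "(p, v) \<in> ?R\<^sup>*" using S[of p v] that assms(2) xp by auto
    ultimately show ?thesis by (rule rtrancl_trans)
  qed
  then show ?thesis unfolding connected_in_def by blast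
qed

text \<open>If a vertex of \<open>B x\<close> and \<open>B y\<close> were missing from
  \<open>B p\<close>, its subtree would lead from \<open>x\<close> to \<open>y\<close> without
  visiting \<open>p\<close>, hence without the edge \<open>{x, p}\<close>. Continuing inside
  \<open>S\<close>, which does not contain \<open>x\<close>, reaches \<open>p\<close>, although that
  edge is a bridge.\<close>

lemma tree_attachment_intersection:
  assumes td: "tree_decomposition G T B"
    and S: "connected_in T S" "S \<subseteq> verts T" "p \<in> S" "x \<in> verts T - S" "{x, p} \<in> edges T" "y \<in> S"
  shows "B x \<inter> B y \<subseteq> B p"
proof (rule ccontr)
  assume "\<not> B x \<inter> B y \<subseteq> B p"
  then obtain v where v: "v \<in> B x" "v \<in> B y" "v \<notin> B p" by blast
  have tr: "is_tree T" and "B x \<subseteq> verts G" using td S unfolding tree_decomposition_def by auto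
  then have "connected_in T {z \<in> verts T. v \<in> B z}"
    using td v unfolding tree_decomposition_def by blast
  then have "(x, y) \<in> {(u, w). u \<in> {z \<in> verts T. v \<in> B z} \<and> w \<in> {z \<in> verts T. v \<in> B z} \<and>
      {u, w} \<in> edges T}\<^sup>*"
    unfolding connected_in_def using v S by blast
  moreover let ?R = "{(u, w). {u, w} \<in> edges T \<and> {u, w} \<noteq> {x, p}}"
  have "{(u, w). u \<in> {z \<in> verts T. v \<in> B z} \<and> w \<in> {z \<in> verts T. v \<in> B z} \<and>
      {u, w} \<in> edges T} \<subseteq> ?R"
    using v by (auto simp: doubleton_eq_iff)
  ultimately have "(x, y) \<in> ?R\<^sup>*" using rtrancl_mono by blast
  moreover have "(y, p) \<in> {(u, w). u \<in> S \<and> w \<in> S \<and> {u, w} \<in> edges T}\<^sup>*"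
    using S unfolding connected_in_def by blast
  then have "(y, p) \<in> ?R\<^sup>*"
    by (rule rtrancl_mono[THEN subsetD, rotated]) (use S in \<open>auto simp: doubleton_eq_iff\<close>)
  ultimately have "(x, p) \<in> ?R\<^sup>*" by (rule rtrancl_trans)
  then show False
    using acyclic_edge_is_bridge[of T x p] tr S unfolding is_tree_def by blast
qed

text \<open>The order is grown from the root backwards: a tree node adjacent to the connected set
  already listed is put in front, with its neighbour in that set as parent.\<close>

lemma tree_decomposition_partial_order:
  assumes td: "tree_decomposition G T B" and "k < card (verts T)"
  shows "\<exists>xs par. length xs = Suc k \<and> distinct xs \<and> set xs \<subseteq> verts T \<and> connected_in T (set xs) \<and>
    running_intersection (map B xs) par"
  using assms(2)
proof (induction k)
  case 0
  then obtain x where "x \<in> verts T" by fastforce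
  then show ?case
    by (intro exI[of _ "[x]"]) (auto simp: connected_in_def running_intersection_def)
next
  case (Suc k)
  then obtain xs par where xs: "length xs = Suc k" "distinct xs" "set xs \<subseteq> verts T"
    "connected_in T (set xs)" "running_intersection (map B xs) par" by auto
  have con: "connected_in T (verts T)"
    using td by (auto simp: tree_decomposition_def is_tree_def)
  have "card (set xs) = Suc k" using xs by (simp add: distinct_card)
  then have "set xs \<subset> verts T" using xs(3) Suc.prems by auto
  moreover have "set xs \<noteq> {}" using xs(1) by auto
  ultimately obtain x p where xp: "x \<in> verts T - set xs" "p \<in> set xs" "{x, p} \<in> edges T"
    using connected_in_edge_leaving[OF con] by blast
  obtain l where l: "l < length xs" "xs ! l = p" using xp by (auto simp: in_set_conv_nth)
  \<comment> \<open>Prepending shifts all positions by one; the new node sits at position 0.\<close>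
  let ?par = "\<lambda>i. case i of 0 \<Rightarrow> Suc l | Suc i \<Rightarrow> Suc (par i)"
  have "running_intersection (map B (x # xs)) ?par"
    unfolding running_intersection_def
  proof (intro allI impI)
    fix i assume i: "Suc i < length (map B (x # xs))"
    show "i < ?par i \<and> ?par i < length (map B (x # xs)) \<and>
      (\<forall>j. i < j \<and> j < length (map B (x # xs)) \<longrightarrow>
        map B (x # xs) ! i \<inter> map B (x # xs) ! j \<subseteq> map B (x # xs) ! ?par i)"
    proof (cases i)
      case 0
      have "B x \<inter> B (xs ! j) \<subseteq> B (xs ! l)" if "j < length xs" for j
        using tree_attachment_intersection[OF td xs(4,3) xp(2,1,3), of "xs ! j"] l that by auto
      then show ?thesis using 0 l by (auto simp: nth_Cons' gr0_conv_Suc)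
    next
      case (Suc i')
      then have "Suc i' < length xs" using i by simp
      then have pi: "i' < par i'" "par i' < length xs"
        "\<And>j. i' < j \<Longrightarrow> j < length xs \<Longrightarrow> map B xs ! i' \<inter> map B xs ! j \<subseteq> map B xs ! par i'"
        using xs(5) unfolding running_intersection_def length_map by blast+
      have "map B (x # xs) ! i \<inter> map B (x # xs) ! j \<subseteq> map B (x # xs) ! ?par i"
        if j: "i < j" "j < length (map B (x # xs))" for j
      proof -
        obtain j' where j': "j = Suc j'" using j by (cases j) auto
        then show ?thesis using pi(3)[of j'] j Suc by simp
      qed
      moreover have "i < ?par i" "?par i < length (map B (x # xs))" using Suc pi by simp_all
      ultimately show ?thesis by blast
    qed
  qed
  moreover have "connected_in T (set (x # xs))"
    using connected_in_insert[OF xs(4) xp(2,3)] by simp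
  ultimately show ?case
    using xs xp by (intro exI[of _ "x # xs"] exI[of _ ?par]) auto
qed

lemma tree_decomposition_running_intersection:
  assumes td: "tree_decomposition G T B"
  obtains xs par where "xs \<noteq> []" "set xs = verts T" "running_intersection (map B xs) par"
proof -
  have "finite (verts T)" "verts T \<noteq> {}"
    using td by (auto simp: tree_decomposition_def is_tree_def simple_graph_def connected_in_def)
  then have pos: "card (verts T) > 0" by (simp add: card_gt_0_iff)
  then obtain xs par where xs: "length xs = card (verts T)" "distinct xs" "set xs \<subseteq> verts T"
    "running_intersection (map B xs) par"
    using tree_decomposition_partial_order[OF td, of "card (verts T) - 1"] by auto
  then have "set xs = verts T"
    using \<open>finite (verts T)\<close> by (metis card_subset_eq distinct_card)
  with xs pos show thesis by (intro that[of xs par]) auto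
qed

section \<open>Covering a matched bag by oriented edges\<close>

lemma matching_oriented_list:
  assumes G: "simple_graph G" and M: "is_matching G S M"
  obtains cs where "\<forall>(a, b)\<in>set cs. {a, b} \<in> edges G" "(\<Union>(a, b)\<in>set cs. {a, b}) = \<Union>M"
    "2 * length cs = card (\<Union>M)"
proof -
  have e2: "\<exists>a b. e = {a, b}" if "e \<in> M" for e
  proof -
    have "card e = 2" using that G M unfolding is_matching_def simple_graph_def by blast
    then show ?thesis unfolding card_2_iff by blast
  qed
  then obtain fa fb where f: "\<And>e. e \<in> M \<Longrightarrow> e = {fa e, fb e}" by metis
  have "M \<subseteq> Pow (verts G)" using G M unfolding is_matching_def simple_graph_def by blast
  then have fin: "finite M" using G unfolding simple_graph_def by (metis finite_Pow_iff finite_subset)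
  then obtain es where es: "set es = M" "distinct es" using finite_distinct_list by blast
  let ?cs = "map (\<lambda>e. (fa e, fb e)) es"
  have "finite e" if "e \<in> M" for e
    using that \<open>M \<subseteq> Pow (verts G)\<close> G by (auto simp: simple_graph_def intro: finite_subset)
  then have "card (\<Union>M) = (\<Sum>e\<in>M. card e)"
    by (intro card_Union_disjoint)
       (use M in \<open>auto simp: is_matching_def pairwise_def disjnt_def\<close>)
  also have "\<dots> = (\<Sum>e\<in>M. 2)"
    by (rule sum.cong) (use M G in \<open>auto simp: is_matching_def simple_graph_def\<close>)
  finally have card: "card (\<Union>M) = 2 * card M" by simp
  have "(\<Union>(a, b)\<in>set ?cs. {a, b}) = (\<Union>e\<in>M. {fa e, fb e})" using es by auto
  also have "\<dots> = (\<Union>e\<in>M. e)" by (rule SUP_cong) (simp_all add: f[symmetric])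
  finally have "(\<Union>(a, b)\<in>set ?cs. {a, b}) = \<Union>M" by simp
  moreover have "{fa e, fb e} \<in> edges G" if "e \<in> M" for e
    using that M f[symmetric] by (auto simp: is_matching_def)
  ultimately show thesis
    using es card by (intro that[of ?cs]) (auto simp: distinct_card)
qed

text \<open>A perfect matching already covers \<open>S\<close>. Otherwise the matching together with
  the edge from the unmatched vertex to a matched neighbour does; it has (card S - 1) / 2 + 1
  members, which gives the + 1 in the bound.\<close>

lemma matched_bag_edge_cover:
  assumes G: "simple_graph G" and S: "matched_bag G S"
  obtains cs where "\<forall>(a, b)\<in>set cs. {a, b} \<in> edges G" "(\<Union>(a, b)\<in>set cs. {a, b}) = S"
    "2 * length cs \<le> card S + 1"
proof -
  consider M where "is_matching G S M" "\<Union>M = S"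
    | M v u where "v \<in> S" "is_matching G S M" "\<Union>M = S - {v}" "u \<in> \<Union>M" "{u, v} \<in> edges G"
    using S unfolding matched_bag_def by metis
  then show thesis
  proof cases
    case 1
    obtain cs where "\<forall>(a, b)\<in>set cs. {a, b} \<in> edges G" "(\<Union>(a, b)\<in>set cs. {a, b}) = \<Union>M"
      "2 * length cs = card (\<Union>M)"
      by (rule matching_oriented_list[OF G 1(1)])
    then show thesis using 1(2) by (intro that[of cs]) auto
  next
    case 2
    obtain cs where cs: "\<forall>(a, b)\<in>set cs. {a, b} \<in> edges G" "(\<Union>(a, b)\<in>set cs. {a, b}) = \<Union>M"
      "2 * length cs = card (\<Union>M)"
      by (rule matching_oriented_list[OF G 2(2)])
    have "finite (\<Union>M)" unfolding cs(2)[symmetric] by auto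
    then have "finite S" using 2(3) by simp
    then have "card S = Suc (card (\<Union>M))" using 2(1,3) by (metis card.remove)
    then show thesis using cs 2 by (intro that[of "(u, v) # cs"]) auto
  qed
qed

section \<open>Sum-product elimination\<close>

text \<open>An assignment on \<open>A \<union> B\<close> is a pair of assignments on
  \<open>A\<close> and \<open>B\<close> that agree on the intersection; the inner sum collects the
  second components compatible with a given first one.\<close>

lemma sum_PiE_Un:
  fixes F g :: "('a \<Rightarrow> 'v) \<Rightarrow> 'r::comm_semiring_1"
  assumes F: "\<And>\<phi> \<phi>'. (\<And>v. v \<in> A \<Longrightarrow> \<phi> v = \<phi>' v) \<Longrightarrow> F \<phi> = F \<phi>'"
    and g: "\<And>\<phi> \<phi>'. (\<And>v. v \<in> B \<Longrightarrow> \<phi> v = \<phi>' v) \<Longrightarrow> g \<phi> = g \<phi>'"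
    and fin: "finite A" "finite B" "finite W"
  shows "(\<Sum>\<phi>\<in>(A \<union> B) \<rightarrow>\<^sub>E W. F \<phi> * g \<phi>) =
    (\<Sum>\<phi>\<in>A \<rightarrow>\<^sub>E W. F \<phi> * (\<Sum>\<psi>\<in>{\<psi> \<in> B \<rightarrow>\<^sub>E W. \<forall>v\<in>A \<inter> B. \<psi> v = \<phi> v}. g \<psi>))"
proof -
  have "(\<Sum>\<phi>\<in>A \<rightarrow>\<^sub>E W. F \<phi> * (\<Sum>\<psi>\<in>{\<psi> \<in> B \<rightarrow>\<^sub>E W. \<forall>v\<in>A \<inter> B. \<psi> v = \<phi> v}. g \<psi>)) =
    (\<Sum>(\<phi>, \<psi>)\<in>(SIGMA \<phi>:A \<rightarrow>\<^sub>E W. {\<psi> \<in> B \<rightarrow>\<^sub>E W. \<forall>v\<in>A \<inter> B. \<psi> v = \<phi> v}). F \<phi> * g \<psi>)"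
    by (simp add: sum_distrib_left sum.Sigma finite_PiE fin)
  also have "\<dots> = (\<Sum>\<phi>\<in>(A \<union> B) \<rightarrow>\<^sub>E W. F \<phi> * g \<phi>)"
  proof (rule sum.reindex_bij_witness[where i = "\<lambda>\<phi>. (restrict \<phi> A, restrict \<phi> B)"
        and j = "\<lambda>(\<phi>, \<psi>). \<lambda>v. if v \<in> A then \<phi> v else \<psi> v"], goal_cases)
    case (1 a)
    then show ?case
      by (auto simp: fun_eq_iff PiE_def extensional_def restrict_def)
  next
    case (2 a)
    then show ?case by (auto simp: PiE_def extensional_def Pi_def)
  next
    case (3 b)
    then show ?case by (auto simp: fun_eq_iff PiE_def extensional_def restrict_def)
  next
    case (4 b)
    then show ?case by (auto simp: PiE_def extensional_def Pi_def)
  next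
    case (5 a)
    obtain \<phi> \<psi> where a: "a = (\<phi>, \<psi>)" by (cases a)
    have "F (\<lambda>v. if v \<in> A then \<phi> v else \<psi> v) = F \<phi>" by (rule F) simp
    moreover have "g (\<lambda>v. if v \<in> A then \<phi> v else \<psi> v) = g \<psi>" by (rule g) (use 5 a in auto)
    ultimately show ?case using a by simp
  qed
  finally show ?thesis by simp
qed

text \<open>\<open>sepset bs par i\<close> is the part of bag \<open>i\<close> on which it communicates with its parent; the last
  bag is the root.\<close>

definition sepset :: "'a set list \<Rightarrow> (nat \<Rightarrow> nat) \<Rightarrow> nat \<Rightarrow> 'a set" where
  "sepset bs par i = (if Suc i < length bs then bs ! i \<inter> bs ! par i else {})"

definition kids :: "(nat \<Rightarrow> nat) \<Rightarrow> nat \<Rightarrow> nat list" where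
  "kids par i = filter (\<lambda>c. par c = i) [0..<i]"

lemma prod_list_kids: "(\<Prod>c\<leftarrow>kids par i. h c) = (\<Prod>c\<in>{c. c < i \<and> par c = i}. h c)"
proof -
  have "(\<Prod>c\<leftarrow>kids par i. h c) = (\<Prod>c\<in>set (kids par i). h c)"
    by (rule prod.distinct_set_conv_list[symmetric]) (simp add: kids_def)
  then show ?thesis by (simp add: kids_def conj_commute)
qed

text \<open>The upward message of the sum-product algorithm on a junction tree, as a function on
  total assignments of which only the values on the separator matter. Children have smaller
  positions, whence termination.\<close>

function msg :: "'a set list \<Rightarrow> (nat \<Rightarrow> nat) \<Rightarrow> 'v set \<Rightarrow> (nat \<Rightarrow> ('a \<Rightarrow> 'v) \<Rightarrow> 'r::comm_semiring_1) \<Rightarrow>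
    nat \<Rightarrow> ('a \<Rightarrow> 'v) \<Rightarrow> 'r" where
  "msg bs par W f i \<phi> =
     (\<Sum>\<psi>\<in>{\<psi> \<in> (bs ! i) \<rightarrow>\<^sub>E W. \<forall>v\<in>sepset bs par i. \<psi> v = \<phi> v}.
        f i \<psi> * (\<Prod>c\<leftarrow>kids par i. msg bs par W f c \<psi>))"
  by pat_completeness auto
termination
  by (relation "measure (\<lambda>(bs, par, W, f, i, \<phi>). i)") (auto simp: kids_def)

declare msg.simps [simp del]

lemma msg_cong:
  assumes "\<And>v. v \<in> sepset bs par i \<Longrightarrow> \<phi> v = \<phi>' v"
  shows "msg bs par W f i \<phi> = msg bs par W f i \<phi>'"
  using assms by (simp add: msg.simps[of bs par W f i])

text \<open>Elimination invariant: the bags before \<open>j\<close> have been summed out, and each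
  one whose parent remains lives on as a message multiplied to that parent. By running intersection,
  what bag \<open>j\<close> shares with all later bags is its separator, so summing out its private
  vertices yields its message.\<close>

lemma msg_elimination:
  fixes f :: "nat \<Rightarrow> ('a \<Rightarrow> 'v) \<Rightarrow> 'r::comm_semiring_1"
  assumes ri: "running_intersection bs par" and fin: "finite W" "\<And>i. i < length bs \<Longrightarrow> finite (bs ! i)"
    and f: "\<And>i \<phi> \<phi>'. i < length bs \<Longrightarrow> (\<And>v. v \<in> bs ! i \<Longrightarrow> \<phi> v = \<phi>' v) \<Longrightarrow> f i \<phi> = f i \<phi>'"
    and j: "j < length bs"
  shows "(\<Sum>\<phi>\<in>(\<Union>i<length bs. bs ! i) \<rightarrow>\<^sub>E W. \<Prod>i<length bs. f i \<phi>) =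
    (\<Sum>\<phi>\<in>(\<Union>i\<in>{j..<length bs}. bs ! i) \<rightarrow>\<^sub>E W.
       \<Prod>i\<in>{j..<length bs}. f i \<phi> * (\<Prod>c\<in>{c. c < j \<and> par c = i}. msg bs par W f c \<phi>))"
  using j
proof (induction j)
  case 0
  then show ?case by (simp add: atLeast0LessThan)
next
  case (Suc j)
  let ?n = "length bs"
  let ?m = "msg bs par W f"
  let ?U = "\<Union>i\<in>{Suc j..<?n}. bs ! i"
  let ?h = "\<lambda>k i \<phi>. f i \<phi> * (\<Prod>c\<in>{c. c < k \<and> par c = i}. ?m c \<phi>)"
  have par: "i < par i" "par i < ?n" if "Suc i < ?n" for i
    using ri that unfolding running_intersection_def by auto
  have sep: "sepset bs par c \<subseteq> bs ! par c" "sepset bs par c \<subseteq> bs ! c" for c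
    by (auto simp: sepset_def)
  have h: "?h k i \<phi> = ?h k i \<phi>'" if "i < ?n" "\<And>v. v \<in> bs ! i \<Longrightarrow> \<phi> v = \<phi>' v" for k i \<phi> \<phi>'
  proof -
    have "?m c \<phi> = ?m c \<phi>'" if "par c = i" for c
      using sep(1)[of c] that \<open>\<And>v. v \<in> bs ! i \<Longrightarrow> \<phi> v = \<phi>' v\<close> by (intro msg_cong) blast
    moreover have "f i \<phi> = f i \<phi>'" using f that by blast
    ultimately show ?thesis by simp
  qed
  have split: "{j..<?n} = insert j {Suc j..<?n}" using Suc.prems by auto
  have "(\<Sum>\<phi>\<in>(\<Union>i\<in>{j..<?n}. bs ! i) \<rightarrow>\<^sub>E W. \<Prod>i\<in>{j..<?n}. ?h j i \<phi>) =
    (\<Sum>\<phi>\<in>(?U \<union> bs ! j) \<rightarrow>\<^sub>E W. (\<Prod>i\<in>{Suc j..<?n}. ?h j i \<phi>) * ?h j j \<phi>)"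
    unfolding split by (simp add: mult.commute Un_commute)
  also have "\<dots> = (\<Sum>\<phi>\<in>?U \<rightarrow>\<^sub>E W. (\<Prod>i\<in>{Suc j..<?n}. ?h j i \<phi>) *
      (\<Sum>\<psi>\<in>{\<psi> \<in> bs ! j \<rightarrow>\<^sub>E W. \<forall>v\<in>?U \<inter> bs ! j. \<psi> v = \<phi> v}. ?h j j \<psi>))"
  proof (rule sum_PiE_Un)
    fix \<phi> \<phi>' :: "'a \<Rightarrow> 'v" assume eq: "\<And>v. v \<in> ?U \<Longrightarrow> \<phi> v = \<phi>' v"
    show "(\<Prod>i\<in>{Suc j..<?n}. ?h j i \<phi>) = (\<Prod>i\<in>{Suc j..<?n}. ?h j i \<phi>')"
    proof (intro prod.cong refl h)
      fix i v assume "i \<in> {Suc j..<?n}" "v \<in> bs ! i"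
      then show "\<phi> v = \<phi>' v" by (intro eq UN_I)
    qed simp
  next
    fix \<phi> \<phi>' :: "'a \<Rightarrow> 'v" assume "\<And>v. v \<in> bs ! j \<Longrightarrow> \<phi> v = \<phi>' v"
    then show "?h j j \<phi> = ?h j j \<phi>'" using Suc.prems by (intro h) simp_all
  qed (use fin Suc.prems in auto)
  also have "\<dots> = (\<Sum>\<phi>\<in>?U \<rightarrow>\<^sub>E W. (\<Prod>i\<in>{Suc j..<?n}. ?h j i \<phi>) * ?m j \<phi>)"
  proof (intro sum.cong refl arg_cong2[where f = "(*)"])
    fix \<phi> :: "'a \<Rightarrow> 'v"
    have "?U \<inter> bs ! j = sepset bs par j"
    proof
      have *: "bs ! j \<inter> bs ! i \<subseteq> bs ! par j" if "j < i" "i < ?n" for i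
        using ri Suc.prems that unfolding running_intersection_def by blast
      have "v \<in> bs ! par j" if v: "v \<in> ?U" "v \<in> bs ! j" for v
      proof -
        from v(1) obtain i where "i \<in> {Suc j..<?n}" "v \<in> bs ! i" by (rule UN_E)
        then show ?thesis using *[of i] v(2) by auto
      qed
      then show "?U \<inter> bs ! j \<subseteq> sepset bs par j" using Suc.prems by (auto simp: sepset_def)
      have "par j \<in> {Suc j..<?n}" using par[OF Suc.prems] by simp
      then have "bs ! par j \<subseteq> ?U" by (rule UN_upper)
      then show "sepset bs par j \<subseteq> ?U \<inter> bs ! j" using Suc.prems by (auto simp: sepset_def)
    qed
    then show "(\<Sum>\<psi>\<in>{\<psi> \<in> bs ! j \<rightarrow>\<^sub>E W. \<forall>v\<in>?U \<inter> bs ! j. \<psi> v = \<phi> v}. ?h j j \<psi>) = ?m j \<phi>"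
      by (simp add: msg.simps[of bs par W f j \<phi>] prod_list_kids)
  qed
  also have "\<dots> = (\<Sum>\<phi>\<in>?U \<rightarrow>\<^sub>E W. \<Prod>i\<in>{Suc j..<?n}. ?h (Suc j) i \<phi>)"
  proof (intro sum.cong refl)
    fix \<phi> :: "'a \<Rightarrow> 'v"
    \<comment> \<open>The message of bag \<open>j\<close> becomes a factor of exactly one later bag,
      its parent.\<close>
    have "?h (Suc j) i \<phi> = ?h j i \<phi> * (if i = par j then ?m j \<phi> else 1)" for i
    proof (cases "par j = i")
      case True
      then have "{c. c < Suc j \<and> par c = i} = insert j {c. c < j \<and> par c = i}"
        by (auto simp: less_Suc_eq)
      then show ?thesis using True by (simp add: ac_simps)
    next
      case False
      then have "{c. c < Suc j \<and> par c = i} = {c. c < j \<and> par c = i}" by (auto simp: less_Suc_eq)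
      then show ?thesis using False by simp
    qed
    then show "(\<Prod>i\<in>{Suc j..<?n}. ?h j i \<phi>) * ?m j \<phi> = (\<Prod>i\<in>{Suc j..<?n}. ?h (Suc j) i \<phi>)"
      using par[OF Suc.prems] by (simp add: prod.distrib prod.delta)
  qed
  finally show ?case using Suc by simp
qed

text \<open>At the last bag the separator is empty, so its message is the full sum and
  \<open>\<phi>\<^sub>0\<close> may be arbitrary.\<close>

lemma msg_root:
  fixes f :: "nat \<Rightarrow> ('a \<Rightarrow> 'v) \<Rightarrow> 'r::comm_semiring_1"
  assumes "running_intersection bs par" "finite W" "\<And>i. i < length bs \<Longrightarrow> finite (bs ! i)"
    and "\<And>i \<phi> \<phi>'. i < length bs \<Longrightarrow> (\<And>v. v \<in> bs ! i \<Longrightarrow> \<phi> v = \<phi>' v) \<Longrightarrow> f i \<phi> = f i \<phi>'"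
    and ne: "bs \<noteq> []"
  shows "(\<Sum>\<phi>\<in>(\<Union>i<length bs. bs ! i) \<rightarrow>\<^sub>E W. \<Prod>i<length bs. f i \<phi>) =
    msg bs par W f (length bs - 1) \<phi>\<^sub>0"
proof -
  let ?r = "length bs - 1"
  have r: "{?r..<length bs} = {?r}" using ne by (cases bs) auto
  have "sepset bs par ?r = {}" using ne by (simp add: sepset_def)
  then have root: "(\<Sum>\<phi>\<in>(\<Union>i\<in>{?r..<length bs}. bs ! i) \<rightarrow>\<^sub>E W. \<Prod>i\<in>{?r..<length bs}.
      f i \<phi> * (\<Prod>c\<in>{c. c < ?r \<and> par c = i}. msg bs par W f c \<phi>)) = msg bs par W f ?r \<phi>\<^sub>0"
    unfolding r msg.simps[of bs par W f ?r] by (simp add: prod_list_kids)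
  have "?r < length bs" using ne by simp
  show ?thesis
    by (rule trans[OF msg_elimination root]) (fact assms(1-4) \<open>?r < length bs\<close>)+
qed

section \<open>Weakest preconditions with time bounds\<close>

text \<open>Total correctness: the existential over finite executions includes termination. The time
  is only bounded above, so estimates may be rounded up at each composition.\<close>

definition wp :: "nat ugraph \<Rightarrow> nat \<Rightarrow> prog \<Rightarrow> nat \<Rightarrow> ('k::comm_ring_1 state \<Rightarrow> bool) \<Rightarrow> 'k state \<Rightarrow> bool" where
  "wp H q P c Q s \<longleftrightarrow> (\<exists>c' s'. exec H q P s c' s' \<and> c' \<le> c \<and> Q s')"

lemma wp_conseq:
  "wp H q P c Q s \<Longrightarrow> c \<le> c' \<Longrightarrow> (\<And>s'. Q s' \<Longrightarrow> Q' s') \<Longrightarrow> wp H q P c' Q' s"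
  unfolding wp_def by (meson order_trans)

text \<open>The charge \<open>q + 1\<close> covers both a host access and a unit-cost instruction,
  also for \<open>q = 0\<close>.\<close>

lemma wp_Instr: "Q (step H i s) \<Longrightarrow> q + 1 \<le> c \<Longrightarrow> wp H q (Instr i) c Q s"
proof -
  assume a: "Q (step H i s)" "q + 1 \<le> c"
  have "instr_cost q i \<le> q + 1" by (cases i) auto
  with a show ?thesis unfolding wp_def by (meson exec.Instr order_trans)
qed

lemma wp_Seq: "wp H q P c (wp H q Q d R) s \<Longrightarrow> c + d \<le> e \<Longrightarrow> wp H q (Seq P Q) e R s"
  unfolding wp_def by (meson add_mono exec.Seq order_trans)

lemma wp_If:
  assumes "reg s r \<noteq> 0 \<Longrightarrow> wp H q P c Q s" "reg s r = 0 \<Longrightarrow> wp H q P' c Q s" "Suc c \<le> d"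
  shows "wp H q (If_Nonzero r P P') d Q s"
proof (cases "reg s r = 0")
  case True
  then obtain c' s' where "exec H q P' s c' s'" "c' \<le> c" "Q s'" using assms(2) unfolding wp_def by blast
  then show ?thesis using True assms(3) exec.If_False[of s r H q P' c' s'] unfolding wp_def
    by (intro exI[of _ "1 + c'"]) auto
next
  case False
  then obtain c' s' where "exec H q P s c' s'" "c' \<le> c" "Q s'" using assms(1) unfolding wp_def by blast
  then show ?thesis using False assms(3) exec.If_True[of s r H q P c' s'] unfolding wp_def
    by (intro exI[of _ "1 + c'"]) auto
qed

text \<open>\<open>I\<close> is indexed by the number of iterations left. Each of them pays for its
  test, and one more test ends the loop.\<close>

lemma wp_While:
  assumes "\<And>k s. I (Suc k) s \<Longrightarrow> reg s r \<noteq> 0 \<and> wp H q P c (I k) s"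
    and "\<And>s. I 0 s \<Longrightarrow> reg s r = 0"
    and "I n s" "1 + n * Suc c \<le> d" "\<And>s'. I 0 s' \<Longrightarrow> Q s'"
  shows "wp H q (While_Nonzero r P) d Q s"
proof -
  have "wp H q (While_Nonzero r P) (1 + n * Suc c) (I 0) s"
    using assms(3)
  proof (induction n arbitrary: s)
    case 0
    then show ?case using exec.While_False[of s r H q P] assms(2) unfolding wp_def
      by (intro exI[of _ 1] exI[of _ s]) auto
  next
    case (Suc n)
    from assms(1)[OF Suc.prems] obtain c' s' where
      1: "reg s r \<noteq> 0" "exec H q P s c' s'" "c' \<le> c" "I n s'" unfolding wp_def by blast
    from Suc.IH[OF 1(4)] obtain d' s'' where
      2: "exec H q (While_Nonzero r P) s' d' s''" "d' \<le> 1 + n * Suc c" "I 0 s''"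
      unfolding wp_def by blast
    show ?case unfolding wp_def
      by (intro exI[of _ "1 + c' + d'"] exI[of _ s''])
         (use exec.While_True[OF 1(1,2) 2(1)] 1(3) 2(2,3) in auto)
  qed
  then show ?thesis by (rule wp_conseq) (use assms in auto)
qed

text \<open>A straight-line prefix is kept apart from what follows so that its effect can be
  simplified as one state update, \<open>fold (step H)\<close>.\<close>

primrec block :: "instr list \<Rightarrow> prog \<Rightarrow> prog" where
  "block [] P = P"
| "block (i # is) P = Seq (Instr i) (block is P)"

lemma wp_block:
  assumes "wp H q P c Q (fold (step H) is s)" "length is * (q + 1) + c \<le> d"
  shows "wp H q (block is P) d Q s"
proof -
  have "wp H q (block is P) (length is * (q + 1) + c) Q s"
    using assms(1)
  proof (induction "is" arbitrary: s)
    case (Cons i "is")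
    then show ?case
      by (auto intro!: wp_Seq[where c = "q + 1"] wp_Instr)
  qed simp
  then show ?thesis by (rule wp_conseq) (use assms in auto)
qed

section \<open>Circuits under construction\<close>

lemma gate_values_snoc: "gate_values (gs @ [g]) = gate_values gs @ [gate_value (gate_values gs) g]"
  by (simp add: gate_values_def)

lemma length_gate_values [simp]: "length (gate_values gs) = length gs"
  by (induction gs rule: rev_induct) (simp_all add: gate_values_snoc, simp add: gate_values_def)

lemma gate_values_append_nth:
  "i < length gs \<Longrightarrow> gate_values (gs @ hs) ! i = gate_values gs ! i"
proof (induction hs rule: rev_induct)
  case (snoc h hs)
  then show ?case
    by (simp add: gate_values_snoc nth_append flip: append_assoc)
qed simp

definition gate_is :: "'k::comm_ring_1 state \<Rightarrow> nat \<Rightarrow> (nat, 'k) hpoly \<Rightarrow> bool" where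
  "gate_is s g p \<longleftrightarrow> g < length (gates (circ s)) \<and> gate_values (gates (circ s)) ! g = p"

text \<open>The value of a gate is fixed when it is emitted, so gate numbers stored in memory never
  lose their meaning.\<close>

lemma gate_is_extend:
  "gate_is s g p \<Longrightarrow> gates (circ s') = gates (circ s) @ gs \<Longrightarrow> gate_is s' g p"
  by (auto simp: gate_is_def gate_values_append_nth)

lemma gate_is_new:
  "gates (circ s') = gs @ [g] \<Longrightarrow> gate_is s' (length gs) (gate_value (gate_values gs) g)"
  by (simp add: gate_is_def gate_values_snoc nth_append)

section \<open>Table addresses\<close>

definition horner :: "nat \<Rightarrow> nat \<Rightarrow> nat list \<Rightarrow> nat" where
  "horner b = foldl (\<lambda>k x. k * b + x)"

lemma horner_simps [simp]:
  "horner b k [] = k" "horner b k (x # xs) = horner b (k * b + x) xs"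
  "horner b k (xs @ [x]) = horner b k xs * b + x"
  by (simp_all add: horner_def)

text \<open>Digits are recovered from the right as residues modulo \<open>b\<close>. Equal lengths
  are assumed because leading zeros do not change the value.\<close>

lemma horner_inj:
  assumes "length xs = length ys" "set xs \<subseteq> {..<b}" "set ys \<subseteq> {..<b}"
    "horner b 0 xs = horner b 0 ys"
  shows "xs = ys"
  using assms
proof (induction xs arbitrary: ys rule: rev_induct)
  case (snoc x xs)
  obtain zs z where ys: "ys = zs @ [z]" using snoc.prems(1) by (cases ys rule: rev_cases) auto
  have "x < b" "z < b" using snoc.prems ys by auto
  moreover have eq: "horner b 0 xs * b + x = horner b 0 zs * b + z" using snoc.prems ys by simp
  moreover have "(horner b 0 xs * b + x) mod b = x" "(horner b 0 zs * b + z) mod b = z"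
    using calculation(1,2) by simp_all
  ultimately have "x = z" by metis
  moreover from this have "horner b 0 xs = horner b 0 zs" using eq \<open>x < b\<close> by simp
  ultimately show ?case using snoc ys by simp
qed simp

section \<open>Programs\<close>

text \<open>Register conventions: 1 holds the constant 1, 2 the base \<open>2 ^ L\<close>, 3 the number \<open>L\<close>, 4 the
  end of the array of oriented edges, 5 the number of emitted gates, 6 the gate of the product
  being accumulated, 7 a table address; 8, 9 and 10 are scratch.  Loop \<open>j\<close> uses register \<open>20 + 3 * j\<close>
  as array pointer and the next two for the end points of its oriented edge.\<close>

definition shift_prog :: prog where
  "shift_prog = block [Set_Const 9 0, Add 8 3 9]
     (While_Nonzero 8 (block [Add 7 7 7] (Instr (Sub 8 8 1))))"

primrec key_prog :: "nat list \<Rightarrow> nat \<Rightarrow> prog" where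
  "key_prog [] t = Seq shift_prog (block [Set_Const 9 t] (Instr (Add 7 7 9)))"
| "key_prog (r # rs) t = Seq shift_prog (Seq (Instr (Add 7 7 r)) (key_prog rs t))"

text \<open>The tag is the last digit of the address; it is shifted by 2 to keep off the residues 0
  and 1, where the edge array lies.\<close>

definition lookup_prog :: "nat \<Rightarrow> nat list \<Rightarrow> prog" where
  "lookup_prog t rs = block [Set_Const 7 0] (Seq (key_prog rs (t + 2)) (Instr (Load 9 7)))"

text \<open>\<open>Emit_Mul\<close> reads register 5 before it is advanced past the leaf, so it
  refers to the leaf just emitted. The additions then make register 6 the product gate and register
  5 the new gate count.\<close>

primrec y_prog :: "nat list \<Rightarrow> prog \<Rightarrow> prog" where
  "y_prog [] P = P"
| "y_prog (r # rs) P = block [Emit_Y r, Emit_Mul 6 5, Add 6 5 1, Add 5 6 1] (y_prog rs P)"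

primrec x_prog :: "(nat \<times> nat) list \<Rightarrow> prog \<Rightarrow> prog" where
  "x_prog [] P = P"
| "x_prog (e # es) P = block [Emit_X (fst e) (snd e), Emit_Mul 6 5, Add 6 5 1, Add 5 6 1] (x_prog es P)"

text \<open>Clearing register 9 and adding it copies register 5 to register 6, as the machine has no
  move instruction.\<close>

primrec kids_prog :: "(nat \<times> nat list) list \<Rightarrow> prog \<Rightarrow> prog" where
  "kids_prog [] P = P"
| "kids_prog (k # ks) P = Seq (lookup_prog (fst k) (snd k))
     (block [Emit_Mul 6 9, Set_Const 9 0, Add 6 5 9, Add 5 5 1] (kids_prog ks P))"

definition store_prog :: "nat \<Rightarrow> nat list \<Rightarrow> prog" where
  "store_prog t rs = Seq (lookup_prog t rs) (block [Emit_Add 9 6, Store 7 5] (Instr (Add 5 5 1)))"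

text \<open>There are \<open>N\<close> tables, table \<open>t\<close> with keys of length
  \<open>ar t\<close>, and an array holding \<open>D\<close>. The assumption makes every shifted tag
  \<open>t + 2\<close> a proper digit in base \<open>2 ^ L\<close>.\<close>

locale table_machine =
  fixes H :: "nat ugraph" and q L N :: nat and D :: "(nat \<times> nat) list" and ar :: "nat \<Rightarrow> nat"
  assumes base: "N + 2 < 2 ^ L"
begin

text \<open>The unit in which times are counted: it dominates one host access and, up to a constant,
  a loop of \<open>L\<close> doublings.\<close>

definition W :: nat where "W = (q + 1) * (L + 1)"

definition addr :: "nat \<Rightarrow> nat list \<Rightarrow> nat" where
  "addr t xs = horner (2 ^ L) 0 xs * 2 ^ L + (t + 2)"

lemma addr_mod: "t < N \<Longrightarrow> addr t xs mod 2 ^ L = t + 2"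
proof -
  assume "t < N"
  then have "t + 2 < 2 ^ L" using base by linarith
  then show ?thesis by (simp only: addr_def mod_mult_self3 mod_less)
qed

lemma addr_inj:
  assumes "t < N" "t' < N" "length xs = ar t" "length xs' = ar t'"
    "set xs \<subseteq> {..<2 ^ L}" "set xs' \<subseteq> {..<2 ^ L}"
  shows "addr t xs = addr t' xs' \<longleftrightarrow> t = t' \<and> xs = xs'"
proof
  assume eq: "addr t xs = addr t' xs'"
  then have "t = t'" using addr_mod[of t xs] addr_mod[of t' xs'] assms by simp
  moreover from this have "horner (2 ^ L) 0 xs = horner (2 ^ L) 0 xs'" using eq by (simp add: addr_def)
  ultimately show "t = t' \<and> xs = xs'" using horner_inj assms by auto
qed simp

lemma W_bounds: "q + 1 \<le> W" "Suc 0 \<le> W"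
  by (auto simp: W_def)

lemma wp_block_W:
  assumes "wp H q P c Q (fold (step H) is s)" "length is * W + c \<le> d"
  shows "wp H q (block is P) d Q s"
proof (rule wp_block[OF assms(1)])
  have "length is * (q + 1) \<le> length is * W" using W_bounds(1) by (rule mult_le_mono2)
  then show "length is * (q + 1) + c \<le> d" using assms(2) by linarith
qed

lemma wp_Instr_W: "Q (step H i s) \<Longrightarrow> W \<le> c \<Longrightarrow> wp H q (Instr i) c Q s"
  using W_bounds(1) by (intro wp_Instr) auto

definition frame :: "nat set \<Rightarrow> 'k::comm_ring_1 state \<Rightarrow> 'k state \<Rightarrow> bool" where
  "frame R s s' \<longleftrightarrow> mem s' = mem s \<and> circ s' = circ s \<and> (\<forall>r. r \<notin> R \<longrightarrow> reg s' r = reg s r)"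

lemma wp_shift:
  fixes s :: "'k::comm_ring_1 state"
  assumes "reg s 1 = 1" "reg s 3 = L" "3 * W \<le> c"
    "\<And>s'. frame {7, 8, 9} s s' \<Longrightarrow> reg s' 7 = reg s 7 * 2 ^ L \<Longrightarrow> Q s'"
  shows "wp H q shift_prog c Q s"
proof -
  define I :: "nat \<Rightarrow> 'k state \<Rightarrow> bool" where
    "I = (\<lambda>k s'. k \<le> L \<and> frame {7, 8, 9} s s' \<and> reg s' 7 = reg s 7 * 2 ^ (L - k) \<and> reg s' 8 = k)"
  have "wp H q (While_Nonzero 8 (block [Add 7 7 7] (Instr (Sub 8 8 1)))) (1 + L * Suc (2 * (q + 1))) Q
    (fold (step H) [Set_Const 9 0, Add 8 3 9] s)"
  proof (rule wp_While[where I = I and n = L])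
    fix k and s' :: "'k state" assume I: "I (Suc k) s'"
    then have "L - k = Suc (L - Suc k)" by (auto simp: I_def)
    with I have "I k (step H (Sub 8 8 1) (fold (step H) [Add 7 7 7] s'))"
      using assms(1) by (auto simp: I_def frame_def)
    then have "wp H q (block [Add 7 7 7] (Instr (Sub 8 8 1))) (2 * (q + 1)) (I k) s'"
      by (intro wp_block[where c = "q + 1"] wp_Instr) simp_all
    with I show "reg s' 8 \<noteq> 0 \<and> wp H q (block [Add 7 7 7] (Instr (Sub 8 8 1))) (2 * (q + 1)) (I k) s'"
      by (simp add: I_def)
  qed (use assms in \<open>auto simp: I_def frame_def\<close>)
  then show ?thesis unfolding shift_prog_def
  proof (rule wp_block)
    show "length [Set_Const 9 0, Add 8 3 9] * (q + 1) + (1 + L * Suc (2 * (q + 1))) \<le> c"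
      using assms(3) by (simp add: W_def algebra_simps)
  qed
qed

lemma frame_trans: "frame R s s' \<Longrightarrow> frame R s' s'' \<Longrightarrow> frame R s s''"
  by (auto simp: frame_def)

lemma wp_key:
  assumes "reg s 1 = 1" "reg s 3 = L" "set rs \<inter> {7, 8, 9} = {}" "5 * (length rs + 1) * W \<le> c"
    "\<And>s'. frame {7, 8, 9} s s' \<Longrightarrow> reg s' 7 = horner (2 ^ L) (reg s 7) (map (reg s) rs @ [t]) \<Longrightarrow> Q s'"
  shows "wp H q (key_prog rs t) c Q s"
  using assms
proof (induction rs arbitrary: s c)
  case Nil
  show ?case unfolding key_prog.simps
  proof (rule wp_Seq[where c = "3 * W" and d = "2 * W"], rule wp_shift)
    fix s' assume s': "frame {7, 8, 9} s s'" "reg s' 7 = reg s 7 * 2 ^ L"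
    show "wp H q (block [Set_Const 9 t] (Instr (Add 7 7 9))) (2 * W) Q s'"
      by (rule wp_block_W[where c = W], rule wp_Instr_W, rule Nil.prems(5))
         (use s' in \<open>auto simp: frame_def\<close>)
  qed (use Nil in auto)
next
  case (Cons r rs)
  show ?case unfolding key_prog.simps
  proof (rule wp_Seq[where c = "3 * W" and d = "W + 5 * (length rs + 1) * W"], rule wp_shift)
    fix s' assume s': "frame {7, 8, 9} s s'" "reg s' 7 = reg s 7 * 2 ^ L"
    define s2 where "s2 = step H (Add 7 7 r) s'"
    have f: "frame {7, 8, 9} s s2" using s' by (auto simp: frame_def s2_def)
    have m: "map (reg s2) rs = map (reg s) rs"
    proof (rule map_cong[OF refl])
      fix x assume "x \<in> set rs"
      then have "x \<notin> {7, 8, 9}" using Cons.prems(3) by auto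
      then show "reg s2 x = reg s x" using f unfolding frame_def by blast
    qed
    have 7: "reg s2 7 = reg s 7 * 2 ^ L + reg s r"
      using s' Cons.prems(3) by (auto simp: frame_def s2_def)
    have "wp H q (key_prog rs t) (5 * (length rs + 1) * W) Q s2"
    proof (rule Cons.IH)
      fix s3 assume s3: "frame {7, 8, 9} s2 s3"
        "reg s3 7 = horner (2 ^ L) (reg s2 7) (map (reg s2) rs @ [t])"
      show "Q s3"
        by (rule Cons.prems(5)[OF frame_trans[OF f s3(1)]]) (simp add: s3(2) 7 m)
    qed (use f Cons.prems in \<open>auto simp: frame_def\<close>)
    then show "wp H q (Seq (Instr (Add 7 7 r)) (key_prog rs t)) (W + 5 * (length rs + 1) * W) Q s'"
      by (intro wp_Seq[where c = W and d = "5 * (length rs + 1) * W"] wp_Instr_W)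
         (simp_all add: s2_def)
  qed (use Cons.prems in \<open>auto simp: algebra_simps\<close>)
qed

lemma wp_lookup:
  assumes "reg s 1 = 1" "reg s 3 = L" "set rs \<inter> {7, 8, 9} = {}" "(5 * length rs + 7) * W \<le> c"
    "\<And>s'. frame {7, 8, 9} s s' \<Longrightarrow> reg s' 7 = addr t (map (reg s) rs) \<Longrightarrow>
       reg s' 9 = mem s (addr t (map (reg s) rs)) \<Longrightarrow> Q s'"
  shows "wp H q (lookup_prog t rs) c Q s"
  unfolding lookup_prog_def
proof (rule wp_block_W[where c = "5 * (length rs + 1) * W + W"],
    rule wp_Seq[where c = "5 * (length rs + 1) * W" and d = W], rule wp_key)
  let ?s = "fold (step H) [Set_Const 7 0] s"
  have m: "map (reg ?s) rs = map (reg s) rs" using assms(3) by auto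
  fix s' assume s': "frame {7, 8, 9} ?s s'"
    "reg s' 7 = horner (2 ^ L) (reg ?s 7) (map (reg ?s) rs @ [t + 2])"
  have "reg s' 7 = addr t (map (reg s) rs)" using s'(2)[unfolded m] by (simp add: addr_def)
  then show "wp H q (Instr (Load 9 7)) W Q s'"
    by (intro wp_Instr_W assms(5)) (use s' in \<open>auto simp: frame_def\<close>)
qed (use assms in \<open>auto simp: algebra_simps\<close>)

text \<open>Gate 0 holds the constant 0, so table entries that were never written denote the zero
  polynomial.  The edge array occupies the addresses congruent to 0 and 1 modulo \<open>2 ^ L\<close>.\<close>

definition consistent :: "(nat \<Rightarrow> nat list \<Rightarrow> (nat, 'k::comm_ring_1) hpoly) \<Rightarrow> 'k state \<Rightarrow> bool" where
  "consistent tab s \<longleftrightarrow>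
     reg s 1 = 1 \<and> reg s 2 = 2 ^ L \<and> reg s 3 = L \<and> reg s 4 = length D * 2 ^ L \<and>
     reg s 5 = length (gates (circ s)) \<and>
     (\<forall>j<length D. mem s (j * 2 ^ L) = fst (D ! j) \<and> mem s (j * 2 ^ L + 1) = snd (D ! j)) \<and>
     (\<forall>i<length (gates (circ s)). wf_gate (host_vars H) i (gates (circ s) ! i)) \<and>
     (\<forall>t<N. \<forall>xs. length xs = ar t \<longrightarrow> set xs \<subseteq> {..<2 ^ L} \<longrightarrow>
        gate_is s (mem s (addr t xs)) (tab t xs))"

lemma consistent_extend:
  assumes "consistent tab s" "mem s' = mem s" "gates (circ s') = gates (circ s) @ gs"
    "\<And>i. i < length gs \<Longrightarrow> wf_gate (host_vars H) (length (gates (circ s)) + i) (gs ! i)"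
    "\<And>r. r \<in> {1, 2, 3, 4} \<Longrightarrow> reg s' r = reg s r" "reg s' 5 = reg s 5 + length gs"
  shows "consistent tab s'"
proof -
  have "wf_gate (host_vars H) i (gates (circ s') ! i)" if "i < length (gates (circ s'))" for i
  proof (cases "i < length (gates (circ s))")
    case True
    then show ?thesis using assms(1,3) by (simp add: consistent_def nth_append)
  next
    case False
    then show ?thesis using assms(4)[of "i - length (gates (circ s))"] that assms(3)
      by (simp add: nth_append)
  qed
  moreover have "gate_is s' (mem s' (addr t xs)) (tab t xs)"
    if "t < N" "length xs = ar t" "set xs \<subseteq> {..<2 ^ L}" for t xs
  proof -
    have "gate_is s (mem s (addr t xs)) (tab t xs)"
      using assms(1) that unfolding consistent_def by blast
    then show ?thesis using gate_is_extend[OF _ assms(3)] assms(2) by simp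
  qed
  ultimately show ?thesis
    using assms unfolding consistent_def by simp
qed

lemma consistent_frame:
  assumes "consistent tab s" "frame R s s'" "\<And>r. r \<in> R \<Longrightarrow> r > 5"
  shows "consistent tab s'"
proof (rule consistent_extend[OF assms(1), where gs = "[]"])
  show "reg s' r = reg s r" if "r \<in> {1, 2, 3, 4}" for r
    using assms(2) assms(3)[of r] that unfolding frame_def by fastforce
  show "reg s' 5 = reg s 5 + length []"
    using assms(2) assms(3)[of 5] unfolding frame_def by auto
qed (use assms(2) in \<open>auto simp: frame_def\<close>)

text \<open>The invariant inside a loop body: register 6 names the product formed so far, and the
  loop registers, those from 20 on, hold the fixed environment \<open>\<rho>\<close>.\<close>

definition acc :: "(nat \<Rightarrow> nat list \<Rightarrow> (nat, 'k::comm_ring_1) hpoly) \<Rightarrow> (nat, 'k) hpoly \<Rightarrow> (nat \<Rightarrow> nat) \<Rightarrow>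
    'k state \<Rightarrow> bool" where
  "acc tab p \<rho> s \<longleftrightarrow> consistent tab s \<and> gate_is s (reg s 6) p \<and> (\<forall>r\<ge>20. reg s r = \<rho> r)"

lemma acc_mult_leaf:
  assumes "acc tab p \<rho> s" "wf_gate (host_vars H) (length (gates (circ s))) g"
    "mem s' = mem s" "gates (circ s') = gates (circ s) @ [g, Mul_Gate (reg s 6) (reg s 5)]"
    "gate_value (gate_values (gates (circ s))) g = p'"
    "reg s' = (reg s)(6 := reg s 5 + 1, 5 := reg s 5 + 2)"
  shows "acc tab (p * p') \<rho> s'"
proof -
  let ?g = "gates (circ s)"
  have a: "consistent tab s" "reg s 6 < length ?g" "gate_values ?g ! reg s 6 = p"
    "reg s 5 = length ?g"
    using assms(1) by (auto simp: acc_def gate_is_def consistent_def)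
  have "consistent tab s'"
    by (rule consistent_extend[OF a(1) assms(3,4)])
       (use assms a in \<open>auto simp: less_Suc_eq numeral_2_eq_2\<close>)
  moreover have "gate_is s' (length (?g @ [g])) (gate_value (gate_values (?g @ [g])) (Mul_Gate (reg s 6) (reg s 5)))"
    by (rule gate_is_new) (use assms in simp)
  then have "gate_is s' (reg s' 6) (p * p')"
    using a assms by (simp add: gate_values_snoc nth_append)
  ultimately show ?thesis using assms(1,6) by (simp add: acc_def)
qed

lemma wp_y:
  assumes "acc tab p \<rho> s" "\<And>r. r \<in> set rs \<Longrightarrow> 20 \<le> r \<and> \<rho> r \<in> verts H"
    "4 * length rs * W + c \<le> d"
    "\<And>s'. acc tab (p * (\<Prod>r\<leftarrow>rs. pvar (Y (\<rho> r)))) \<rho> s' \<Longrightarrow> wp H q P c Q s'"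
  shows "wp H q (y_prog rs P) d Q s"
  using assms
proof (induction rs arbitrary: s p d)
  case Nil
  then show ?case by (auto intro: wp_conseq)
next
  case (Cons r rs)
  let ?s = "fold (step H) [Emit_Y r, Emit_Mul 6 5, Add 6 5 1, Add 5 6 1] s"
  have r: "reg s r = \<rho> r" "reg s 1 = 1" using Cons.prems(1,2) by (auto simp: acc_def consistent_def)
  have "acc tab (p * pvar (Y (\<rho> r))) \<rho> ?s"
    by (rule acc_mult_leaf[OF Cons.prems(1), where g = "Var_Leaf (Y (\<rho> r))"])
       (use r Cons.prems(2) in \<open>auto simp: host_vars_def emit_def\<close>)
  then show ?case unfolding y_prog.simps
    by (intro wp_block_W[where c = "4 * length rs * W + c"] Cons.IH)
       (use Cons.prems in \<open>auto simp: algebra_simps\<close>)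
qed

lemma wp_x:
  assumes "acc tab p \<rho> s"
    "\<And>e. e \<in> set es \<Longrightarrow> 20 \<le> fst e \<and> 20 \<le> snd e \<and> {\<rho> (fst e), \<rho> (snd e)} \<in> edges H"
    "4 * length es * W + c \<le> d"
    "\<And>s'. acc tab (p * (\<Prod>e\<leftarrow>es. pvar (X {\<rho> (fst e), \<rho> (snd e)}))) \<rho> s' \<Longrightarrow> wp H q P c Q s'"
  shows "wp H q (x_prog es P) d Q s"
  using assms
proof (induction es arbitrary: s p d)
  case Nil
  then show ?case by (auto intro: wp_conseq)
next
  case (Cons e es)
  let ?s = "fold (step H) [Emit_X (fst e) (snd e), Emit_Mul 6 5, Add 6 5 1, Add 5 6 1] s"
  have r: "reg s (fst e) = \<rho> (fst e)" "reg s (snd e) = \<rho> (snd e)" "reg s 1 = 1"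
    using Cons.prems(1,2) by (auto simp: acc_def consistent_def)
  have "acc tab (p * pvar (X {\<rho> (fst e), \<rho> (snd e)})) \<rho> ?s"
    by (rule acc_mult_leaf[OF Cons.prems(1), where g = "Var_Leaf (X {\<rho> (fst e), \<rho> (snd e)})"])
       (use r Cons.prems(2) in \<open>auto simp: host_vars_def emit_def\<close>)
  then show ?case unfolding x_prog.simps
    by (intro wp_block_W[where c = "4 * length es * W + c"] Cons.IH)
       (use Cons.prems in \<open>auto simp: algebra_simps\<close>)
qed

definition table_ref :: "(nat \<Rightarrow> nat) \<Rightarrow> nat \<times> nat list \<Rightarrow> bool" where
  "table_ref \<rho> k \<longleftrightarrow> fst k < N \<and> length (snd k) = ar (fst k) \<and> (\<forall>r\<in>set (snd k). 20 \<le> r \<and> \<rho> r < 2 ^ L)"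

lemma acc_lookup:
  assumes "acc tab p \<rho> s" "table_ref \<rho> (t, rs)" "(5 * length rs + 7) * W \<le> c"
    "\<And>s'. acc tab p \<rho> s' \<Longrightarrow> reg s' 7 = addr t (map \<rho> rs) \<Longrightarrow> reg s' 9 = mem s' (addr t (map \<rho> rs)) \<Longrightarrow>
       gate_is s' (reg s' 9) (tab t (map \<rho> rs)) \<Longrightarrow> Q s'"
  shows "wp H q (lookup_prog t rs) c Q s"
proof (rule wp_lookup)
  have m: "map (reg s) rs = map \<rho> rs" using assms(1,2) by (auto simp: acc_def table_ref_def)
  fix s' assume s': "frame {7, 8, 9} s s'" "reg s' 7 = addr t (map (reg s) rs)"
    "reg s' 9 = mem s (addr t (map (reg s) rs))"
  have 1: "consistent tab s'"
    by (rule consistent_frame[OF _ s'(1)]) (use assms(1) in \<open>auto simp: acc_def\<close>)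
  then have "acc tab p \<rho> s'" using assms(1) s'(1) by (auto simp: acc_def frame_def gate_is_def)
  moreover have "gate_is s' (mem s' (addr t (map \<rho> rs))) (tab t (map \<rho> rs))"
  proof -
    have "t < N" "length (map \<rho> rs) = ar t" "set (map \<rho> rs) \<subseteq> {..<2 ^ L}"
      using assms(2) by (auto simp: table_ref_def)
    then show ?thesis using 1 unfolding consistent_def by blast
  qed
  ultimately show "Q s'" using s' m by (intro assms(4)) (auto simp: frame_def)
qed (use assms in \<open>auto simp: acc_def consistent_def table_ref_def\<close>)

lemma wp_kids:
  assumes "acc tab p \<rho> s" "\<And>k. k \<in> set ks \<Longrightarrow> table_ref \<rho> k"
    "(\<Sum>k\<leftarrow>ks. 5 * length (snd k) + 11) * W + c \<le> d"
    "\<And>s'. acc tab (p * (\<Prod>k\<leftarrow>ks. tab (fst k) (map \<rho> (snd k)))) \<rho> s' \<Longrightarrow> wp H q P c Q s'"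
  shows "wp H q (kids_prog ks P) d Q s"
  using assms
proof (induction ks arbitrary: s p d)
  case Nil
  then show ?case by (auto intro: wp_conseq)
next
  case (Cons k ks)
  let ?v = "tab (fst k) (map \<rho> (snd k))"
  let ?c = "(\<Sum>k\<leftarrow>ks. 5 * length (snd k) + 11) * W + c"
  show ?case unfolding kids_prog.simps
  proof (rule wp_Seq[where c = "(5 * length (snd k) + 7) * W" and d = "4 * W + ?c"], rule acc_lookup)
    fix s' assume s': "acc tab p \<rho> s'" "gate_is s' (reg s' 9) ?v"
    let ?s = "fold (step H) [Emit_Mul 6 9, Set_Const 9 0, Add 6 5 9, Add 5 5 1] s'"
    let ?g = "gates (circ s')"
    have a: "consistent tab s'" "reg s' 6 < length ?g" "gate_values ?g ! reg s' 6 = p"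
      "reg s' 9 < length ?g" "gate_values ?g ! reg s' 9 = ?v" "reg s' 5 = length ?g" "reg s' 1 = 1"
      using s' by (auto simp: acc_def gate_is_def consistent_def)
    have g: "gates (circ ?s) = ?g @ [Mul_Gate (reg s' 6) (reg s' 9)]" by (simp add: emit_def)
    have "consistent tab ?s"
      by (rule consistent_extend[OF a(1) _ g]) (use a in \<open>auto simp: emit_def\<close>)
    moreover have "gate_is ?s (reg ?s 6) (p * ?v)"
      using gate_is_new[OF g] a by (simp add: emit_def)
    moreover have "\<forall>r\<ge>20. reg ?s r = \<rho> r" using s'(1) by (auto simp: acc_def emit_def)
    ultimately have "acc tab (p * ?v) \<rho> ?s" unfolding acc_def by blast
    then show "wp H q (block [Emit_Mul 6 9, Set_Const 9 0, Add 6 5 9, Add 5 5 1] (kids_prog ks P))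
      (4 * W + ?c) Q s'"
      by (intro wp_block_W[where c = ?c] Cons.IH)
         (use Cons.prems in \<open>auto simp: algebra_simps\<close>)
  qed (use Cons.prems in \<open>auto simp: algebra_simps\<close>)
qed

definition add_entry :: "nat \<Rightarrow> nat list \<Rightarrow> 'r::comm_ring_1 \<Rightarrow> (nat \<Rightarrow> nat list \<Rightarrow> 'r) \<Rightarrow> nat \<Rightarrow> nat list \<Rightarrow> 'r" where
  "add_entry t xs p tab = tab(t := (tab t)(xs := tab t xs + p))"

text \<open>Emitted gates are immutable, so an entry is increased by emitting the sum of its old
  gate and the product and redirecting the cell to that sum.\<close>

lemma wp_store:
  assumes "acc tab p \<rho> s" "table_ref \<rho> (t, rs)" "(5 * length rs + 10) * W \<le> c"
  shows "wp H q (store_prog t rs) c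
    (\<lambda>s'. consistent (add_entry t (map \<rho> rs) p tab) s' \<and> (\<forall>r\<ge>20. reg s' r = \<rho> r)) s"
  unfolding store_prog_def
proof (rule wp_Seq[where c = "(5 * length rs + 7) * W" and d = "3 * W"], rule acc_lookup[OF assms(1,2)])
  fix s' let ?x = "map \<rho> rs" let ?a = "addr t ?x"
  let ?tab = "add_entry t ?x p tab"
  assume s': "acc tab p \<rho> s'" "reg s' 7 = ?a" "reg s' 9 = mem s' ?a" "gate_is s' (reg s' 9) (tab t ?x)"
  define s2 where "s2 = fold (step H) [Emit_Add 9 6, Store 7 5, Add 5 5 1] s'"
  let ?g = "gates (circ s')"
  have a: "consistent tab s'" "reg s' 6 < length ?g" "gate_values ?g ! reg s' 6 = p"
    "reg s' 9 < length ?g" "gate_values ?g ! reg s' 9 = tab t ?x" "reg s' 5 = length ?g" "reg s' 1 = 1"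
    using s' by (auto simp: acc_def gate_is_def consistent_def)
  have t: "t < N" "length ?x = ar t" "set ?x \<subseteq> {..<2 ^ L}"
    using assms(2) by (auto simp: table_ref_def)
  have g: "gates (circ s2) = ?g @ [Add_Gate (reg s' 9) (reg s' 6)]" by (simp add: emit_def s2_def)
  have m: "mem s2 = (mem s')(?a := reg s' 5)" using s' by (simp add: emit_def s2_def)
  \<comment> \<open>Emission and memory write are separated: first the new gate alone, with the old
    memory put back, then the single changed cell.\<close>
  have "consistent tab (s2\<lparr>mem := mem s'\<rparr>)"
    by (rule consistent_extend[OF a(1), where gs = "[Add_Gate (reg s' 9) (reg s' 6)]"])
       (use a in \<open>auto simp: emit_def s2_def\<close>)
  moreover have "gate_is s2 (mem s2 (addr t' xs)) (?tab t' xs)"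
    if "t' < N" "length xs = ar t'" "set xs \<subseteq> {..<2 ^ L}" for t' xs
  proof (cases "addr t' xs = ?a")
    case True
    then have "t' = t" "xs = ?x" using addr_inj that t by blast+
    then show ?thesis using gate_is_new[OF g] a m by (simp add: add_entry_def)
  next
    case False
    then have "?tab t' xs = tab t' xs" by (auto simp: add_entry_def)
    moreover have "gate_is s' (mem s' (addr t' xs)) (tab t' xs)"
      using a(1) that by (auto simp: consistent_def)
    ultimately show ?thesis using False m gate_is_extend[OF _ g] by simp
  qed
  \<comment> \<open>The write hits a residue of at least 2, so the edge array survives.\<close>
  moreover have "mem s2 (j * 2 ^ L) = mem s' (j * 2 ^ L)" "mem s2 (j * 2 ^ L + 1) = mem s' (j * 2 ^ L + 1)" for j
  proof -
    have "1 < (2::nat) ^ L" using base by linarith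
    then have "(j * 2 ^ L + 1) mod 2 ^ L = 1" "(j * 2 ^ L) mod 2 ^ L = 0"
      by (simp_all only: mod_mult_self3 mod_less mod_mult_self2_is_0)
    then have "?a \<noteq> j * 2 ^ L" "?a \<noteq> j * 2 ^ L + 1" using addr_mod[OF t(1), of ?x] by auto
    then show "mem s2 (j * 2 ^ L) = mem s' (j * 2 ^ L)"
      "mem s2 (j * 2 ^ L + 1) = mem s' (j * 2 ^ L + 1)" using m by auto
  qed
  ultimately have "consistent ?tab s2" unfolding consistent_def by auto
  moreover have "\<forall>r\<ge>20. reg s2 r = \<rho> r" using s'(1) by (auto simp: acc_def emit_def s2_def)
  ultimately show "wp H q (block [Emit_Add 9 6, Store 7 5] (Instr (Add 5 5 1))) (3 * W)
    (\<lambda>s'. consistent ?tab s' \<and> (\<forall>r\<ge>20. reg s' r = \<rho> r)) s'"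
    by (intro wp_block_W[where c = W] wp_Instr_W) (auto simp: s2_def)
qed (use assms in \<open>auto simp: algebra_simps\<close>)
end

section \<open>Enumeration of tuples of oriented edges\<close>

text \<open>The fields list the registers that the code of a bag compares, multiplies as vertex variables,
  multiplies as edge variables, and uses as keys of the tables of the children and of its own.\<close>

record node_code =
  n_eqs :: "(nat \<times> nat) list"
  n_ys :: "nat list"
  n_xs :: "(nat \<times> nat) list"
  n_kids :: "(nat \<times> nat list) list"
  n_tag :: nat
  n_key :: "nat list"

text \<open>Subtraction truncates at 0, so the sum of both differences vanishes only for equal
  operands. The branch that clears register 9 stands for doing nothing.\<close>

primrec eq_prog :: "(nat \<times> nat) list \<Rightarrow> prog \<Rightarrow> prog" where
  "eq_prog [] P = P"
| "eq_prog (e # es) P = block [Sub 9 (fst e) (snd e), Sub 10 (snd e) (fst e), Add 9 9 10]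
     (If_Nonzero 9 (Instr (Set_Const 9 0)) (eq_prog es P))"

text \<open>The enumeration guarantees host edges only for the covering edges, so the edges charged
  to the bag are tested here. A passed test also makes the edge variables emitted afterwards legal
  leaves.\<close>

primrec adj_prog :: "(nat \<times> nat) list \<Rightarrow> prog \<Rightarrow> prog" where
  "adj_prog [] P = P"
| "adj_prog (e # es) P = block [Adjacent 9 (fst e) (snd e)]
     (If_Nonzero 9 (adj_prog es P) (Instr (Set_Const 9 0)))"

definition body_prog :: "node_code \<Rightarrow> prog" where
  "body_prog nd = eq_prog (n_eqs nd) (adj_prog (n_xs nd)
     (block [Emit_Const 1, Set_Const 9 0, Add 6 5 9, Add 5 5 1]
        (y_prog (n_ys nd) (x_prog (n_xs nd) (kids_prog (n_kids nd) (store_prog (n_tag nd) (n_key nd)))))))"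

text \<open>Each loop runs through the array from its end, because the only loop test is for a
  nonzero register: the pointer is 0 once the first entry has been processed. Loop \<open>d\<close>
  encloses the loops with smaller numbers.\<close>

primrec nest_prog :: "nat \<Rightarrow> prog \<Rightarrow> prog" where
  "nest_prog 0 P = P"
| "nest_prog (Suc d) P = block [Set_Const 9 0, Add (20 + 3 * d) 4 9]
     (While_Nonzero (20 + 3 * d)
        (block [Sub (20 + 3 * d) (20 + 3 * d) 2, Load (21 + 3 * d) (20 + 3 * d),
                Add 9 (20 + 3 * d) 1, Load (22 + 3 * d) 9]
           (nest_prog d P)))"

definition node_prog :: "nat \<times> node_code \<Rightarrow> prog" where
  "node_prog kn = nest_prog (fst kn) (body_prog (snd kn))"

text \<open>The first loop doubles until the truncated difference in register 8 vanishes, which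
  finds the least \<open>L\<close> with \<open>2 ^ L\<close> at least n + N + 3, where n is the
  number of host vertices, initially in register 0. The second loop writes each edge in both
  orientations.\<close>

definition prelude_prog :: "nat \<Rightarrow> prog \<Rightarrow> prog" where
  "prelude_prog N P =
     block [Set_Const 1 1, Set_Const 9 (N + 3), Add 6 0 9, Set_Const 2 1, Set_Const 3 0, Sub 8 6 2]
     (Seq (While_Nonzero 8 (block [Add 2 2 2, Add 3 3 1] (Instr (Sub 8 6 2))))
     (block [Set_Const 9 0, Emit_Const 9, Set_Const 5 1, Set_Const 4 0, Next_Edge 6 7 8]
     (Seq (While_Nonzero 6
        (block [Store 4 7, Add 9 4 1, Store 9 8, Add 4 4 2, Store 4 8, Add 9 4 1, Store 9 7, Add 4 4 2]
           (Instr (Next_Edge 6 7 8))))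
      P)))"

definition hom_prog :: "nat \<Rightarrow> (nat \<times> node_code) list \<Rightarrow> prog" where
  "hom_prog N nds = prelude_prog N (foldr (\<lambda>kn. Seq (node_prog kn)) nds
     (Seq (lookup_prog (N - 1) []) (Instr (Set_Output 9))))"

text \<open>Counts the body in units of \<open>W\<close>: an edge takes 3 for its adjacency test and
  4 for its factor; 14 is 4 for the initial constant gate and 10 for the final store.\<close>

definition node_cost :: "node_code \<Rightarrow> nat" where
  "node_cost nd = 4 * length (n_eqs nd) + 7 * length (n_xs nd) + 4 * length (n_ys nd) +
     (\<Sum>k\<leftarrow>n_kids nd. 5 * length (snd k) + 11) + 5 * length (n_key nd) + 14"

definition node_regs :: "node_code \<Rightarrow> nat set" where
  "node_regs nd = fst ` set (n_eqs nd) \<union> snd ` set (n_eqs nd) \<union> set (n_ys nd) \<union>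
     fst ` set (n_xs nd) \<union> snd ` set (n_xs nd) \<union> (\<Union>k\<in>set (n_kids nd). set (snd k)) \<union> set (n_key nd)"

definition passes :: "nat ugraph \<Rightarrow> node_code \<Rightarrow> (nat \<Rightarrow> nat) \<Rightarrow> bool" where
  "passes H nd \<rho> \<longleftrightarrow> (\<forall>e\<in>set (n_eqs nd). \<rho> (fst e) = \<rho> (snd e)) \<and>
     (\<forall>e\<in>set (n_xs nd). {\<rho> (fst e), \<rho> (snd e)} \<in> edges H)"

definition contribution :: "node_code \<Rightarrow> (nat \<Rightarrow> nat) \<Rightarrow> (nat \<Rightarrow> nat list \<Rightarrow> (nat, 'k::comm_ring_1) hpoly) \<Rightarrow>
    (nat, 'k) hpoly" where
  "contribution nd \<rho> tab = (\<Prod>r\<leftarrow>n_ys nd. pvar (Y (\<rho> r))) *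
     (\<Prod>e\<leftarrow>n_xs nd. pvar (X {\<rho> (fst e), \<rho> (snd e)})) *
     (\<Prod>k\<leftarrow>n_kids nd. tab (fst k) (map \<rho> (snd k)))"

definition node_update :: "nat ugraph \<Rightarrow> node_code \<Rightarrow> (nat \<Rightarrow> nat) \<Rightarrow>
    (nat \<Rightarrow> nat list \<Rightarrow> (nat, 'k::comm_ring_1) hpoly) \<Rightarrow> nat \<Rightarrow> nat list \<Rightarrow> (nat, 'k) hpoly" where
  "node_update H nd \<rho> tab = (if passes H nd \<rho>
     then tab(n_tag nd := (tab (n_tag nd))
       (map \<rho> (n_key nd) := tab (n_tag nd) (map \<rho> (n_key nd)) + contribution nd \<rho> tab))
     else tab)"

text \<open>Lets the machine registers be replaced by the environment of a tuple, with which they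
  agree on the registers named in the code.\<close>

lemma node_update_cong:
  assumes "\<And>r. r \<in> node_regs nd \<Longrightarrow> \<rho> r = \<rho>' r"
  shows "node_update H nd \<rho> tab = node_update H nd \<rho>' tab"
proof -
  have 1: "\<rho> (fst e) = \<rho>' (fst e)" "\<rho> (snd e) = \<rho>' (snd e)"
    if "e \<in> set (n_eqs nd) \<or> e \<in> set (n_xs nd)" for e
    using that assms unfolding node_regs_def by blast+
  have "passes H nd \<rho> = passes H nd \<rho>'" unfolding passes_def using 1 by simp
  moreover have "map \<rho> (n_key nd) = map \<rho>' (n_key nd)"
    by (rule map_cong[OF refl]) (use assms in \<open>simp add: node_regs_def\<close>)
  moreover have "contribution nd \<rho> tab = contribution nd \<rho>' tab"
    unfolding contribution_def
  proof (intro arg_cong2[where f = "(*)"] arg_cong[where f = prod_list] map_cong refl)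
    fix k assume "k \<in> set (n_kids nd)"
    then have "map \<rho> (snd k) = map \<rho>' (snd k)"
      by (intro map_cong[OF refl] assms) (auto simp: node_regs_def)
    then show "tab (fst k) (map \<rho> (snd k)) = tab (fst k) (map \<rho>' (snd k))" by (rule arg_cong)
  qed (simp_all add: 1 assms node_regs_def)
  ultimately show ?thesis unfolding node_update_def by (simp only:)
qed

text \<open>Follows the order of the nested loops: \<open>\<tau>\<close> holds the choices of the
  outer loops, and the array is traversed backwards, hence \<open>rev D\<close>.\<close>

primrec tuples :: "'d list \<Rightarrow> nat \<Rightarrow> 'd list \<Rightarrow> 'd list list" where
  "tuples D 0 \<tau> = [\<tau>]"
| "tuples D (Suc d) \<tau> = concat (map (\<lambda>x. tuples D d (x # \<tau>)) (rev D))"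

lemma set_tuples: "set (tuples D d \<tau>) = {\<sigma> @ \<tau> | \<sigma>. length \<sigma> = d \<and> set \<sigma> \<subseteq> set D}"
proof (induction d arbitrary: \<tau>)
  case (Suc d)
  have "set (tuples D (Suc d) \<tau>) = (\<Union>x\<in>set D. {\<sigma> @ x # \<tau> | \<sigma>. length \<sigma> = d \<and> set \<sigma> \<subseteq> set D})"
    by (simp add: Suc.IH)
  also have "\<dots> = {\<sigma> @ \<tau> | \<sigma>. length \<sigma> = Suc d \<and> set \<sigma> \<subseteq> set D}"
  proof (intro subset_antisym subsetI)
    fix \<upsilon> assume "\<upsilon> \<in> (\<Union>x\<in>set D. {\<sigma> @ x # \<tau> | \<sigma>. length \<sigma> = d \<and> set \<sigma> \<subseteq> set D})"
    then obtain x \<sigma> where "\<upsilon> = (\<sigma> @ [x]) @ \<tau>" "x \<in> set D" "length \<sigma> = d" "set \<sigma> \<subseteq> set D" by auto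
    then show "\<upsilon> \<in> {\<sigma> @ \<tau> | \<sigma>. length \<sigma> = Suc d \<and> set \<sigma> \<subseteq> set D}"
      by (intro CollectI exI[of _ "\<sigma> @ [x]"]) auto
  next
    fix \<upsilon> assume "\<upsilon> \<in> {\<sigma> @ \<tau> | \<sigma>. length \<sigma> = Suc d \<and> set \<sigma> \<subseteq> set D}"
    then obtain \<sigma> where s: "\<upsilon> = \<sigma> @ \<tau>" "length \<sigma> = Suc d" "set \<sigma> \<subseteq> set D" by auto
    then obtain \<sigma>' x where "\<sigma> = \<sigma>' @ [x]" by (cases \<sigma> rule: rev_cases) auto
    with s show "\<upsilon> \<in> (\<Union>x\<in>set D. {\<sigma> @ x # \<tau> | \<sigma>. length \<sigma> = d \<and> set \<sigma> \<subseteq> set D})" by auto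
  qed
  finally show ?case .
qed auto

text \<open>This turns the sum over iterations into a sum over the set of tuples.\<close>

lemma distinct_tuples: "distinct D \<Longrightarrow> distinct (tuples D d \<tau>)"
proof (induction d arbitrary: \<tau>)
  case (Suc d)
  have disj: "x = y" if "\<upsilon> \<in> set (tuples D d (x # \<tau>))" "\<upsilon> \<in> set (tuples D d (y # \<tau>))" for x y \<upsilon>
  proof -
    obtain \<sigma> \<sigma>' where "\<upsilon> = \<sigma> @ x # \<tau>" "\<upsilon> = \<sigma>' @ y # \<tau>" "length \<sigma> = d" "length \<sigma>' = d"
      using \<open>\<upsilon> \<in> set (tuples D d (x # \<tau>))\<close> \<open>\<upsilon> \<in> set (tuples D d (y # \<tau>))\<close>
      unfolding set_tuples by blast
    then show ?thesis by simp
  qed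
  show ?case unfolding tuples.simps
  proof (rule distinct_concat)
    have "inj_on (\<lambda>x. tuples D d (x # \<tau>)) (set (rev D))"
    proof (rule inj_onI)
      fix x y assume x: "x \<in> set (rev D)" "tuples D d (x # \<tau>) = tuples D d (y # \<tau>)"
      have "replicate d x @ x # \<tau> \<in> set (tuples D d (x # \<tau>))"
        using x(1) by (auto simp: set_tuples)
      with x(2) show "x = y" using disj by metis
    qed
    then show "distinct (map (\<lambda>x. tuples D d (x # \<tau>)) (rev D))"
      using Suc.prems by (simp add: distinct_map)
  next
    fix ys zs assume "ys \<in> set (map (\<lambda>x. tuples D d (x # \<tau>)) (rev D))"
      "zs \<in> set (map (\<lambda>x. tuples D d (x # \<tau>)) (rev D))" "ys \<noteq> zs"
    then obtain x y where "ys = tuples D d (x # \<tau>)" "zs = tuples D d (y # \<tau>)" "x \<noteq> y" by auto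
    then show "set ys \<inter> set zs = {}" using disj by blast
  qed (use Suc in auto)
qed simp

definition bound :: "nat \<Rightarrow> (nat \<times> nat) list \<Rightarrow> 'k::comm_ring_1 state \<Rightarrow> bool" where
  "bound d \<tau> s \<longleftrightarrow> (\<forall>j<length \<tau>. reg s (21 + 3 * (d + j)) = fst (\<tau> ! j) \<and>
     reg s (22 + 3 * (d + j)) = snd (\<tau> ! j))"

lemma bound_Cons:
  "bound d (x # \<tau>) s \<longleftrightarrow> reg s (21 + 3 * d) = fst x \<and> reg s (22 + 3 * d) = snd x \<and> bound (Suc d) \<tau> s"
  unfolding bound_def by (auto simp: nth_Cons less_Suc_eq_0_disj split: nat.splits)

text \<open>Inverts the register layout: \<open>21 + 3 * j\<close> is divisible by 3 and
  \<open>22 + 3 * j\<close> is not.\<close>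

definition env :: "(nat \<times> nat) list \<Rightarrow> nat \<Rightarrow> nat" where
  "env \<tau> r = (if r mod 3 = 0 then fst (\<tau> ! ((r - 21) div 3)) else snd (\<tau> ! ((r - 22) div 3)))"

lemma env_simps [simp]: "env \<tau> (21 + 3 * j) = fst (\<tau> ! j)" "env \<tau> (22 + 3 * j) = snd (\<tau> ! j)"
proof -
  have "(21 + 3 * j) mod 3 = 0" "(22 + 3 * j) mod 3 \<noteq> 0" by presburger+
  then show "env \<tau> (21 + 3 * j) = fst (\<tau> ! j)" "env \<tau> (22 + 3 * j) = snd (\<tau> ! j)"
    by (simp_all add: env_def)
qed

text \<open>The oriented edges in the order in which the prelude stores them. Both orientations
  occur, since a covering edge can be mapped to a host edge in two ways.\<close>

definition darts :: "nat ugraph \<Rightarrow> (nat \<times> nat) list" where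
  "darts H = concat (map (\<lambda>e. [e, (snd e, fst e)]) (edge_list H))"

lemma length_darts: "length (darts H) = 2 * length (edge_list H)"
  by (simp add: darts_def length_concat comp_def sum_list_triv)

lemma nth_darts:
  assumes "i < length (edge_list H)"
  shows "darts H ! (2 * i) = edge_list H ! i"
    "darts H ! (2 * i + 1) = (snd (edge_list H ! i), fst (edge_list H ! i))"
proof -
  have "concat (map (\<lambda>e. [e, (snd e, fst e)]) es) ! (2 * i) = es ! i \<and>
    concat (map (\<lambda>e. [e, (snd e, fst e)]) es) ! (2 * i + 1) = (snd (es ! i), fst (es ! i))"
    if "i < length es" for es :: "(nat \<times> nat) list"
    using that
  proof (induction es arbitrary: i)
    case (Cons e es)
    then show ?case by (cases i) auto
  qed simp
  with assms show "darts H ! (2 * i) = edge_list H ! i"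
    "darts H ! (2 * i + 1) = (snd (edge_list H ! i), fst (edge_list H ! i))"
    by (simp_all add: darts_def)
qed

section \<open>Correctness and cost of tests and loops\<close>

context table_machine
begin

lemma wp_eq:
  assumes "consistent tab s" "\<And>r. 20 \<le> r \<Longrightarrow> reg s r = \<rho> r"
    "\<And>e. e \<in> set es \<Longrightarrow> 20 \<le> fst e \<and> 20 \<le> snd e" "4 * length es * W + c \<le> d" "W \<le> c"
    "\<And>s'. \<forall>e\<in>set es. \<rho> (fst e) = \<rho> (snd e) \<Longrightarrow> consistent tab s' \<Longrightarrow> \<forall>r\<ge>20. reg s' r = \<rho> r \<Longrightarrow>
       wp H q P c Q s'"
    "\<And>s'. \<not> (\<forall>e\<in>set es. \<rho> (fst e) = \<rho> (snd e)) \<Longrightarrow> consistent tab s' \<Longrightarrow> \<forall>r\<ge>20. reg s' r = \<rho> r \<Longrightarrow> Q s'"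
  shows "wp H q (eq_prog es P) d Q s"
  using assms
proof (induction es arbitrary: s d)
  case Nil
  then show ?case by (auto intro: wp_conseq)
next
  case (Cons e es)
  define s2 where "s2 = fold (step H) [Sub 9 (fst e) (snd e), Sub 10 (snd e) (fst e), Add 9 9 10] s"
  have f: "frame {9, 10} s s2" by (auto simp: frame_def s2_def)
  have c2: "consistent tab s2" by (rule consistent_frame[OF Cons.prems(1) f]) auto
  have \<rho>2: "reg s2 r = \<rho> r" if "20 \<le> r" for r
    using f Cons.prems(2) that by (auto simp: frame_def)
  have e: "20 \<le> fst e" "20 \<le> snd e" using Cons.prems(3) by auto
  have 9: "reg s2 9 = 0 \<longleftrightarrow> \<rho> (fst e) = \<rho> (snd e)"
    using e Cons.prems(2) by (auto simp: s2_def)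
  have "wp H q (If_Nonzero 9 (Instr (Set_Const 9 0)) (eq_prog es P)) (W + (4 * length es * W + c)) Q s2"
  proof (rule wp_If[where c = "4 * length es * W + c"])
    assume 0: "reg s2 9 \<noteq> 0"
    let ?s = "step H (Set_Const 9 0) s2"
    have "frame {9} s2 ?s" by (auto simp: frame_def)
    then have "consistent tab ?s" by (rule consistent_frame[OF c2]) auto
    moreover have "\<forall>r\<ge>20. reg ?s r = \<rho> r" using \<rho>2 by auto
    ultimately show "wp H q (Instr (Set_Const 9 0)) (4 * length es * W + c) Q s2"
      by (intro wp_Instr_W Cons.prems(7)) (use 0 9 Cons.prems(5) in auto)
  next
    assume 0: "reg s2 9 = 0"
    show "wp H q (eq_prog es P) (4 * length es * W + c) Q s2"
      by (rule Cons.IH[OF c2 \<rho>2]) (use 0 9 Cons.prems in auto)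
  qed (use W_bounds in auto)
  then show ?case unfolding eq_prog.simps
    by (intro wp_block_W[where c = "W + (4 * length es * W + c)"])
       (use Cons.prems in \<open>auto simp: s2_def algebra_simps\<close>)
qed

lemma wp_adj:
  assumes "consistent tab s" "\<And>r. 20 \<le> r \<Longrightarrow> reg s r = \<rho> r"
    "\<And>e. e \<in> set es \<Longrightarrow> 20 \<le> fst e \<and> 20 \<le> snd e" "3 * length es * W + c \<le> d" "W \<le> c"
    "\<And>s'. \<forall>e\<in>set es. {\<rho> (fst e), \<rho> (snd e)} \<in> edges H \<Longrightarrow> consistent tab s' \<Longrightarrow>
       \<forall>r\<ge>20. reg s' r = \<rho> r \<Longrightarrow> wp H q P c Q s'"
    "\<And>s'. \<not> (\<forall>e\<in>set es. {\<rho> (fst e), \<rho> (snd e)} \<in> edges H) \<Longrightarrow> consistent tab s' \<Longrightarrow>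
       \<forall>r\<ge>20. reg s' r = \<rho> r \<Longrightarrow> Q s'"
  shows "wp H q (adj_prog es P) d Q s"
  using assms
proof (induction es arbitrary: s d)
  case Nil
  then show ?case by (auto intro: wp_conseq)
next
  case (Cons e es)
  define s2 where "s2 = fold (step H) [Adjacent 9 (fst e) (snd e)] s"
  have f: "frame {9} s s2" by (auto simp: frame_def s2_def)
  have c2: "consistent tab s2" by (rule consistent_frame[OF Cons.prems(1) f]) auto
  have \<rho>2: "reg s2 r = \<rho> r" if "20 \<le> r" for r
    using f Cons.prems(2) that by (auto simp: frame_def)
  have e: "20 \<le> fst e" "20 \<le> snd e" using Cons.prems(3) by auto
  have 9: "reg s2 9 \<noteq> 0 \<longleftrightarrow> {\<rho> (fst e), \<rho> (snd e)} \<in> edges H"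
    using e Cons.prems(2) by (auto simp: s2_def)
  have "wp H q (If_Nonzero 9 (adj_prog es P) (Instr (Set_Const 9 0))) (W + (3 * length es * W + c)) Q s2"
  proof (rule wp_If[where c = "3 * length es * W + c"])
    assume 0: "reg s2 9 = 0"
    let ?s = "step H (Set_Const 9 0) s2"
    have "frame {9} s2 ?s" by (auto simp: frame_def)
    then have "consistent tab ?s" by (rule consistent_frame[OF c2]) auto
    moreover have "\<forall>r\<ge>20. reg ?s r = \<rho> r" using \<rho>2 by auto
    ultimately show "wp H q (Instr (Set_Const 9 0)) (3 * length es * W + c) Q s2"
      by (intro wp_Instr_W Cons.prems(7)) (use 0 9 Cons.prems(5) in auto)
  next
    assume 0: "reg s2 9 \<noteq> 0"
    show "wp H q (adj_prog es P) (3 * length es * W + c) Q s2"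
      by (rule Cons.IH[OF c2 \<rho>2]) (use 0 9 Cons.prems in auto)
  qed (use W_bounds in auto)
  then show ?case unfolding adj_prog.simps
    by (intro wp_block_W[where c = "W + (3 * length es * W + c)"])
       (use Cons.prems in \<open>auto simp: s2_def algebra_simps\<close>)
qed

definition valid_node :: "node_code \<Rightarrow> bool" where
  "valid_node nd \<longleftrightarrow> (\<forall>r\<in>node_regs nd. 20 \<le> r) \<and> n_tag nd < N \<and> length (n_key nd) = ar (n_tag nd) \<and>
     (\<forall>k\<in>set (n_kids nd). fst k < N \<and> length (snd k) = ar (fst k))"

lemma wp_body:
  assumes c: "consistent tab s" and nd: "valid_node nd"
    and val: "\<And>r. r \<in> node_regs nd \<Longrightarrow> reg s r \<in> verts H" "verts H \<subseteq> {..<2 ^ L}"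
    and d: "node_cost nd * W \<le> d"
  shows "wp H q (body_prog nd) d
    (\<lambda>s'. consistent (node_update H nd (reg s) tab) s' \<and> (\<forall>r\<ge>20. reg s' r = reg s r)) s"
proof -
  let ?\<rho> = "reg s"
  let ?Q = "\<lambda>s'. consistent (node_update H nd ?\<rho> tab) s' \<and> (\<forall>r\<ge>20. reg s' r = ?\<rho> r)"
  let ?c4 = "(5 * length (n_key nd) + 10) * W"
  let ?c3 = "(\<Sum>k\<leftarrow>n_kids nd. 5 * length (snd k) + 11) * W + ?c4"
  let ?c2 = "4 * length (n_xs nd) * W + ?c3"
  let ?c1 = "4 * length (n_ys nd) * W + ?c2"
  let ?c0 = "3 * length (n_xs nd) * W + (4 * W + ?c1)"
  have regs: "20 \<le> r" "?\<rho> r < 2 ^ L" if "r \<in> node_regs nd" for r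
    using nd val that unfolding valid_node_def by blast+
  have refs: "table_ref ?\<rho> k" if "k = (n_tag nd, n_key nd) \<or> k \<in> set (n_kids nd)" for k
  proof -
    have "set (snd k) \<subseteq> node_regs nd" using that by (auto simp: node_regs_def)
    then show ?thesis using nd that regs unfolding table_ref_def valid_node_def by auto
  qed
  have es: "20 \<le> fst e \<and> 20 \<le> snd e" if "e \<in> set (n_eqs nd) \<or> e \<in> set (n_xs nd)" for e
    using that by (auto intro!: regs(1) simp: node_regs_def)
  show ?thesis unfolding body_prog_def
  proof (rule wp_eq[where c = ?c0, OF c])
    fix s1 :: "'a state" assume s1: "\<forall>e\<in>set (n_eqs nd). ?\<rho> (fst e) = ?\<rho> (snd e)" "consistent tab s1" "\<forall>r\<ge>20. reg s1 r = ?\<rho> r"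
    let ?P4 = "store_prog (n_tag nd) (n_key nd)"
    let ?P3 = "kids_prog (n_kids nd) ?P4"
    let ?P2 = "x_prog (n_xs nd) ?P3"
    let ?P1 = "y_prog (n_ys nd) ?P2"
    let ?is = "[Emit_Const 1, Set_Const 9 0, Add 6 5 9, Add 5 5 1]"
    show "wp H q (adj_prog (n_xs nd) (block ?is ?P1)) ?c0 ?Q s1"
    proof (rule wp_adj[where c = "4 * W + ?c1" and \<rho> = ?\<rho>, OF s1(2)])
      fix s2 :: "'a state" assume s2: "\<forall>e\<in>set (n_xs nd). {?\<rho> (fst e), ?\<rho> (snd e)} \<in> edges H" "consistent tab s2"
        "\<forall>r\<ge>20. reg s2 r = ?\<rho> r"
      define s3 where "s3 = fold (step H) ?is s2"
      have r: "reg s2 1 = 1" "reg s2 5 = length (gates (circ s2))" using s2(2) by (auto simp: consistent_def)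
      have g: "gates (circ s3) = gates (circ s2) @ [Const_Leaf 1]" using r by (simp add: s3_def emit_def)
      have "consistent tab s3"
        by (rule consistent_extend[OF s2(2) _ g]) (use r in \<open>auto simp: s3_def emit_def\<close>)
      moreover have "gate_is s3 (reg s3 6) 1"
        using gate_is_new[OF g] r by (simp add: s3_def emit_def pconst_def flip: single_one)
      moreover have "\<forall>r\<ge>20. reg s3 r = ?\<rho> r" using s2(3) by (auto simp: s3_def emit_def)
      ultimately have a3: "acc tab 1 ?\<rho> s3" by (simp add: acc_def)
      have "wp H q ?P1 ?c1 ?Q s3"
      proof (rule wp_y[OF a3, where c = ?c2], goal_cases)
        case (3 s4)
        show ?case
        proof (rule wp_x[OF 3, where c = ?c3], goal_cases)
          case (3 s5)
          show ?case
          proof (rule wp_kids[OF 3, where c = ?c4], goal_cases)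
            case (3 s6)
            have "passes H nd ?\<rho>" using s1(1) s2(1) by (simp add: passes_def)
            then show ?case
              using wp_store[OF 3 refs order_refl] by (simp add: node_update_def add_entry_def contribution_def)
          qed (use refs in auto)
        qed (use es s2(1) in auto)
      next
        case (1 r)
        then have "r \<in> node_regs nd" by (simp add: node_regs_def)
        then show ?case using regs val by blast
      qed auto
      then show "wp H q (block ?is ?P1) (4 * W + ?c1) ?Q s2"
        by (intro wp_block_W[where c = ?c1]) (auto simp: s3_def)
    next
      fix s2 :: "'a state" assume s2: "\<not> (\<forall>e\<in>set (n_xs nd). {?\<rho> (fst e), ?\<rho> (snd e)} \<in> edges H)" "consistent tab s2"
        "\<forall>r\<ge>20. reg s2 r = ?\<rho> r"
      then have "\<not> passes H nd ?\<rho>" by (auto simp: passes_def)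
      with s2 show "?Q s2" by (simp add: node_update_def)
    qed (use s1 es in auto)
  next
    fix s1 :: "'a state" assume s1: "\<not> (\<forall>e\<in>set (n_eqs nd). ?\<rho> (fst e) = ?\<rho> (snd e))" "consistent tab s1" "\<forall>r\<ge>20. reg s1 r = ?\<rho> r"
    then have "\<not> passes H nd ?\<rho>" by (auto simp: passes_def)
    with s1 show "?Q s1" by (simp add: node_update_def)
  next
    show "4 * length (n_eqs nd) * W + ?c0 \<le> d" using d by (simp add: node_cost_def algebra_simps)
  qed (use es in auto)
qed

text \<open>Whatever the body does to the tables is abstracted into \<open>upd\<close>, so the loops
  amount to a fold over \<open>tuples\<close>. In the cost, \<open>max 1\<close> keeps the power
  positive for an empty array, when setting up the loop still takes time.\<close>

lemma wp_nest:
  fixes upd :: "(nat \<times> nat) list \<Rightarrow> (nat \<Rightarrow> nat list \<Rightarrow> (nat, 'k::comm_ring_1) hpoly) \<Rightarrow>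
    nat \<Rightarrow> nat list \<Rightarrow> (nat, 'k) hpoly"
  assumes body: "\<And>\<tau> tab s. length \<tau> = K \<Longrightarrow> set \<tau> \<subseteq> set D \<Longrightarrow> consistent tab s \<Longrightarrow> bound 0 \<tau> s \<Longrightarrow>
      wp H q P c (\<lambda>s'. consistent (upd \<tau> tab) s' \<and> (\<forall>r\<ge>20. reg s' r = reg s r)) s"
    and "d + length \<tau> = K" "set \<tau> \<subseteq> set D" "consistent tab s" "bound d \<tau> s"
  shows "wp H q (nest_prog d P) ((max 1 (length D)) ^ d * (c + 8 * W * d))
    (\<lambda>s'. consistent (fold upd (tuples D d \<tau>) tab) s' \<and> (\<forall>r\<ge>20 + 3 * d. reg s' r = reg s r)) s"
  using assms(2-)
proof (induction d arbitrary: \<tau> tab s)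
  case 0
  then show ?case using body[of \<tau> tab s] by simp
next
  case (Suc d)
  let ?p = "20 + 3 * d" let ?M = "max 1 (length D)"
  let ?C = "?M ^ d * (c + 8 * W * d)"
  let ?is = "[Sub ?p ?p 2, Load (21 + 3 * d) ?p, Add 9 ?p 1, Load (22 + 3 * d) 9]"
  \<comment> \<open>The loop counts down, so with \<open>k\<close> iterations left the entries of
    \<open>D\<close> from position \<open>k\<close> on have been processed.\<close>
  let ?tups = "\<lambda>k. concat (map (\<lambda>x. tuples D d (x # \<tau>)) (rev (drop k D)))"
  define I :: "nat \<Rightarrow> 'k state \<Rightarrow> bool" where
    "I = (\<lambda>k s'. k \<le> length D \<and> consistent (fold upd (?tups k) tab) s' \<and> reg s' ?p = k * 2 ^ L \<and>
       (\<forall>r\<ge>20 + 3 * Suc d. reg s' r = reg s r))"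
  have "wp H q (While_Nonzero ?p (block ?is (nest_prog d P))) (1 + length D * Suc (4 * W + ?C)) (I 0)
    (fold (step H) [Set_Const 9 0, Add ?p 4 9] s)"
  proof (rule wp_While[where I = I and n = "length D"])
    fix k and s1 :: "'k state" assume I1: "I (Suc k) s1"
    define s2 where "s2 = fold (step H) ?is s1"
    have k: "k < length D" using I1 by (simp add: I_def)
    have c1: "consistent (fold upd (?tups (Suc k)) tab) s1" using I1 by (simp add: I_def)
    have f: "frame {r. r = 9 \<or> r = ?p \<or> r = 21 + 3 * d \<or> r = 22 + 3 * d} s1 s2"
      by (auto simp: frame_def s2_def)
    have c2: "consistent (fold upd (?tups (Suc k)) tab) s2"
      by (rule consistent_frame[OF c1 f]) auto
    have r1: "reg s1 1 = 1" "reg s1 2 = 2 ^ L" "reg s1 ?p = Suc k * 2 ^ L"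
      using c1 I1 by (auto simp: consistent_def I_def)
    have m: "mem s1 (k * 2 ^ L) = fst (D ! k)" "mem s1 (k * 2 ^ L + 1) = snd (D ! k)"
      using c1 k by (auto simp: consistent_def)
    have r2: "reg s2 ?p = k * 2 ^ L" "reg s2 (21 + 3 * d) = fst (D ! k)" "reg s2 (22 + 3 * d) = snd (D ! k)"
      using r1 m by (simp_all add: s2_def)
    have hi: "reg s2 r = reg s r" if "r \<ge> 20 + 3 * Suc d" for r
      using f I1 that by (auto simp: frame_def I_def)
    have "bound (Suc d) \<tau> s2" using Suc.prems(4) hi unfolding bound_def by simp
    then have b2: "bound d (D ! k # \<tau>) s2" using r2 by (simp add: bound_Cons)
    have "wp H q (nest_prog d P) ?C (\<lambda>s'. consistent (fold upd (tuples D d (D ! k # \<tau>)) (fold upd (?tups (Suc k)) tab)) s' \<and>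
        (\<forall>r\<ge>20 + 3 * d. reg s' r = reg s2 r)) s2"
      by (rule Suc.IH[OF _ _ c2 b2]) (use Suc.prems k in auto)
    then have "wp H q (nest_prog d P) ?C (I k) s2"
    proof (rule wp_conseq)
      fix s3 assume s3: "consistent (fold upd (tuples D d (D ! k # \<tau>)) (fold upd (?tups (Suc k)) tab)) s3 \<and>
        (\<forall>r\<ge>20 + 3 * d. reg s3 r = reg s2 r)"
      have "?tups k = ?tups (Suc k) @ tuples D d (D ! k # \<tau>)"
        using Cons_nth_drop_Suc[OF k, symmetric] by simp
      then show "I k s3" using s3 k r2 hi by (simp add: I_def)
    qed simp
    then have "wp H q (block ?is (nest_prog d P)) (4 * W + ?C) (I k) s1"
      by (intro wp_block_W[where c = ?C]) (simp_all add: s2_def)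
    then show "reg s1 ?p \<noteq> 0 \<and> wp H q (block ?is (nest_prog d P)) (4 * W + ?C) (I k) s1"
      using r1 by simp
  next
    let ?s = "fold (step H) [Set_Const 9 0, Add ?p 4 9] s"
    have "frame {r. r = 9 \<or> r = ?p} s ?s" by (auto simp: frame_def)
    then have "consistent tab ?s" by (rule consistent_frame[OF Suc.prems(3)]) auto
    moreover have "reg s 4 = length D * 2 ^ L" using Suc.prems(3) by (simp add: consistent_def)
    ultimately show "I (length D) ?s" by (simp add: I_def)
  qed (auto simp: I_def)
  then have "wp H q (nest_prog (Suc d) P) (2 * W + (1 + length D * Suc (4 * W + ?C))) (I 0) s"
    unfolding nest_prog.simps by (intro wp_block_W[where c = "1 + length D * Suc (4 * W + ?C)"]) simp_all
  then show ?case
  proof (rule wp_conseq)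
    \<comment> \<open>A level costs at most \<open>3 * W\<close> for the set-up and
      \<open>5 * W\<close> per iteration beyond what it encloses, which makes the 8.\<close>
    have "2 * W + (1 + length D * Suc (4 * W + ?C)) \<le> ?M * (3 * W) + ?M * (5 * W + ?C)"
    proof (rule order_trans[OF _ add_mono])
      show "3 * W \<le> ?M * (3 * W)" using mult_le_mono1[of 1 ?M "3 * W"] by simp
      show "length D * (5 * W + ?C) \<le> ?M * (5 * W + ?C)" by (rule mult_le_mono1) simp
      have "length D * Suc (4 * W + ?C) \<le> length D * (5 * W + ?C)"
        using W_bounds(2) by (intro mult_le_mono2) simp
      then show "2 * W + (1 + length D * Suc (4 * W + ?C)) \<le> 3 * W + length D * (5 * W + ?C)"
        using W_bounds(2) by linarith
    qed
    also have "\<dots> = ?M * (8 * W) + ?M * ?C" by (simp add: algebra_simps)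
    also have "\<dots> \<le> ?M ^ Suc d * (8 * W) + ?M ^ Suc d * (c + 8 * W * d)"
    proof (rule add_mono)
      have "?M ^ 1 \<le> ?M ^ Suc d" by (rule power_increasing) auto
      then show "?M * (8 * W) \<le> ?M ^ Suc d * (8 * W)" by (intro mult_le_mono1) simp
    qed simp
    finally show "2 * W + (1 + length D * Suc (4 * W + ?C)) \<le> ?M ^ Suc d * (c + 8 * W * Suc d)"
      by (simp add: algebra_simps)
  qed (simp add: I_def)
qed

lemma wp_node:
  assumes c: "consistent tab s" and nd: "valid_node nd" and D: "set D \<subseteq> verts H \<times> verts H" "verts H \<subseteq> {..<2 ^ L}"
    and regs: "\<And>r. r \<in> node_regs nd \<Longrightarrow> \<exists>j<K. r = 21 + 3 * j \<or> r = 22 + 3 * j"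
  shows "wp H q (node_prog (K, nd)) ((max 1 (length D)) ^ K * ((node_cost nd + 8 * K) * W))
    (consistent (fold (\<lambda>\<tau>. node_update H nd (env \<tau>)) (tuples D K []) tab)) s"
proof -
  have "wp H q (nest_prog K (body_prog nd)) ((max 1 (length D)) ^ K * (node_cost nd * W + 8 * W * K))
    (\<lambda>s'. consistent (fold (\<lambda>\<tau>. node_update H nd (env \<tau>)) (tuples D K []) tab) s' \<and>
      (\<forall>r\<ge>20 + 3 * K. reg s' r = reg s r)) s"
  proof (rule wp_nest[where K = K and \<tau> = "[]"])
    fix \<tau> tab and s :: "'a state"
    assume \<tau>: "length \<tau> = K" "set \<tau> \<subseteq> set D" "consistent tab s" "bound 0 \<tau> s"
    have e: "reg s r = env \<tau> r \<and> reg s r \<in> verts H" if r: "r \<in> node_regs nd" for r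
    proof -
      obtain j where j: "j < K" "r = 21 + 3 * j \<or> r = 22 + 3 * j" using regs[OF r] by blast
      have "\<tau> ! j \<in> verts H \<times> verts H" using j \<tau>(1,2) D(1) nth_mem by blast
      then show ?thesis using j \<tau>(1,4) by (auto simp: bound_def mem_Times_iff)
    qed
    have "node_update H nd (env \<tau>) tab = node_update H nd (reg s) tab"
      by (rule node_update_cong) (simp add: e)
    then show "wp H q (body_prog nd) (node_cost nd * W)
      (\<lambda>s'. consistent (node_update H nd (env \<tau>) tab) s' \<and> (\<forall>r\<ge>20. reg s' r = reg s r)) s"
      using wp_body[OF \<tau>(3) nd conjunct2[OF e] D(2) order_refl] by (simp only:)
  qed (use c in \<open>simp_all add: bound_def\<close>)
  then show ?thesis unfolding node_prog_def fst_conv snd_conv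
    by (rule wp_conseq) (auto simp: algebra_simps)
qed

lemma array_address_eq:
  fixes i j :: nat
  shows "i * 2 ^ L = j * 2 ^ L \<longleftrightarrow> i = j" "i * 2 ^ L + 1 = j * 2 ^ L + 1 \<longleftrightarrow> i = j"
  "i * 2 ^ L \<noteq> j * 2 ^ L + 1" "j * 2 ^ L + 1 \<noteq> i * 2 ^ L"
  "(i * 2 ^ L) mod 2 ^ L = 0" "(i * 2 ^ L + 1) mod 2 ^ L = 1"
proof -
  have "1 < (2::nat) ^ L" using base by linarith
  then show m: "(i * 2 ^ L) mod 2 ^ L = 0" "(i * 2 ^ L + 1) mod 2 ^ L = 1" for i :: nat
    by (simp_all only: mod_mult_self3 mod_less mod_mult_self2_is_0)
  show "i * 2 ^ L \<noteq> j * 2 ^ L + 1" "j * 2 ^ L + 1 \<noteq> i * 2 ^ L"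
    using m(1)[of i] m(2)[of j] by (metis zero_neq_one)+
qed simp_all

text \<open>Minimality of \<open>L\<close> keeps the doubling loop running until step
  \<open>L\<close>, so registers 2 and 3 end with exactly the parameters used in the
  addresses.\<close>

lemma wp_prelude:
  fixes Q :: "'k::comm_ring_1 state \<Rightarrow> bool"
  assumes D: "D = darts H"
    and L: "card (verts H) + N + 3 \<le> 2 ^ L" "\<And>l. l < L \<Longrightarrow> 2 ^ l < card (verts H) + N + 3"
    and P: "\<And>s :: 'k state. consistent (\<lambda>_ _. 0) s \<Longrightarrow> wp H q P c Q s"
    and d: "(16 + 10 * (length (edge_list H) + 1)) * W + c \<le> d"
  shows "wp H q (prelude_prog N P) d Q (init_state H)"
proof -
  let ?E = "edge_list H"
  let ?m = "length ?E"
  let ?t = "card (verts H) + N + 3"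
  define I1 :: "nat \<Rightarrow> 'k state \<Rightarrow> bool" where
    "I1 = (\<lambda>k s. k \<le> L \<and> reg s 1 = 1 \<and> reg s 6 = ?t \<and> reg s 2 = 2 ^ (L - k) \<and> reg s 3 = L - k \<and>
       reg s 8 = ?t - 2 ^ (L - k) \<and> mem s = (\<lambda>_. 0) \<and> iter_pos s = 0 \<and> gates (circ s) = [])"
  define J :: "nat \<Rightarrow> 'k state \<Rightarrow> bool" where
    "J = (\<lambda>j s. reg s 1 = 1 \<and> reg s 2 = 2 ^ L \<and> reg s 3 = L \<and> reg s 4 = 2 * j * 2 ^ L \<and> reg s 5 = 1 \<and>
       gates (circ s) = [Const_Leaf 0] \<and>
       (\<forall>i<2 * j. mem s (i * 2 ^ L) = fst (D ! i) \<and> mem s (i * 2 ^ L + 1) = snd (D ! i)) \<and>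
       (\<forall>a. 2 \<le> a mod 2 ^ L \<longrightarrow> mem s a = 0))"
  \<comment> \<open>The next edge is fetched at the end of each iteration: while edges are left, the
    first of them is already in registers 7 and 8 and the iterator is one ahead.\<close>
  define I2 :: "nat \<Rightarrow> 'k state \<Rightarrow> bool" where
    "I2 = (\<lambda>k s. k \<le> ?m \<and> J (?m - k) s \<and> (if k = 0 then reg s 6 = 0
       else reg s 6 = 1 \<and> reg s 7 = fst (?E ! (?m - k)) \<and> reg s 8 = snd (?E ! (?m - k)) \<and>
         iter_pos s = Suc (?m - k)))"
  let ?is1 = "[Set_Const 1 1, Set_Const 9 (N + 3), Add 6 0 9, Set_Const 2 1, Set_Const 3 0, Sub 8 6 2]"
  let ?is2 = "[Set_Const 9 0, Emit_Const 9, Set_Const 5 1, Set_Const 4 0, Next_Edge 6 7 8]"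
  let ?is3 = "[Store 4 7, Add 9 4 1, Store 9 8, Add 4 4 2, Store 4 8, Add 9 4 1, Store 9 7, Add 4 4 2]"
  let ?W1 = "While_Nonzero 8 (block [Add 2 2 2, Add 3 3 1] (Instr (Sub 8 6 2)))"
  let ?W2 = "While_Nonzero 6 (block ?is3 (Instr (Next_Edge 6 7 8)))"
  let ?c2 = "1 + ?m * Suc (9 * W)"
  let ?c1 = "1 + L * Suc (3 * (q + 1))"

  have next_edge: "I2 (?m - j) (step H (Next_Edge 6 7 8) s)"
    if "J j s" "j \<le> ?m" "iter_pos s = j" for j and s :: "'k state"
  proof (cases "j = ?m")
    case True
    then show ?thesis using that by (auto simp: I2_def J_def)
  next
    case False
    then have "?m - (?m - j) = j" "?m - j \<noteq> 0" "j < ?m" using that by auto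
    then show ?thesis using that by (simp add: I2_def J_def)
  qed

  have W2: "wp H q ?W2 ?c2 (I2 0) s" if "I2 ?m s" for s
  proof (rule wp_While[where I = I2 and n = ?m])
    fix k and s :: "'k state" assume I: "I2 (Suc k) s"
    define j where "j = ?m - Suc k"
    have j: "j < ?m" "?m - Suc j = k" "Suc j \<le> ?m" using I by (auto simp: j_def I2_def)
    have s: "J j s" "reg s 6 = 1" "reg s 7 = fst (?E ! j)" "reg s 8 = snd (?E ! j)" "iter_pos s = Suc j"
      using I by (auto simp: I2_def j_def)
    define s' where "s' = fold (step H) ?is3 s"
    have r: "reg s 1 = 1" "reg s 2 = 2 ^ L" "reg s 4 = 2 * j * 2 ^ L" using s(1) by (auto simp: J_def)
    have mem: "mem s' = (mem s)((2 * j) * 2 ^ L := fst (?E ! j), (2 * j) * 2 ^ L + 1 := snd (?E ! j),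
        (2 * j + 1) * 2 ^ L := snd (?E ! j), (2 * j + 1) * 2 ^ L + 1 := fst (?E ! j))"
      using r s(3,4) by (simp add: s'_def algebra_simps)
    have arr: "mem s' (i * 2 ^ L) = fst (D ! i) \<and> mem s' (i * 2 ^ L + 1) = snd (D ! i)" if i: "i < 2 * Suc j" for i
    proof -
      have upd: "mem s' (i * 2 ^ L) = (if i = 2 * j + 1 then snd (?E ! j)
          else if i = 2 * j then fst (?E ! j) else mem s (i * 2 ^ L))"
        "mem s' (i * 2 ^ L + 1) = (if i = 2 * j + 1 then fst (?E ! j)
          else if i = 2 * j then snd (?E ! j) else mem s (i * 2 ^ L + 1))"
        unfolding mem by (simp_all only: fun_upd_apply array_address_eq if_False)
      have "i < 2 * j \<or> i = 2 * j \<or> i = 2 * j + 1" using i by auto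
      then consider "i < 2 * j" | "i = 2 * j" | "i = 2 * j + 1" by blast
      then show ?thesis
      proof cases
        case 1
        then have "mem s (i * 2 ^ L) = fst (D ! i) \<and> mem s (i * 2 ^ L + 1) = snd (D ! i)"
          using s(1) by (simp add: J_def)
        then show ?thesis using 1 unfolding upd by simp
      next
        case 2
        then show ?thesis unfolding upd using nth_darts[OF j(1)] D by simp
      next
        case 3
        then show ?thesis unfolding upd using nth_darts[OF j(1)] D by simp
      qed
    qed
    have zero: "mem s' a = 0" if "2 \<le> a mod 2 ^ L" for a
    proof -
      have ne: "a \<noteq> i * 2 ^ L" "a \<noteq> i * 2 ^ L + 1" for i
        using that array_address_eq(5,6)[of i] by auto
      have "mem s' a = mem s a" unfolding mem by (simp only: fun_upd_apply ne if_False)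
      then show ?thesis using s(1) that by (simp add: J_def)
    qed
    have "reg s' = (reg s)(9 := (2 * j + 1) * 2 ^ L + 1, 4 := 2 * Suc j * 2 ^ L)"
      using r by (auto simp: s'_def algebra_simps fun_eq_iff)
    moreover have "circ s' = circ s" "iter_pos s' = Suc j" using s(5) by (simp_all add: s'_def)
    ultimately have "J (Suc j) s'" using s(1) arr zero unfolding J_def by simp
    from next_edge[OF this j(3) \<open>iter_pos s' = Suc j\<close>]
    have "I2 k (step H (Next_Edge 6 7 8) s')" unfolding j(2) .
    then have "wp H q (block ?is3 (Instr (Next_Edge 6 7 8))) (9 * W) (I2 k) s"
      by (intro wp_block_W[where c = W] wp_Instr_W) (simp_all add: s'_def)
    then show "reg s 6 \<noteq> 0 \<and> wp H q (block ?is3 (Instr (Next_Edge 6 7 8))) (9 * W) (I2 k) s"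
      using s(2) by simp
  qed (use that in \<open>auto simp: I2_def\<close>)

  have loaded: "consistent (\<lambda>_ _. 0) s" if "I2 0 s" for s :: "'k state"
  proof -
    have J: "J ?m s" using that by (simp add: I2_def)
    then have g: "gates (circ s) = [] @ [Const_Leaf 0]" by (simp add: J_def)
    have "gate_is s (mem s (addr t xs)) 0" if "t < N" for t xs
    proof -
      have "mem s (addr t xs) = 0" using J addr_mod[OF that, of xs] by (simp add: J_def)
      then show ?thesis using gate_is_new[OF g] by (simp add: pconst_def)
    qed
    moreover have "length D = 2 * ?m" by (simp add: D length_darts)
    ultimately show ?thesis using J unfolding consistent_def J_def by simp
  qed

  have W1: "wp H q ?W1 ?c1 (I1 0) s" if "I1 L s" for s
  proof (rule wp_While[where I = I1 and n = L])
    fix k and s :: "'k state" assume I: "I1 (Suc k) s"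
    then have k: "L - k = Suc (L - Suc k)" by (auto simp: I1_def)
    then have "2 ^ (L - Suc k) < ?t" by (intro L(2)) simp
    then have "reg s 8 \<noteq> 0" using I by (simp add: I1_def)
    moreover have "I1 k (step H (Sub 8 6 2) (fold (step H) [Add 2 2 2, Add 3 3 1] s))"
      using I k by (simp add: I1_def mult_2)
    then have "wp H q (block [Add 2 2 2, Add 3 3 1] (Instr (Sub 8 6 2))) (3 * (q + 1)) (I1 k) s"
      by (intro wp_block[where c = "q + 1"] wp_Instr) simp_all
    ultimately show "reg s 8 \<noteq> 0 \<and>
      wp H q (block [Add 2 2 2, Add 3 3 1] (Instr (Sub 8 6 2))) (3 * (q + 1)) (I1 k) s" by simp
  qed (use that L(1) in \<open>auto simp: I1_def\<close>)

  have I1_init: "I1 L (fold (step H) ?is1 (init_state H))" by (simp add: I1_def init_state_def)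
  have "wp H q (Seq ?W1 (block ?is2 (Seq ?W2 P))) (?c1 + (5 * W + (?c2 + c))) Q
    (fold (step H) ?is1 (init_state H))"
  proof (rule wp_Seq[OF wp_conseq[OF W1[OF I1_init] order_refl]])
    fix s :: "'k state" assume s: "I1 0 s"
    let ?s = "fold (step H) [Set_Const 9 0, Emit_Const 9, Set_Const 5 1, Set_Const 4 0] s"
    have "J 0 ?s" "iter_pos ?s = 0" using s by (simp_all add: I1_def J_def emit_def)
    then have i2: "I2 ?m (step H (Next_Edge 6 7 8) ?s)"
      using next_edge[of 0 ?s] unfolding minus_nat.diff_0 by blast
    have "wp H q (Seq ?W2 P) (?c2 + c) Q (step H (Next_Edge 6 7 8) ?s)"
      by (rule wp_Seq[OF wp_conseq[OF W2[OF i2] order_refl P[OF loaded]] order_refl])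
    then show "wp H q (block ?is2 (Seq ?W2 P)) (5 * W + (?c2 + c)) Q s"
      by (intro wp_block_W[where c = "?c2 + c"]) simp_all
  qed simp
  then show ?thesis unfolding prelude_prog_def
  proof (rule wp_block_W)
    have "?c1 \<le> 5 * W" by (simp add: W_def algebra_simps)
    moreover have "?c2 \<le> 10 * (?m + 1) * W"
    proof -
      have "?m * Suc (9 * W) \<le> ?m * (10 * W)" using W_bounds(2) by (intro mult_le_mono2) simp
      then have "?c2 \<le> W + ?m * (10 * W)" using W_bounds(2) by linarith
      also have "\<dots> \<le> 10 * (?m + 1) * W" by (simp add: algebra_simps)
      finally show ?thesis .
    qed
    ultimately show "length ?is1 * W + (?c1 + (5 * W + (?c2 + c))) \<le> d"
      using d by (simp add: algebra_simps)
  qed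
qed

lemma wp_nodes:
  assumes "consistent tab s" and D: "set D \<subseteq> verts H \<times> verts H" "verts H \<subseteq> {..<2 ^ L}"
    and "\<And>kn. kn \<in> set nds \<Longrightarrow> valid_node (snd kn) \<and> fst kn \<le> K \<and>
      (\<forall>r\<in>node_regs (snd kn). \<exists>j<fst kn. r = 21 + 3 * j \<or> r = 22 + 3 * j)"
    and P: "\<And>s. consistent (fold (\<lambda>kn. fold (\<lambda>\<tau>. node_update H (snd kn) (env \<tau>)) (tuples D (fst kn) [])) nds tab) s \<Longrightarrow>
      wp H q P c Q s"
    and d: "(max 1 (length D)) ^ K * ((\<Sum>kn\<leftarrow>nds. node_cost (snd kn) + 8 * fst kn) * W) + c \<le> d"
  shows "wp H q (foldr (\<lambda>kn. Seq (node_prog kn)) nds P) d Q s"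
  using assms(1,4-)
proof (induction nds arbitrary: tab s d)
  case Nil
  then show ?case by (auto intro: wp_conseq)
next
  case (Cons kn nds)
  let ?M = "max 1 (length D)"
  let ?d = "?M ^ K * ((\<Sum>kn\<leftarrow>nds. node_cost (snd kn) + 8 * fst kn) * W) + c"
  let ?tab = "fold (\<lambda>\<tau>. node_update H (snd kn) (env \<tau>)) (tuples D (fst kn) []) tab"
  have "wp H q (node_prog (fst kn, snd kn)) (?M ^ fst kn * ((node_cost (snd kn) + 8 * fst kn) * W))
    (consistent ?tab) s"
    by (rule wp_node[OF Cons.prems(1) _ D]) (use Cons.prems(2)[of kn] in auto)
  then have 1: "wp H q (node_prog kn) (?M ^ K * ((node_cost (snd kn) + 8 * fst kn) * W))
    (wp H q (foldr (\<lambda>kn. Seq (node_prog kn)) nds P) ?d Q) s"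
    unfolding prod.collapse
  proof (rule wp_conseq)
    have "?M ^ fst kn \<le> ?M ^ K" using Cons.prems(2)[of kn] by (intro power_increasing) auto
    then show "?M ^ fst kn * ((node_cost (snd kn) + 8 * fst kn) * W) \<le>
      ?M ^ K * ((node_cost (snd kn) + 8 * fst kn) * W)" by (rule mult_le_mono1)
    fix s' assume "consistent ?tab s'"
    then show "wp H q (foldr (\<lambda>kn. Seq (node_prog kn)) nds P) ?d Q s'"
      by (rule Cons.IH) (use Cons.prems in auto)
  qed
  show ?case
    unfolding foldr.simps comp_def
    by (rule wp_Seq[OF 1]) (use Cons.prems(4) in \<open>simp add: algebra_simps\<close>)
qed

lemma wp_hom_prog:
  fixes tab :: "nat \<Rightarrow> nat list \<Rightarrow> (nat, 'k::comm_ring_1) hpoly"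
  assumes D: "D = darts H" "set D \<subseteq> verts H \<times> verts H" "verts H \<subseteq> {..<2 ^ L}"
    and L: "card (verts H) + N + 3 \<le> 2 ^ L" "\<And>l. l < L \<Longrightarrow> 2 ^ l < card (verts H) + N + 3"
    and nds: "\<And>kn. kn \<in> set nds \<Longrightarrow> valid_node (snd kn) \<and> fst kn \<le> K \<and>
      (\<forall>r\<in>node_regs (snd kn). \<exists>j<fst kn. r = 21 + 3 * j \<or> r = 22 + 3 * j)"
    and tab: "tab = fold (\<lambda>kn. fold (\<lambda>\<tau>. node_update H (snd kn) (env \<tau>)) (tuples D (fst kn) [])) nds (\<lambda>_ _. 0)"
    and N: "N > 0" "ar (N - 1) = 0" and K: "K > 0"
  shows "wp H q (hom_prog N nds)
    ((2 * max 1 (length (edge_list H))) ^ K * ((\<Sum>kn\<leftarrow>nds. node_cost (snd kn) + 8 * fst kn) + 44) * W)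
    (\<lambda>s. circuit_computes (host_vars H) (circ s) (tab (N - 1) [])) (init_state H)"
proof -
  let ?E = "length (edge_list H)"
  let ?S = "\<Sum>kn\<leftarrow>nds. node_cost (snd kn) + 8 * fst kn"
  let ?M = "2 * max 1 ?E"
  let ?Q = "\<lambda>s :: 'k state. circuit_computes (host_vars H) (circ s) (tab (N - 1) [])"
  have out: "wp H q (Seq (lookup_prog (N - 1) []) (Instr (Set_Output 9))) (8 * W) ?Q s"
    if c: "consistent tab s" for s :: "'k state"
  proof (rule wp_Seq[where c = "7 * W" and d = W], rule wp_lookup)
    fix s' assume s': "frame {7, 8, 9} s s'" "reg s' 9 = mem s (addr (N - 1) (map (reg s) []))"
    have "consistent tab s'" by (rule consistent_frame[OF c s'(1)]) auto
    moreover have "gate_is s (mem s (addr (N - 1) [])) (tab (N - 1) [])"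
      using c N unfolding consistent_def by simp
    ultimately show "wp H q (Instr (Set_Output 9)) W ?Q s'"
      using s' by (intro wp_Instr_W)
        (auto simp: circuit_computes_def wf_circuit_def consistent_def gate_is_def frame_def)
  qed (use c in \<open>auto simp: consistent_def\<close>)
  have "max 1 (length D) \<le> ?M" by (simp add: D(1) length_darts)
  then have M1: "max 1 (length D) ^ K \<le> ?M ^ K" by (rule power_mono) simp
  \<comment> \<open>With \<open>K > 0\<close> the main term dominates the linear time spent on
    reading the edges.\<close>
  have M2: "?M ^ 1 \<le> ?M ^ K" by (rule power_increasing) (use K in auto)
  have main: "wp H q (foldr (\<lambda>kn. Seq (node_prog kn)) nds (Seq (lookup_prog (N - 1) []) (Instr (Set_Output 9))))
    (?M ^ K * (?S * W) + 8 * W) ?Q s" if "consistent (\<lambda>_ _. 0) s" for s :: "'k state"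
    by (rule wp_nodes[OF that D(2,3) nds out])
       (use M1 in \<open>auto simp: tab intro!: mult_le_mono1\<close>)
  show ?thesis unfolding hom_prog_def
  proof (rule wp_prelude[OF D(1) L main])
    have "1 \<le> ?M ^ K" "?E + 1 \<le> ?M ^ K" using M2 unfolding power_one_right by linarith+
    moreover have "16 + 10 * (e + 1) + 8 \<le> 44 * x" if "1 \<le> x" "e + 1 \<le> x" for e x :: nat
      using that by (simp add: algebra_simps)
    ultimately have "16 + 10 * (?E + 1) + 8 \<le> 44 * ?M ^ K" by blast
    then have "(16 + 10 * (?E + 1) + 8) * W \<le> 44 * ?M ^ K * W" by (rule mult_le_mono1)
    then show "(16 + 10 * (?E + 1)) * W + (?M ^ K * (?S * W) + 8 * W) \<le> ?M ^ K * (?S + 44) * W"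
      by (simp add: algebra_simps)
  qed
qed
end

section \<open>Tables of a covered sequence of bags\<close>

definition list_of :: "'b set \<Rightarrow> 'b list" where
  "list_of S = (SOME l. distinct l \<and> set l = S)"

lemma list_of: "finite S \<Longrightarrow> distinct (list_of S) \<and> set (list_of S) = S"
  unfolding list_of_def by (rule someI_ex) (metis finite_distinct_list)

text \<open>Pairs each end point of a covering edge with the register that receives its image; a
  vertex of two covering edges occurs twice.\<close>

definition occurrences :: "('a \<times> 'a) list \<Rightarrow> ('a \<times> nat) list" where
  "occurrences cs = concat (map (\<lambda>j. [(fst (cs ! j), 21 + 3 * j), (snd (cs ! j), 22 + 3 * j)]) [0..<length cs])"

text \<open>\<open>map_of\<close> picks the first occurrence, so each covered vertex has one
  register from which it is read.\<close>

definition slot :: "('a \<times> 'a) list \<Rightarrow> 'a \<Rightarrow> nat" where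
  "slot cs v = the (map_of (occurrences cs) v)"

definition ends :: "'a set \<Rightarrow> 'a \<times> 'a" where
  "ends e = (SOME p. e = {fst p, snd p})"

lemma ends: "card e = 2 \<Longrightarrow> {fst (ends e), snd (ends e)} = e"
proof -
  assume "card e = 2"
  then obtain a b where "e = {a, b}" by (auto simp: card_2_iff)
  then have "\<exists>p. e = {fst p, snd p}" by (intro exI[of _ "(a, b)"]) simp
  then have "e = {fst (ends e), snd (ends e)}" unfolding ends_def by (rule someI_ex)
  then show ?thesis by simp
qed

lemma set_occurrences:
  "(v, r) \<in> set (occurrences cs) \<longleftrightarrow>
     (\<exists>j<length cs. v = fst (cs ! j) \<and> r = 21 + 3 * j \<or> v = snd (cs ! j) \<and> r = 22 + 3 * j)"
  unfolding occurrences_def by auto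

lemma slot_in_occurrences:
  assumes "v \<in> (\<Union>(a, b)\<in>set cs. {a, b})"
  shows "(v, slot cs v) \<in> set (occurrences cs)"
proof -
  obtain j where "j < length cs" "v = fst (cs ! j) \<or> v = snd (cs ! j)"
    using assms by (fastforce simp: in_set_conv_nth)
  then have "\<exists>r. (v, r) \<in> set (occurrences cs)" unfolding set_occurrences by blast
  then have "map_of (occurrences cs) v \<noteq> None"
    unfolding map_of_eq_None_iff by force
  then show ?thesis unfolding slot_def by (auto intro: map_of_SomeD)
qed

lemma set_darts:
  assumes "simple_graph H"
  shows "set (darts H) = {(u, v). {u, v} \<in> edges H}"
proof -
  have "{(u, v). u < v \<and> {u, v} \<in> edges H} \<subseteq> verts H \<times> verts H"
    using assms by (auto simp: simple_graph_def)
  then have "finite {(u, v). u < v \<and> {u, v} \<in> edges H}"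
    using assms by (auto simp: simple_graph_def intro: finite_subset)
  then have 1: "set (edge_list H) = {(u, v). u < v \<and> {u, v} \<in> edges H}"
    by (simp add: edge_list_def)
  have 2: "u \<noteq> v" if "{u, v} \<in> edges H" for u v
    using assms that by (auto simp: simple_graph_def)
  have 3: "set (darts H) = set (edge_list H) \<union> (\<lambda>e. (snd e, fst e)) ` set (edge_list H)"
    unfolding darts_def by auto
  have "(u, v) \<in> set (darts H) \<longleftrightarrow> {u, v} \<in> edges H" for u v
  proof -
    have "(u, v) \<in> set (darts H) \<longleftrightarrow> (u < v \<or> v < u) \<and> {u, v} \<in> edges H"
      unfolding 3 1 by (auto simp: image_iff insert_commute)
    then show ?thesis using 2[of u v] by auto
  qed
  then show ?thesis by auto
qed

lemma length_edge_list:
  assumes "simple_graph H"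
  shows "length (edge_list H) = num_edges H"
proof -
  let ?A = "{(u, v). u < v \<and> {u, v} \<in> edges H}"
  have "?A \<subseteq> verts H \<times> verts H" using assms by (auto simp: simple_graph_def)
  then have fin: "finite ?A" using assms by (auto simp: simple_graph_def intro: finite_subset)
  have "bij_betw (\<lambda>(u, v). {u, v}) ?A (edges H)"
  proof (rule bij_betwI')
    fix e assume e: "e \<in> edges H"
    then have "card e = 2" using assms by (auto simp: simple_graph_def)
    then obtain u v where uv: "e = {u, v}" "u \<noteq> v" by (auto simp: card_2_iff)
    show "\<exists>x\<in>?A. e = (case x of (u, v) \<Rightarrow> {u, v})"
    proof (cases "u < v")
      case True
      then show ?thesis using uv e by (intro bexI[of _ "(u, v)"]) auto
    next
      case False
      then show ?thesis using uv e by (intro bexI[of _ "(v, u)"]) (auto simp: insert_commute)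
    qed
  qed (auto simp: doubleton_eq_iff)
  then have "card ?A = card (edges H)" by (rule bij_betw_same_card)
  then show ?thesis using fin by (simp add: edge_list_def num_edges_def)
qed

text \<open>By counting: every listed edge is an increasing pair, so the reversed pairs form a
  disjoint set of the same size.\<close>

lemma distinct_darts: "simple_graph H \<Longrightarrow> distinct (darts H)"
proof -
  assume H: "simple_graph H"
  have un: "set (darts H) = set (edge_list H) \<union> (\<lambda>e. (snd e, fst e)) ` set (edge_list H)"
    unfolding darts_def by auto
  have "finite {(u, v). u < v \<and> {u, v} \<in> edges H}"
    by (rule finite_subset[of _ "verts H \<times> verts H"]) (use H in \<open>auto simp: simple_graph_def\<close>)
  then have lt: "fst e < snd e" if "e \<in> set (edge_list H)" for e
    using that by (auto simp: edge_list_def)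
  have "set (edge_list H) \<inter> (\<lambda>e. (snd e, fst e)) ` set (edge_list H) = {}"
  proof (rule equals0I)
    fix x assume "x \<in> set (edge_list H) \<inter> (\<lambda>e. (snd e, fst e)) ` set (edge_list H)"
    then obtain e where "x \<in> set (edge_list H)" "e \<in> set (edge_list H)" "x = (snd e, fst e)" by blast
    with lt[of x] lt[of e] show False by simp
  qed
  moreover have "card ((\<lambda>e. (snd e, fst e)) ` set (edge_list H)) = card (set (edge_list H))"
    by (rule card_image) (auto simp: inj_on_def prod_eq_iff)
  moreover have "distinct (edge_list H)" by (simp add: edge_list_def)
  ultimately have "card (set (darts H)) = 2 * length (edge_list H)"
    unfolding un by (simp add: card_Un_disjoint distinct_card)
  then show ?thesis by (intro card_distinct) (simp add: length_darts)
qed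

text \<open>The tables of the children differ from the bag's own, so updates do not feed back into
  later contributions and the fold is a plain sum in each cell.\<close>

lemma fold_node_update:
  assumes "n_tag nd \<notin> fst ` set (n_kids nd)"
  shows "fold (\<lambda>\<tau>. node_update H nd (env \<tau>)) ts tab =
    tab(n_tag nd := \<lambda>x. tab (n_tag nd) x +
      (\<Sum>\<tau>\<leftarrow>ts. if passes H nd (env \<tau>) \<and> map (env \<tau>) (n_key nd) = x then contribution nd (env \<tau>) tab else 0))"
proof (induction ts arbitrary: tab)
  case (Cons \<tau> ts)
  let ?tab = "node_update H nd (env \<tau>) tab"
  have "map (\<lambda>k. ?tab (fst k) (map \<rho> (snd k))) (n_kids nd) = map (\<lambda>k. tab (fst k) (map \<rho> (snd k))) (n_kids nd)"
    for \<rho>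
    using assms by (intro map_cong refl) (auto simp: node_update_def image_iff)
  then have *: "contribution nd \<rho> ?tab = contribution nd \<rho> tab" for \<rho>
    unfolding contribution_def by (simp only:)
  show ?case unfolding fold.simps comp_def Cons.IH *
    by (auto simp: fun_eq_iff node_update_def algebra_simps)
qed simp

text \<open>\<open>va\<close> and \<open>ea\<close> charge each vertex and edge to one bag, so that every variable of a monomial is
  contributed exactly once.\<close>

locale covered_bags =
  fixes G :: "'a ugraph" and bs :: "'a set list" and par :: "nat \<Rightarrow> nat" and cs :: "nat \<Rightarrow> ('a \<times> 'a) list"
    and va :: "'a \<Rightarrow> nat" and ea :: "'a set \<Rightarrow> nat"
  assumes G: "simple_graph G" and ri: "running_intersection bs par" and ne: "bs \<noteq> []"
    and cover_edges: "\<And>i e. i < length bs \<Longrightarrow> e \<in> set (cs i) \<Longrightarrow> {fst e, snd e} \<in> edges G"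
    and cover: "\<And>i. i < length bs \<Longrightarrow> (\<Union>(a, b)\<in>set (cs i). {a, b}) = bs ! i"
    and va: "\<And>v. v \<in> verts G \<Longrightarrow> va v < length bs \<and> v \<in> bs ! va v"
    and ea: "\<And>e. e \<in> edges G \<Longrightarrow> ea e < length bs \<and> e \<subseteq> bs ! ea e"
begin

text \<open>The order of the separator is fixed once, so that the key under which a bag stores is
  the key by which its parent reads.\<close>

definition sep_list :: "nat \<Rightarrow> 'a list" where
  "sep_list i = list_of (sepset bs par i)"

definition bag_verts :: "nat \<Rightarrow> 'a list" where
  "bag_verts i = list_of {v \<in> verts G. va v = i}"

definition bag_edges :: "nat \<Rightarrow> 'a set list" where
  "bag_edges i = list_of {e \<in> edges G. ea e = i}"

text \<open>Every occurrence is tested against the slot of its vertex, after which the register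
  contents define a map on the bag.\<close>

definition code :: "nat \<Rightarrow> node_code" where
  "code i = \<lparr>n_eqs = map (\<lambda>(v, r). (r, slot (cs i) v)) (occurrences (cs i)),
     n_ys = map (slot (cs i)) (bag_verts i),
     n_xs = map (\<lambda>e. (slot (cs i) (fst (ends e)), slot (cs i) (snd (ends e)))) (bag_edges i),
     n_kids = map (\<lambda>c. (c, map (slot (cs i)) (sep_list c))) (kids par i),
     n_tag = i,
     n_key = map (slot (cs i)) (sep_list i)\<rparr>"

text \<open>The covering edges are included even if charged to another bag, because tuples of host
  edges realise only maps that preserve them. Being edges of \<open>G\<close>, they impose nothing
  new on a homomorphism, and as mere conditions they may recur in several bags.\<close>

definition bag_hom :: "nat ugraph \<Rightarrow> nat \<Rightarrow> ('a \<Rightarrow> nat) \<Rightarrow> bool" where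
  "bag_hom H i \<psi> \<longleftrightarrow> (\<forall>e\<in>set (cs i). {\<psi> (fst e), \<psi> (snd e)} \<in> edges H) \<and>
     (\<forall>e\<in>set (bag_edges i). \<psi> ` e \<in> edges H)"

definition weight :: "nat ugraph \<Rightarrow> nat \<Rightarrow> ('a \<Rightarrow> nat) \<Rightarrow> (nat, 'k::comm_ring_1) hpoly" where
  "weight H i \<psi> = (if bag_hom H i \<psi>
     then (\<Prod>v\<leftarrow>bag_verts i. pvar (Y (\<psi> v))) * (\<Prod>e\<leftarrow>bag_edges i. pvar (X (\<psi> ` e))) else 0)"

lemma finite_edges: "finite (edges G)"
proof (rule finite_subset)
  show "edges G \<subseteq> Pow (verts G)" using G by (auto simp: simple_graph_def)
qed (use G in \<open>simp add: simple_graph_def\<close>)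

lemma bag_subset: "i < length bs \<Longrightarrow> bs ! i \<subseteq> verts G"
proof
  fix v assume i: "i < length bs" and "v \<in> bs ! i"
  then obtain e where "e \<in> set (cs i)" "v \<in> {fst e, snd e}" using cover[OF i] by fastforce
  then show "v \<in> verts G" using cover_edges[OF i] G unfolding simple_graph_def by blast
qed

lemma finite_bag: "i < length bs \<Longrightarrow> finite (bs ! i)"
  using bag_subset G by (auto simp: simple_graph_def intro: finite_subset)

lemma set_sep_list: "i < length bs \<Longrightarrow> set (sep_list i) = sepset bs par i"
  using list_of[of "sepset bs par i"] finite_bag[of i] unfolding sep_list_def sepset_def by auto

lemma bag_verts: "distinct (bag_verts i)" "set (bag_verts i) = {v \<in> verts G. va v = i}"
  using list_of[of "{v \<in> verts G. va v = i}"] G unfolding bag_verts_def by (auto simp: simple_graph_def)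

lemma bag_edges: "distinct (bag_edges i)" "set (bag_edges i) = {e \<in> edges G. ea e = i}"
  using list_of[of "{e \<in> edges G. ea e = i}"] finite_edges unfolding bag_edges_def by auto

lemma ends_edge: "e \<in> set (bag_edges i) \<Longrightarrow> {fst (ends e), snd (ends e)} = e"
  using G by (intro ends) (auto simp: bag_edges simple_graph_def)

lemma in_bag:
  "v \<in> set (bag_verts i) \<Longrightarrow> v \<in> bs ! i"
  "e \<in> set (bag_edges i) \<Longrightarrow> fst (ends e) \<in> bs ! i \<and> snd (ends e) \<in> bs ! i"
  "i < length bs \<Longrightarrow> v \<in> set (sep_list i) \<Longrightarrow> v \<in> bs ! i"
  "i < length bs \<Longrightarrow> c \<in> set (kids par i) \<Longrightarrow> v \<in> set (sep_list c) \<Longrightarrow> v \<in> bs ! i"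
proof -
  show "v \<in> set (bag_verts i) \<Longrightarrow> v \<in> bs ! i" using va by (auto simp: bag_verts)
  show "e \<in> set (bag_edges i) \<Longrightarrow> fst (ends e) \<in> bs ! i \<and> snd (ends e) \<in> bs ! i"
    using ea[of e] ends_edge[of e i] by (auto simp: bag_edges)
  show "i < length bs \<Longrightarrow> v \<in> set (sep_list i) \<Longrightarrow> v \<in> bs ! i"
    by (auto simp: set_sep_list sepset_def split: if_splits)
  show "i < length bs \<Longrightarrow> c \<in> set (kids par i) \<Longrightarrow> v \<in> set (sep_list c) \<Longrightarrow> v \<in> bs ! i"
    using set_sep_list[of c] by (auto simp: sepset_def kids_def split: if_splits)
qed

lemma slot_occ: "i < length bs \<Longrightarrow> v \<in> bs ! i \<Longrightarrow> (v, slot (cs i) v) \<in> set (occurrences (cs i))"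
  using slot_in_occurrences[of v "cs i"] cover[of i] by simp

lemma occurrence_in_bag:
  assumes i: "i < length bs" and v: "(v, r) \<in> set (occurrences (cs i))"
  shows "v \<in> bs ! i"
proof -
  have "fst e \<in> bs ! i" "snd e \<in> bs ! i" if "e \<in> set (cs i)" for e
    using cover[OF i] that by (auto simp: split_beta)
  then have "fst (cs i ! j) \<in> bs ! i" "snd (cs i ! j) \<in> bs ! i" if "j < length (cs i)" for j
    using nth_mem[OF that] by blast+
  then show ?thesis using v unfolding set_occurrences by auto
qed

lemma code_regs:
  assumes i: "i < length bs" and r: "r \<in> node_regs (code i)"
  shows "\<exists>j<length (cs i). r = 21 + 3 * j \<or> r = 22 + 3 * j"
proof -
  define R where "R = slot (cs i) ` (bs ! i) \<union> snd ` set (occurrences (cs i))"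
  have R: "v \<in> bs ! i \<Longrightarrow> slot (cs i) v \<in> R" "(v, x) \<in> set (occurrences (cs i)) \<Longrightarrow> x \<in> R" for v x
    by (force simp: R_def)+
  have R': "(v, x) \<in> set (occurrences (cs i)) \<Longrightarrow> slot (cs i) v \<in> R"
    "e \<in> set (bag_edges i) \<Longrightarrow> slot (cs i) (fst (ends e)) \<in> R"
    "e \<in> set (bag_edges i) \<Longrightarrow> slot (cs i) (snd (ends e)) \<in> R" for v x e
    using R(1) occurrence_in_bag[OF i, of v x] in_bag(2)[of e i] by blast+
  have "node_regs (code i) \<subseteq> R" unfolding node_regs_def code_def
    by (auto intro: R R' in_bag(1) in_bag(3)[OF i] in_bag(4)[OF i])
  then have "r \<in> R" using r by blast
  then have "(\<exists>v. (v, r) \<in> set (occurrences (cs i))) \<or> (\<exists>v. v \<in> bs ! i \<and> r = slot (cs i) v)"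
    unfolding R_def by force
  then obtain v where "(v, r) \<in> set (occurrences (cs i))" using slot_occ[OF i] by blast
  then show ?thesis unfolding set_occurrences by blast
qed

definition tuple :: "nat \<Rightarrow> ('a \<Rightarrow> nat) \<Rightarrow> (nat \<times> nat) list" where
  "tuple i \<psi> = map (\<lambda>e. (\<psi> (fst e), \<psi> (snd e))) (cs i)"

lemma env_tuple: "(v, r) \<in> set (occurrences (cs i)) \<Longrightarrow> env (tuple i \<psi>) r = \<psi> v"
  unfolding set_occurrences tuple_def by auto

lemma tuple_env:
  assumes "length \<tau> = length (cs i)" "\<And>v r. (v, r) \<in> set (occurrences (cs i)) \<Longrightarrow> env \<tau> r = \<psi> v"
  shows "tuple i \<psi> = \<tau>"
proof (rule nth_equalityI)
  fix j assume "j < length (tuple i \<psi>)"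
  then have j: "j < length (cs i)" by (simp add: tuple_def)
  have "(fst (cs i ! j), 21 + 3 * j) \<in> set (occurrences (cs i))"
    "(snd (cs i ! j), 22 + 3 * j) \<in> set (occurrences (cs i))"
    using j unfolding set_occurrences by auto
  from this[THEN assms(2)] show "tuple i \<psi> ! j = \<tau> ! j"
    using j by (simp add: tuple_def prod_eq_iff)
qed (use assms(1) in \<open>simp add: tuple_def\<close>)

lemma code_env:
  assumes i: "i < length bs" and \<psi>: "\<And>v. v \<in> bs ! i \<Longrightarrow> \<rho> (slot (cs i) v) = \<psi> v"
  shows "map \<rho> (n_key (code i)) = map \<psi> (sep_list i)"
    and "(\<forall>e\<in>set (n_xs (code i)). {\<rho> (fst e), \<rho> (snd e)} \<in> edges H) \<longleftrightarrow> (\<forall>e\<in>set (bag_edges i). \<psi> ` e \<in> edges H)"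
    and "contribution (code i) \<rho> tab = (\<Prod>v\<leftarrow>bag_verts i. pvar (Y (\<psi> v))) *
      (\<Prod>e\<leftarrow>bag_edges i. pvar (X (\<psi> ` e))) * (\<Prod>c\<leftarrow>kids par i. tab c (map \<psi> (sep_list c)))"
proof -
  have e: "{\<rho> (slot (cs i) (fst (ends e))), \<rho> (slot (cs i) (snd (ends e)))} = \<psi> ` e"
    if "e \<in> set (bag_edges i)" for e
  proof -
    have "\<psi> ` {fst (ends e), snd (ends e)} = {\<psi> (fst (ends e)), \<psi> (snd (ends e))}" by simp
    then show ?thesis using in_bag(2)[OF that] \<psi> unfolding ends_edge[OF that] by simp
  qed
  show "map \<rho> (n_key (code i)) = map \<psi> (sep_list i)"
    using in_bag(3)[OF i] \<psi> by (simp add: code_def)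
  show "(\<forall>e\<in>set (n_xs (code i)). {\<rho> (fst e), \<rho> (snd e)} \<in> edges H) \<longleftrightarrow> (\<forall>e\<in>set (bag_edges i). \<psi> ` e \<in> edges H)"
    using e by (simp add: code_def)
  show "contribution (code i) \<rho> tab = (\<Prod>v\<leftarrow>bag_verts i. pvar (Y (\<psi> v))) *
      (\<Prod>e\<leftarrow>bag_edges i. pvar (X (\<psi> ` e))) * (\<Prod>c\<leftarrow>kids par i. tab c (map \<psi> (sep_list c)))"
    unfolding contribution_def code_def node_code.simps map_map comp_def fst_conv snd_conv
  proof (intro arg_cong2[where f = "(*)"] arg_cong[where f = prod_list] map_cong refl)
    fix c assume "c \<in> set (kids par i)"
    then have "map (\<lambda>x. \<rho> (slot (cs i) x)) (sep_list c) = map \<psi> (sep_list c)"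
      by (intro map_cong refl \<psi> in_bag(4)[OF i])
    then show "tab c (map (\<lambda>x. \<rho> (slot (cs i) x)) (sep_list c)) = tab c (map \<psi> (sep_list c))"
      by (rule arg_cong)
  qed (simp_all add: e \<psi> in_bag(1))
qed

text \<open>The tuples that pass the tests correspond bijectively to the maps satisfying
  \<open>bag_hom\<close>: reading the slots gives the map, and applying the map to the cover gives
  the tuple back, because the equality tests leave no freedom at repeated occurrences. The
  comparison of keys is agreement with \<open>\<phi>\<close> on the separator.\<close>

lemma node_sum_eq_msg:
  fixes tab :: "nat \<Rightarrow> nat list \<Rightarrow> (nat, 'k::comm_ring_1) hpoly"
  assumes H: "simple_graph H" and i: "i < length bs"
    and tab: "\<And>c \<phi>. c \<in> set (kids par i) \<Longrightarrow> tab c (map \<phi> (sep_list c)) = msg bs par (verts H) (weight H) c \<phi>"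
  shows "(\<Sum>\<tau>\<leftarrow>tuples (darts H) (length (cs i)) [].
      if passes H (code i) (env \<tau>) \<and> map (env \<tau>) (n_key (code i)) = map \<phi> (sep_list i)
      then contribution (code i) (env \<tau>) tab else 0) = msg bs par (verts H) (weight H) i \<phi>"
proof -
  let ?slot = "slot (cs i)"
  let ?P = "\<lambda>\<tau>. passes H (code i) (env \<tau>) \<and> map (env \<tau>) (n_key (code i)) = map \<phi> (sep_list i)"
  let ?T0 = "{\<tau>. length \<tau> = length (cs i) \<and> set \<tau> \<subseteq> set (darts H)}"
  let ?A0 = "{\<psi> \<in> bs ! i \<rightarrow>\<^sub>E verts H. \<forall>v\<in>sepset bs par i. \<psi> v = \<phi> v}"
  let ?h = "\<lambda>\<psi>. weight H i \<psi> * (\<Prod>c\<leftarrow>kids par i. msg bs par (verts H) (weight H) c \<psi>) :: (nat, 'k) hpoly"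
  have finH: "finite (verts H)" using H by (simp add: simple_graph_def)
  have T0: "set (tuples (darts H) (length (cs i)) []) = ?T0" by (auto simp: set_tuples)
  then have finT: "finite ?T0" by (metis List.finite_set)
  have dart: "(u, v) \<in> set (darts H) \<longleftrightarrow> {u, v} \<in> edges H" for u v by (simp add: set_darts[OF H])
  have dart_verts: "u \<in> verts H" "v \<in> verts H" if "(u, v) \<in> set (darts H)" for u v
    using H that by (auto simp: set_darts simple_graph_def)
  have passes: "passes H (code i) \<rho> \<longleftrightarrow> (\<forall>(v, r)\<in>set (occurrences (cs i)). \<rho> r = \<rho> (?slot v)) \<and>
      (\<forall>e\<in>set (n_xs (code i)). {\<rho> (fst e), \<rho> (snd e)} \<in> edges H)" for \<rho>
    unfolding passes_def by (auto simp: code_def)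
  have "(\<Sum>\<tau>\<leftarrow>tuples (darts H) (length (cs i)) []. if ?P \<tau> then contribution (code i) (env \<tau>) tab else 0) =
    (\<Sum>\<tau>\<in>?T0. if ?P \<tau> then contribution (code i) (env \<tau>) tab else 0)"
    unfolding T0[symmetric] by (rule sum_list_distinct_conv_sum_set[OF distinct_tuples[OF distinct_darts[OF H]]])
  also have "\<dots> = (\<Sum>\<tau>\<in>{\<tau> \<in> ?T0. ?P \<tau>}. contribution (code i) (env \<tau>) tab)"
    by (rule sum.inter_filter[OF finT, symmetric])
  also have "\<dots> = (\<Sum>\<psi>\<in>{\<psi> \<in> ?A0. bag_hom H i \<psi>}. ?h \<psi>)"
  proof (rule sum.reindex_bij_witness[where i = "tuple i" and j = "\<lambda>\<tau>. restrict (\<lambda>v. env \<tau> (?slot v)) (bs ! i)"])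
    fix \<tau> assume "\<tau> \<in> {\<tau> \<in> ?T0. ?P \<tau>}"
    then have \<tau>: "length \<tau> = length (cs i)" "set \<tau> \<subseteq> set (darts H)" "passes H (code i) (env \<tau>)"
      "map (env \<tau>) (n_key (code i)) = map \<phi> (sep_list i)" by auto
    let ?\<psi> = "restrict (\<lambda>v. env \<tau> (?slot v)) (bs ! i)"
    have occ: "env \<tau> r = ?\<psi> v" if "(v, r) \<in> set (occurrences (cs i))" for v r
      using \<tau>(3) that occurrence_in_bag[OF i that] unfolding passes by auto
    have \<psi>: "env \<tau> (?slot v) = ?\<psi> v" if "v \<in> bs ! i" for v using that by simp
    note code_env = code_env[where \<rho> = "env \<tau>" and \<psi> = ?\<psi>, OF i \<psi>]
    show t: "tuple i ?\<psi> = \<tau>" by (rule tuple_env[OF \<tau>(1) occ])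
    have "env \<tau> r \<in> verts H" if vr: "(v, r) \<in> set (occurrences (cs i))" for v r
    proof -
      obtain j where j: "j < length \<tau>" "r = 21 + 3 * j \<or> r = 22 + 3 * j"
        using vr \<tau>(1) unfolding set_occurrences by auto
      have "(fst (\<tau> ! j), snd (\<tau> ! j)) \<in> set (darts H)" using j(1) \<tau>(2) by auto
      from dart_verts[OF this] show ?thesis using j(2) by auto
    qed
    then have "?\<psi> \<in> bs ! i \<rightarrow>\<^sub>E verts H" using slot_occ[OF i] by auto
    moreover have "map ?\<psi> (sep_list i) = map \<phi> (sep_list i)"
      using code_env(1) \<tau>(4) by simp
    then have "\<forall>v\<in>sepset bs par i. ?\<psi> v = \<phi> v" unfolding map_eq_conv set_sep_list[OF i] .
    moreover have hom: "bag_hom H i ?\<psi>" unfolding bag_hom_def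
    proof
      show "\<forall>e\<in>set (bag_edges i). ?\<psi> ` e \<in> edges H"
        using \<tau>(3) code_env(2) unfolding passes by blast
      have "(?\<psi> (fst e), ?\<psi> (snd e)) \<in> set (tuple i ?\<psi>)" if "e \<in> set (cs i)" for e
        using that unfolding tuple_def set_map by (rule imageI)
      then have "(?\<psi> (fst e), ?\<psi> (snd e)) \<in> set \<tau>" if "e \<in> set (cs i)" for e
        using that unfolding t by blast
      then show "\<forall>e\<in>set (cs i). {?\<psi> (fst e), ?\<psi> (snd e)} \<in> edges H" using \<tau>(2) dart by blast
    qed
    ultimately show "?\<psi> \<in> {\<psi> \<in> ?A0. bag_hom H i \<psi>}" by blast
    have k: "(\<Prod>c\<leftarrow>kids par i. tab c (map ?\<psi> (sep_list c))) =
      (\<Prod>c\<leftarrow>kids par i. msg bs par (verts H) (weight H) c ?\<psi>)"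
      by (intro arg_cong[where f = prod_list] map_cong refl tab)
    have w: "weight H i ?\<psi> = (\<Prod>v\<leftarrow>bag_verts i. pvar (Y (?\<psi> v))) *
        (\<Prod>e\<leftarrow>bag_edges i. pvar (X (?\<psi> ` e)) :: (nat, 'k) hpoly)"
      unfolding weight_def by (rule if_P[OF hom])
    show "?h ?\<psi> = contribution (code i) (env \<tau>) tab"
      unfolding w k[symmetric] by (rule code_env(3)[symmetric])
  next
    fix \<psi> assume "\<psi> \<in> {\<psi> \<in> ?A0. bag_hom H i \<psi>}"
    then have A: "\<psi> \<in> bs ! i \<rightarrow>\<^sub>E verts H" "\<forall>v\<in>sepset bs par i. \<psi> v = \<phi> v" "bag_hom H i \<psi>" by auto
    have \<psi>: "env (tuple i \<psi>) (?slot v) = \<psi> v" if "v \<in> bs ! i" for v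
      using env_tuple slot_occ[OF i that] by blast
    note code_env = code_env[where \<rho> = "env (tuple i \<psi>)" and \<psi> = \<psi>, OF i \<psi>]
    show "restrict (\<lambda>v. env (tuple i \<psi>) (?slot v)) (bs ! i) = \<psi>"
      using A(1) \<psi> by (auto simp: fun_eq_iff PiE_def extensional_def)
    have "set (tuple i \<psi>) \<subseteq> set (darts H)"
      using A(3) dart unfolding tuple_def bag_hom_def by auto
    moreover have "env (tuple i \<psi>) r = env (tuple i \<psi>) (?slot v)" if "(v, r) \<in> set (occurrences (cs i))" for v r
      using env_tuple[OF that] \<psi> occurrence_in_bag[OF i that] by simp
    then have "passes H (code i) (env (tuple i \<psi>))"
      using A(3) code_env(2) unfolding passes bag_hom_def by blast
    moreover have "map (env (tuple i \<psi>)) (n_key (code i)) = map \<phi> (sep_list i)"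
      using code_env(1) A(2) set_sep_list[OF i] by simp
    ultimately show "tuple i \<psi> \<in> {\<tau> \<in> ?T0. ?P \<tau>}" by (simp add: tuple_def)
  qed
  also have "\<dots> = (\<Sum>\<psi>\<in>?A0. ?h \<psi>)"
    by (rule sum.mono_neutral_left) (auto simp: weight_def finite_PiE finite_bag[OF i] finH)
  also have "\<dots> = msg bs par (verts H) (weight H) i \<phi>" by (simp add: msg.simps[of bs par "verts H" "weight H" i])
  finally show ?thesis .
qed

definition codes :: "(nat \<times> node_code) list" where
  "codes = map (\<lambda>i. (length (cs i), code i)) [0..<length bs]"

definition tables :: "nat ugraph \<Rightarrow> nat \<Rightarrow> nat \<Rightarrow> nat list \<Rightarrow> (nat, 'k::comm_ring_1) hpoly" where
  "tables H k = fold (\<lambda>kn. fold (\<lambda>\<tau>. node_update H (snd kn) (env \<tau>)) (tuples (darts H) (fst kn) []))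
     (take k codes) (\<lambda>_ _. 0)"

text \<open>The second part, that later tables are still zero, makes the accumulation in table
  \<open>k\<close> start from 0; the tables of the children are complete by then.\<close>

lemma tables_eq_msg:
  assumes H: "simple_graph H" and k: "k \<le> length bs"
  shows "(\<forall>c<k. \<forall>\<phi>. tables H k c (map \<phi> (sep_list c)) =
      (msg bs par (verts H) (weight H) c \<phi> :: (nat, 'k::comm_ring_1) hpoly)) \<and>
    (\<forall>c\<ge>k. tables H k c = (\<lambda>_. 0 :: (nat, 'k) hpoly))"
  using k
proof (induction k)
  case 0
  then show ?case by (simp add: tables_def)
next
  case (Suc k)
  let ?tab = "tables H k :: nat \<Rightarrow> nat list \<Rightarrow> (nat, 'k) hpoly"
  let ?new = "\<lambda>x. \<Sum>\<tau>\<leftarrow>tuples (darts H) (length (cs k)) [].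
    if passes H (code k) (env \<tau>) \<and> map (env \<tau>) (n_key (code k)) = x then contribution (code k) (env \<tau>) ?tab else 0"
  have k: "k < length bs" using Suc.prems by simp
  then have "take (Suc k) codes = take k codes @ [(length (cs k), code k)]"
    by (simp add: codes_def take_Suc_conv_app_nth)
  moreover have "n_tag (code k) = k" "fst ` set (n_kids (code k)) = set (kids par k)"
    by (simp_all add: code_def image_image)
  moreover have "k \<notin> set (kids par k)" by (simp add: kids_def)
  ultimately have "tables H (Suc k) = ?tab(k := \<lambda>x. ?tab k x + ?new x)"
    using fold_node_update[of "code k" H "tuples (darts H) (length (cs k)) []" ?tab]
    by (simp add: tables_def[of H "Suc k"] flip: tables_def[of H k])
  moreover have "?tab k = (\<lambda>_. 0)" using Suc by simp
  ultimately have step: "tables H (Suc k) = ?tab(k := ?new)" by simp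
  have "?new (map \<phi> (sep_list k)) = msg bs par (verts H) (weight H) k \<phi>" for \<phi>
    by (rule node_sum_eq_msg[OF H k]) (use Suc in \<open>auto simp: kids_def\<close>)
  then show ?case unfolding step using Suc by (auto simp: less_Suc_eq)
qed

lemma Union_bags: "(\<Union>i<length bs. bs ! i) = verts G"
  using bag_subset va by blast

text \<open>For a homomorphism the local monomials multiply to the full one, as \<open>va\<close>
  and \<open>ea\<close> partition the vertices and edges among the bags. For any other map a
  violated edge makes the weight of the bag it is charged to vanish.\<close>

lemma prod_weight:
  assumes "\<phi> \<in> verts G \<rightarrow>\<^sub>E verts H"
  shows "(\<Prod>i<length bs. weight H i \<phi>) = (if \<phi> \<in> homs G H
    then (\<Prod>u\<in>verts G. pvar (Y (\<phi> u))) * (\<Prod>e\<in>edges G. pvar (X (\<phi> ` e))) else (0 :: (nat, 'k::comm_ring_1) hpoly))"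
proof (cases "\<phi> \<in> homs G H")
  case True
  then have e: "\<phi> ` e \<in> edges H" if "e \<in> edges G" for e using that by (simp add: homs_def)
  have "bag_hom H i \<phi>" if "i < length bs" for i
    using e[OF cover_edges[OF that]] e unfolding bag_hom_def by (auto simp: bag_edges)
  then have "(\<Prod>i<length bs. weight H i \<phi>) = (\<Prod>i<length bs.
      (\<Prod>v\<in>{v \<in> verts G. va v = i}. pvar (Y (\<phi> v))) * (\<Prod>e\<in>{e \<in> edges G. ea e = i}. pvar (X (\<phi> ` e)) :: (nat, 'k) hpoly))"
    unfolding bag_verts(2)[symmetric] bag_edges(2)[symmetric]
    by (intro prod.cong refl)
       (simp add: weight_def prod.distinct_set_conv_list[OF bag_verts(1)] prod.distinct_set_conv_list[OF bag_edges(1)])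
  also have "\<dots> = (\<Prod>u\<in>verts G. pvar (Y (\<phi> u))) * (\<Prod>e\<in>edges G. pvar (X (\<phi> ` e)))"
    unfolding prod.distrib using va ea G finite_edges
    by (intro arg_cong2[where f = "(*)"] prod.group) (auto simp: simple_graph_def)
  finally show ?thesis using True by simp
next
  case False
  then obtain e where e: "e \<in> edges G" "\<phi> ` e \<notin> edges H" using assms by (auto simp: homs_def)
  then have "\<not> bag_hom H (ea e) \<phi>" unfolding bag_hom_def by (auto simp: bag_edges)
  then have "weight H (ea e) \<phi> = (0 :: (nat, 'k) hpoly)" by (simp add: weight_def)
  then have "(\<Prod>i<length bs. weight H i \<phi>) = (0 :: (nat, 'k) hpoly)"
    using ea[OF e(1)] by (intro prod_zero) auto
  then show ?thesis using False by simp
qed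

lemma weight_cong:
  assumes i: "i < length bs" and \<phi>: "\<And>v. v \<in> bs ! i \<Longrightarrow> \<phi> v = \<phi>' v"
  shows "weight H i \<phi> = (weight H i \<phi>' :: (nat, 'k::comm_ring_1) hpoly)"
proof -
  have e: "\<phi> ` e = \<phi>' ` e" if "e \<in> set (bag_edges i)" for e
    using that ea[of e] \<phi> by (intro image_cong refl) (auto simp: bag_edges)
  have "fst e \<in> bs ! i" "snd e \<in> bs ! i" if "e \<in> set (cs i)" for e
    using cover[OF i] that by (auto simp: split_beta)
  then have "bag_hom H i \<phi> = bag_hom H i \<phi>'" unfolding bag_hom_def using e \<phi> by simp
  moreover have "map (\<lambda>v. pvar (Y (\<phi> v)) :: (nat, 'k) hpoly) (bag_verts i) = map (\<lambda>v. pvar (Y (\<phi>' v))) (bag_verts i)"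
    by (intro map_cong refl) (simp add: \<phi> in_bag(1))
  moreover have "map (\<lambda>e. pvar (X (\<phi> ` e)) :: (nat, 'k) hpoly) (bag_edges i) = map (\<lambda>e. pvar (X (\<phi>' ` e))) (bag_edges i)"
    by (intro map_cong refl) (simp add: e)
  ultimately show ?thesis unfolding weight_def by (simp only:)
qed

lemma tables_root:
  assumes H: "simple_graph H"
  shows "tables H (length bs) (length bs - 1) [] = (hom_poly G H :: (nat, 'k::comm_ring_1) hpoly)"
proof -
  let ?r = "length bs - 1"
  have r: "?r < length bs" using ne by simp
  have "set (sep_list ?r) = {}" using set_sep_list[OF r] ne by (simp add: sepset_def)
  then have s: "sep_list ?r = []" by simp
  have fin: "finite (verts H)" "finite (verts G)" using H G by (auto simp: simple_graph_def)
  have "tables H (length bs) ?r [] = (msg bs par (verts H) (weight H) ?r undefined :: (nat, 'k) hpoly)"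
    using tables_eq_msg[OF H order_refl] r s by (metis list.map(1))
  also have "\<dots> = (\<Sum>\<phi>\<in>(\<Union>i<length bs. bs ! i) \<rightarrow>\<^sub>E verts H. \<Prod>i<length bs. weight H i \<phi>)"
  proof (rule msg_root[symmetric])
    show "weight H i \<phi> = (weight H i \<phi>' :: (nat, 'k) hpoly)"
      if "i < length bs" "\<And>v. v \<in> bs ! i \<Longrightarrow> \<phi> v = \<phi>' v" for i \<phi> \<phi>'
      using that by (rule weight_cong)
  qed (use ri fin finite_bag ne in auto)
  also have "\<dots> = (\<Sum>\<phi>\<in>verts G \<rightarrow>\<^sub>E verts H. if \<phi> \<in> homs G H
      then (\<Prod>u\<in>verts G. pvar (Y (\<phi> u))) * (\<Prod>e\<in>edges G. pvar (X (\<phi> ` e))) else 0)"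
    unfolding Union_bags by (intro sum.cong refl prod_weight)
  also have "\<dots> = (\<Sum>\<phi>\<in>{\<phi> \<in> verts G \<rightarrow>\<^sub>E verts H. \<phi> \<in> homs G H}.
      (\<Prod>u\<in>verts G. pvar (Y (\<phi> u))) * (\<Prod>e\<in>edges G. pvar (X (\<phi> ` e))))"
    by (rule sum.inter_filter[symmetric]) (simp add: finite_PiE fin)
  also have "{\<phi> \<in> verts G \<rightarrow>\<^sub>E verts H. \<phi> \<in> homs G H} = homs G H" by (auto simp: homs_def)
  finally show ?thesis by (simp add: hom_poly_def)
qed

text \<open>One digit must hold a vertex number, which is below \<open>card (verts H)\<close> for
  the hosts considered, or a shifted tag, which is at most \<open>length bs + 1\<close>.\<close>

definition address_bits :: "nat ugraph \<Rightarrow> nat" where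
  "address_bits H = (LEAST l. card (verts H) + length bs + 3 \<le> 2 ^ l)"

lemma address_bits:
  "card (verts H) + length bs + 3 \<le> 2 ^ address_bits H"
  "l < address_bits H \<Longrightarrow> 2 ^ l < card (verts H) + length bs + 3"
proof -
  let ?x = "card (verts H) + length bs + 3"
  have "?x \<le> 2 ^ ?x" by (rule less_imp_le[OF less_exp])
  then show "?x \<le> 2 ^ address_bits H" unfolding address_bits_def by (rule LeastI)
  show "l < address_bits H \<Longrightarrow> 2 ^ l < ?x"
    unfolding address_bits_def by (drule not_less_Least) simp
qed

lemma wp_codes:
  assumes H: "H \<in> hosts" and K: "K > 0" "\<And>i. i < length bs \<Longrightarrow> length (cs i) \<le> K"
  shows "wp H q (hom_prog (length bs) codes)
    ((2 * max 1 (num_edges H)) ^ K * ((\<Sum>kn\<leftarrow>codes. node_cost (snd kn) + 8 * fst kn) + 44) *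
      ((q + 1) * (address_bits H + 1)))
    (\<lambda>s. circuit_computes (host_vars H) (circ s) (hom_poly G H :: (nat, 'k::comm_ring_1) hpoly)) (init_state H)"
proof -
  have sH: "simple_graph H" using H by (simp add: hosts_def)
  interpret table_machine H q "address_bits H" "length bs" "darts H" "\<lambda>i. length (sep_list i)"
    by unfold_locales (use address_bits(1)[of H] in linarith)
  have verts: "set (darts H) \<subseteq> verts H \<times> verts H"
    using sH by (auto simp: set_darts simple_graph_def)
  have small: "verts H \<subseteq> {..<2 ^ address_bits H}"
  proof -
    obtain n where "verts H = {..<n}" using H by (auto simp: hosts_def)
    then show ?thesis using address_bits(1)[of H] by auto
  qed
  have tab: "tables H (length bs) = fold (\<lambda>kn. fold (\<lambda>\<tau>. node_update H (snd kn) (env \<tau>))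
      (tuples (darts H) (fst kn) [])) codes (\<lambda>_ _. 0 :: (nat, 'k) hpoly)"
    by (simp add: tables_def codes_def)
  have nodes: "valid_node (snd kn) \<and> fst kn \<le> K \<and>
      (\<forall>r\<in>node_regs (snd kn). \<exists>j<fst kn. r = 21 + 3 * j \<or> r = 22 + 3 * j)" if kn: "kn \<in> set codes" for kn
  proof -
    obtain i where i: "i < length bs" "kn = (length (cs i), code i)" using kn by (auto simp: codes_def)
    have "20 \<le> r" if "r \<in> node_regs (code i)" for r using code_regs[OF i(1) that] by auto
    then have "valid_node (code i)" unfolding valid_node_def using i(1) by (auto simp: code_def kids_def)
    then show ?thesis using i K(2)[OF i(1)] code_regs[OF i(1)] by auto
  qed
  have root: "length (sep_list (length bs - 1)) = 0"
    using set_sep_list[of "length bs - 1"] ne by (simp add: sepset_def)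
  have "wp H q (hom_prog (length bs) codes)
    ((2 * max 1 (length (edge_list H))) ^ K * ((\<Sum>kn\<leftarrow>codes. node_cost (snd kn) + 8 * fst kn) + 44) * W)
    (\<lambda>s. circuit_computes (host_vars H) (circ s) (tables H (length bs) (length bs - 1) [] :: (nat, 'k) hpoly))
    (init_state H)"
    by (rule wp_hom_prog[OF refl verts small address_bits nodes tab _ root K(1)]) (use ne in auto)
  then show ?thesis unfolding tables_root[OF sH] length_edge_list[OF sH] W_def .
qed

text \<open>By minimality \<open>2 ^ (address_bits H - 1)\<close> is below n + N + 3, which is at
  most (n + 2) * (N + 3), for n host vertices and N bags. The logarithm splits the product, and N
  does not depend on the host.\<close>

lemma address_bits_bound:
  "real (address_bits H + 1) \<le> (3 + log 2 (real (length bs) + 3)) * log 2 (real (input_size H) + 2)"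
proof -
  let ?n = "real (card (verts H))" and ?N = "real (length bs)"
  let ?l = "log 2 (real (input_size H) + 2)"
  have l: "1 \<le> ?l" by (subst le_log_iff) auto
  have "address_bits H \<noteq> 0" using address_bits(1)[of H] by (intro notI) simp
  then have "2 ^ (address_bits H - 1) < card (verts H) + length bs + 3" by (intro address_bits(2)) simp
  then have "real (2 ^ (address_bits H - 1)) \<le> ?n + ?N + 3" by linarith
  also have "\<dots> \<le> (?n + 2) * (?N + 3)" by (simp add: algebra_simps)
  also have "\<dots> \<le> (real (input_size H) + 2) * (?N + 3)"
    by (intro mult_right_mono) (auto simp: input_size_def)
  finally have "log 2 (real (2 ^ (address_bits H - 1))) \<le> log 2 ((real (input_size H) + 2) * (?N + 3))"
    by (subst log_le_cancel_iff) auto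
  then have "real (address_bits H - 1) \<le> ?l + log 2 (?N + 3)"
    by (simp add: log_nat_power log_mult)
  then have "real (address_bits H + 1) \<le> ?l + log 2 (?N + 3) + 2" using \<open>address_bits H \<noteq> 0\<close> by linarith
  also have "\<dots> \<le> ?l + log 2 (?N + 3) * ?l + 2 * ?l"
  proof -
    have "log 2 (?N + 3) * 1 \<le> log 2 (?N + 3) * ?l" using l by (intro mult_left_mono) auto
    then show ?thesis using l by linarith
  qed
  finally show ?thesis by (simp add: algebra_simps)
qed

lemma hom_poly_constructible:
  assumes K: "K > 0" "\<And>i. i < length bs \<Longrightarrow> length (cs i) \<le> K"
  shows "circuit_constructible (\<lambda>H. hom_poly G H :: (nat, 'k::comm_ring_1) hpoly)
    (\<lambda>H. real (max 1 (num_edges H)) ^ K)"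
  unfolding circuit_constructible_def
proof (intro exI[of _ "hom_prog (length bs) codes"] allI impI)
  fix q :: "nat ugraph \<Rightarrow> nat" assume "soft_O hosts input_size (\<lambda>_. 1) q"
  then obtain C d where q: "\<And>H. H \<in> hosts \<Longrightarrow> real (q H) \<le> C * log 2 (real (input_size H) + 2) ^ d"
    unfolding soft_O_def by auto
  define A where "A = (\<Sum>kn\<leftarrow>codes. node_cost (snd kn) + 8 * fst kn) + 44"
  let ?R = "\<lambda>H c. \<exists>s. exec H (q H) (hom_prog (length bs) codes) (init_state H) c s \<and>
    circuit_computes (host_vars H) (circ s) (hom_poly G H :: (nat, 'k) hpoly)"
  define bnd where "bnd H = (2 * max 1 (num_edges H)) ^ K * A * ((q H + 1) * (address_bits H + 1))" for H
  have "\<exists>c. c \<le> bnd H \<and> ?R H c" if "H \<in> hosts" for H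
    using wp_codes[OF that K, of "q H", where ?'k = 'k] unfolding wp_def bnd_def A_def by blast
  then obtain T where T: "\<And>H. H \<in> hosts \<Longrightarrow> T H \<le> bnd H \<and> ?R H (T H)" by metis
  have "soft_O hosts input_size (\<lambda>H. real (max 1 (num_edges H)) ^ K) T"
    unfolding soft_O_def
  proof (intro exI ballI)
    fix H assume H: "H \<in> hosts"
    let ?l = "log 2 (real (input_size H) + 2)" and ?M = "real (max 1 (num_edges H)) ^ K"
    let ?B = "3 + log 2 (real (length bs) + 3)"
    have l: "1 \<le> ?l" by (subst le_log_iff) auto
    have "1 \<le> ?l ^ d" by (rule one_le_power[OF l])
    then have "real (q H + 1) \<le> C * ?l ^ d + ?l ^ d" using q[OF H] by linarith
    then have q1: "real (q H + 1) \<le> (C + 1) * ?l ^ d" by (simp add: algebra_simps)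
    have "real (T H) \<le> real (bnd H)" using T[OF H] by simp
    also have "\<dots> = (2 ^ K * ?M * real A) * (real (q H + 1) * real (address_bits H + 1))"
      by (simp only: bnd_def power_mult_distrib of_nat_mult of_nat_power of_nat_numeral)
    also have "\<dots> \<le> (2 ^ K * ?M * real A) * (((C + 1) * ?l ^ d) * (?B * ?l))"
    proof (intro mult_left_mono mult_mono q1 address_bits_bound)
      show "0 \<le> (C + 1) * ?l ^ d" using q1 by (rule order_trans[rotated]) simp
    qed simp_all
    \<comment> \<open>The address length adds one logarithm to the \<open>d\<close> of the access
      cost.\<close>
    also have "\<dots> = (2 ^ K * real A * (C + 1) * ?B) * ?M * ?l ^ Suc d" by (simp add: algebra_simps)
    finally show "real (T H) \<le> (2 ^ K * real A * (C + 1) * ?B) * ?M * ?l ^ Suc d" .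
  qed
  then show "\<exists>T. soft_O hosts input_size (\<lambda>H. real (max 1 (num_edges H)) ^ K) T \<and>
    (\<forall>H\<in>hosts. ?R H (T H))" using T by blast
qed
end

text \<open>The integers are not well-ordered, so the set is shifted by its lower bound to the
  naturals. It is applied to widths, which are at least -1.\<close>

lemma Least_int_in:
  fixes S :: "int set"
  assumes "S \<noteq> {}" "\<And>x. x \<in> S \<Longrightarrow> b \<le> x"
  shows "(LEAST x. x \<in> S) \<in> S"
proof -
  define n where "n = (LEAST n::nat. b + int n \<in> S)"
  obtain x where x: "x \<in> S" using assms(1) by blast
  then have "b + int (nat (x - b)) \<in> S" using assms(2)[OF x] by simp
  then have n: "b + int n \<in> S" unfolding n_def by (rule LeastI)
  have "(LEAST x. x \<in> S) = b + int n"
  proof (rule Least_equality)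
    show "b + int n \<in> S" by (fact n)
    fix y assume y: "y \<in> S"
    then have "b + int (nat (y - b)) \<in> S" using assms(2)[OF y] by simp
    then have "n \<le> nat (y - b)" unfolding n_def by (rule Least_le)
    then show "b + int n \<le> y" using assms(2)[OF y] by linarith
  qed
  then show ?thesis using n by simp
qed

lemma hom_poly_no_vertices:
  assumes "simple_graph G" "verts G = {}"
  shows "hom_poly G H = 1"
proof -
  have "edges G = {}" using assms by (fastforce simp: simple_graph_def)
  then show ?thesis using assms by (simp add: hom_poly_def homs_def)
qed

text \<open>The bound leaves no time to read the edges, but the only homomorphism is the empty map
  and a single constant gate suffices.\<close>

lemma hom_poly_no_vertices_constructible:
  assumes "simple_graph G" "verts G = {}"
  shows "circuit_constructible (\<lambda>H. hom_poly G H :: (nat, 'k::comm_ring_1) hpoly) (\<lambda>H. 1)"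
  unfolding circuit_constructible_def
proof (intro exI[of _ "Seq (Instr (Set_Const 1 1)) (Instr (Emit_Const 1))"] allI impI exI[of _ "\<lambda>_. 2"] conjI ballI)
  show "soft_O hosts input_size (\<lambda>H. 1) (\<lambda>_. 2)"
    unfolding soft_O_def by (intro exI[of _ 2] exI[of _ 0]) simp
  fix q H
  let ?s = "step H (Emit_Const 1) (step H (Set_Const 1 1) (init_state H :: 'k state))"
  have "exec H (q H) (Seq (Instr (Set_Const 1 1)) (Instr (Emit_Const 1))) (init_state H)
      (instr_cost (q H) (Set_Const 1 1) + instr_cost (q H) (Emit_Const 1)) ?s"
    by (rule exec.Seq[OF exec.Instr exec.Instr])
  then have "exec H (q H) (Seq (Instr (Set_Const 1 1)) (Instr (Emit_Const 1))) (init_state H) 2 ?s"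
    by (simp add: numeral_2_eq_2)
  moreover have "circuit_computes (host_vars H) (circ ?s) (hom_poly G H)"
    unfolding hom_poly_no_vertices[OF assms] circuit_computes_def wf_circuit_def
    by (simp add: emit_def init_state_def gate_values_def pconst_def)
  ultimately show "\<exists>s. exec H (q H) (Seq (Instr (Set_Const 1 1)) (Instr (Emit_Const 1))) (init_state H) 2 s \<and>
    circuit_computes (host_vars H) (circ s) (hom_poly G H :: (nat, 'k) hpoly)" by blast
qed

theorem theorem6:
  fixes G :: "'a ugraph" and t :: int
  assumes "simple_graph G" and "mtw G = Some t"
  shows "circuit_constructible
           (\<lambda>H. hom_poly G H :: (nat, 'k::comm_ring_1) hpoly)
           (\<lambda>H. real (max 1 (num_edges H)) ^ nat \<lceil>real_of_int (t + 1) / 2\<rceil>)"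
proof -
  let ?K = "nat \<lceil>real_of_int (t + 1) / 2\<rceil>"
  have "t \<in> matched_widths G"
  proof -
    have "matched_widths G \<noteq> {}" "t = (LEAST w. w \<in> matched_widths G)"
      using assms(2) by (auto simp: mtw_def split: if_splits)
    moreover have "-1 \<le> w" if "w \<in> matched_widths G" for w
      using that by (auto simp: matched_widths_def td_width_def)
    ultimately show ?thesis using Least_int_in by blast
  qed
  then obtain T B where TB: "matched_tree_decomposition G T B" and t: "t = td_width T B"
    by (auto simp: matched_widths_def)
  then have td: "tree_decomposition G T B" by (simp add: matched_tree_decomposition_def)
  obtain xs par where xs: "xs \<noteq> []" "set xs = verts T" "running_intersection (map B xs) par"
    by (rule tree_decomposition_running_intersection[OF td])
  define bs where "bs = map B xs"
  have "\<exists>cs. (\<forall>(a, b)\<in>set cs. {a, b} \<in> edges G) \<and> (\<Union>(a, b)\<in>set cs. {a, b}) = bs ! i \<and> length cs \<le> ?K"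
    if i: "i < length bs" for i
  proof -
    have x: "xs ! i \<in> verts T" "bs ! i = B (xs ! i)" using i xs(2) nth_mem[of i xs] by (auto simp: bs_def)
    then have "matched_bag G (bs ! i)" using TB by (simp add: matched_tree_decomposition_def)
    then obtain cs where cs: "\<forall>(a, b)\<in>set cs. {a, b} \<in> edges G" "(\<Union>(a, b)\<in>set cs. {a, b}) = bs ! i"
      "2 * length cs \<le> card (bs ! i) + 1"
      by (rule matched_bag_edge_cover[OF assms(1)])
    have "card (bs ! i) \<le> Max ((\<lambda>x. card (B x)) ` verts T)"
      using x xs(2)[symmetric] by (intro Max_ge) auto
    then have "2 * int (length cs) \<le> t + 2" using cs(3) by (simp add: t td_width_def)
    then have "real_of_int (2 * int (length cs)) \<le> real_of_int (t + 2)" by (simp only: of_int_le_iff)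
    \<comment> \<open>Rounding: the integer \<open>length cs\<close> exceeds (t + 1) / 2 by at most
      1 / 2, so it is below the ceiling plus 1.\<close>
    then have "real (length cs) \<le> real_of_int (t + 1) / 2 + 1 / 2" by (simp add: field_simps)
    also have "\<dots> < real_of_int (\<lceil>real_of_int (t + 1) / 2\<rceil> + 1)"
      using le_of_int_ceiling[of "real_of_int (t + 1) / 2"] by linarith
    finally have "int (length cs) < \<lceil>real_of_int (t + 1) / 2\<rceil> + 1" by linarith
    then have "length cs \<le> ?K" by simp
    with cs show ?thesis by blast
  qed
  then obtain cs where cs: "\<And>i. i < length bs \<Longrightarrow> \<forall>(a, b)\<in>set (cs i). {a, b} \<in> edges G"
    "\<And>i. i < length bs \<Longrightarrow> (\<Union>(a, b)\<in>set (cs i). {a, b}) = bs ! i"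
    "\<And>i. i < length bs \<Longrightarrow> length (cs i) \<le> ?K" by metis
  have node: "\<exists>i<length bs. bs ! i = B x" if "x \<in> verts T" for x
    using that xs(2) unfolding bs_def by (metis in_set_conv_nth length_map nth_map)
  have "\<exists>i. i < length bs \<and> v \<in> bs ! i" if "v \<in> verts G" for v
  proof -
    have "connected_in T {x \<in> verts T. v \<in> B x}" using td that by (simp add: tree_decomposition_def)
    then obtain x where "x \<in> verts T" "v \<in> B x" unfolding connected_in_def by blast
    then show ?thesis using node by blast
  qed
  then obtain va where va: "\<And>v. v \<in> verts G \<Longrightarrow> va v < length bs \<and> v \<in> bs ! va v" by metis
  have "\<exists>i. i < length bs \<and> e \<subseteq> bs ! i" if "e \<in> edges G" for e
  proof -
    obtain x where "x \<in> verts T" "e \<subseteq> B x" using td \<open>e \<in> edges G\<close> unfolding tree_decomposition_def by blast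
    then show ?thesis using node by blast
  qed
  then obtain ea where ea: "\<And>e. e \<in> edges G \<Longrightarrow> ea e < length bs \<and> e \<subseteq> bs ! ea e" by metis
  have bs: "bs \<noteq> []" "running_intersection bs par" using xs by (simp_all add: bs_def)
  have cover_edges: "{fst e, snd e} \<in> edges G" if "i < length bs" "e \<in> set (cs i)" for i e
    using cs(1)[OF that(1)] that(2) by auto
  interpret covered_bags G bs par cs va ea
    by unfold_locales (fact assms(1) bs cover_edges cs(2) va ea)+
  show ?thesis
  proof (cases "?K = 0")
    \<comment> \<open>All covers are empty, and with them all bags.\<close>
    case True
    have "verts G = {}"
    proof (rule equals0I)
      fix v assume "v \<in> verts G"
      then have v: "va v < length bs" "v \<in> bs ! va v" using va by auto
      then have "cs (va v) = []" using cs(3) True by force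
      then show False using v cs(2)[of "va v"] by simp
    qed
    then show ?thesis unfolding True power_0
      using hom_poly_no_vertices_constructible[OF assms(1)] by blast
  next
    case False
    then show ?thesis using cs(3) by (intro hom_poly_constructible) auto
  qed
qed

end
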